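(* Let $V\subset\mathbb{C}^n$ be an unbounded complex algebraic set, and let $C_\infty(V)$ be its tangent cone at infinity. Then $\dim V=\dim C_\infty(V)$.
   Context: Let $V\subset\mathbb{C}^n$ be an unbounded subset and let $T=\{t_j\}_{j\in\mathbb{N}}$ be a sequence of positive real numbers with $\lim_{j\to\infty}t_j=\infty$. A vector $v\in\mathbb{C}^n$ is tangent to $V$ at infinity with respect to $T$ if there is a sequence $\{x_j\}_{j\in\mathbb{N}}\subset V$ with $\lim_{j\to\infty}\frac{1}{t_j}x_j=v$. Let $E_T(V)$ be the set of all such $v$; each $E_T(V)$ is called a tangent cone of $V$ at infinity. $V$ has a unique tangent cone at infinity if $E_T(V)$ is the same set for all such sequences $T$; this common set is denoted $C_\infty(V)$. It is known that every unbounded complex algebraic set $V\subset\mathbb{C}^n$ has a unique tangent cone at infinity, and that $C_\infty(V)$ is a complex algebraic set, namely $C_\infty(V)=\{v\in\mathbb{C}^n : f^*(v)=0 \text{ for all } f\in I(V)\}$, where $I(V)$ is the ideal of polynomials vanishing on $V$ and $f^*$ is the homogeneous component of highest degree of $f$. Dimensions are complex dimensions of algebraic sets. *)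

theory Defs
  imports "HOL-Analysis.Analysis" "HOL-Library.Extended_Nat" "HOL-Library.Poly_Mapping"
begin

type_synonym 'n cpoly = "('n \<Rightarrow>\<^sub>0 nat) \<Rightarrow>\<^sub>0 complex"

definition cpoly_eval :: "'n::finite cpoly \<Rightarrow> complex ^ 'n \<Rightarrow> complex" where
  "cpoly_eval p x =
     (\<Sum>m\<in>Poly_Mapping.keys p.
        Poly_Mapping.lookup p m * (\<Prod>i\<in>UNIV. (x $ i) ^ Poly_Mapping.lookup m i))"

(* S may be infinite; by Hilbert's basis theorem finite S would give the same sets. *)
definition algebraic_set :: "(complex ^ 'n::finite) set \<Rightarrow> bool" where
  "algebraic_set V \<longleftrightarrow> (\<exists>S :: 'n cpoly set. V = {x. \<forall>p\<in>S. cpoly_eval p x = 0})"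

definition irreducible_algebraic_set :: "(complex ^ 'n::finite) set \<Rightarrow> bool" where
  "irreducible_algebraic_set Z \<longleftrightarrow>
     algebraic_set Z \<and> Z \<noteq> {} \<and>
     (\<forall>A B. algebraic_set A \<longrightarrow> algebraic_set B \<longrightarrow> Z = A \<union> B \<longrightarrow> Z = A \<or> Z = B)"

(* Complex dimension of an algebraic set V, as the Krull dimension of V in the Zariski
   topology: the supremum of the lengths d of chains Z 0 < Z 1 < ... < Z d of irreducible
   algebraic subsets of V.  It is only meant for nonempty V; the empty set gets the junk
   value 0. *)
definition algebraic_dim :: "(complex ^ 'n::finite) set \<Rightarrow> enat" where
  "algebraic_dim V =
     (SUP d\<in>{d. \<exists>Z :: nat \<Rightarrow> (complex ^ 'n) set.
                   (\<forall>i\<le>d. irreducible_algebraic_set (Z i) \<and> Z i \<subseteq> V) \<and>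
                   (\<forall>i<d. Z i \<subset> Z (Suc i))}. enat d)"

definition tends_to_infinity :: "(nat \<Rightarrow> real) \<Rightarrow> bool" where
  "tends_to_infinity T \<longleftrightarrow> (\<forall>j. 0 < T j) \<and> filterlim T at_top sequentially"

(* E_T(V) *)
definition tangents_at_infinity ::
    "(nat \<Rightarrow> real) \<Rightarrow> (complex ^ 'n::finite) set \<Rightarrow> (complex ^ 'n) set" where
  "tangents_at_infinity T V =
     {v. \<exists>x :: nat \<Rightarrow> complex ^ 'n.
           (\<forall>j. x j \<in> V) \<and> (\<lambda>j. (1 / T j) *\<^sub>R x j) \<longlonglongrightarrow> v}"

definition is_unique_tangent_cone ::
    "(complex ^ 'n::finite) set \<Rightarrow> (complex ^ 'n) set \<Rightarrow> bool" where
  "is_unique_tangent_cone V C \<longleftrightarrow>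
     (\<forall>T. tends_to_infinity T \<longrightarrow> tangents_at_infinity T V = C)"

(* C_infinity(V); unspecified unless V has a unique tangent cone at infinity, as every
   unbounded algebraic set does. *)
definition tangent_cone_at_infinity :: "(complex ^ 'n::finite) set \<Rightarrow> (complex ^ 'n) set" where
  "tangent_cone_at_infinity V = (THE C. is_unique_tangent_cone V C)"

lemma tangent_cone_at_infinity_eqI:
  assumes "is_unique_tangent_cone V C"
  shows "tangent_cone_at_infinity V = C"
proof -
  have "filterlim (\<lambda>j. real (Suc j)) at_top sequentially"
    by (rule filterlim_compose[OF filterlim_real_sequentially filterlim_Suc])
  then have T: "tends_to_infinity (\<lambda>j. real (Suc j))"
    by (simp only: tends_to_infinity_def of_nat_0_less_iff zero_less_Suc simp_thms)
  have "D = C" if "is_unique_tangent_cone V D" for D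
    using assms that T by (metis is_unique_tangent_cone_def)
  with assms show ?thesis
    unfolding tangent_cone_at_infinity_def by (rule the_equality)
qed

end

theory Submission
  imports Defs "HOL-Computational_Algebra.Fundamental_Theorem_Algebra" "HOL-Library.Nat_Bijection"
begin

text \<open>
  Let \<open>C\<close> be the set of common zeros of the leading forms of all polynomials vanishing on \<open>V\<close>.
  If a direction \<open>e\<close> is not in \<open>C\<close>, then some polynomial vanishing on \<open>V\<close> is monic along \<open>e\<close>, so
  the projection of \<open>V\<close> along \<open>e\<close> is finite: images of algebraic sets are algebraic, chains of
  irreducible sets lift, and the growth order of the Hilbert function is preserved. Along any strict
  chain of irreducible sets this growth order increases, so it bounds the dimension from above.
  Projecting until the image is a coordinate subspace \<open>\<complex>\<^sup>d\<close> computes \<open>dim V = d\<close>, and since projections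
  carry cones to cones, the same projections compute \<open>dim C = d\<close>.

  Limits of rescaled points of \<open>V\<close> clearly lie in \<open>C\<close>. That conversely every \<open>v \<in> C\<close> is such a limit
  for every sequence of scales is shown by induction on the ambient dimension. In codimension at
  least two, project along a direction outside the join of \<open>C\<close> with \<open>v\<close>. In codimension one, \<open>V\<close>
  agrees with a hypersurface given by a monic polynomial outside a subset of smaller dimension, and
  the roots of a monic polynomial depend continuously on its coefficients.
\<close>

section \<open>Polynomial functions and their leading forms\<close>

text \<open>The dimension statement itself leans on the analytic half. That a projection maps the
  cone into the cone of the image is formal, but the opposite inclusion lifts a limit of rescaled
  image points to a limit of rescaled points of \<open>V\<close>, so every vector of the cone of the
  image must be known to be such a limit. In codimension one the lifting argument breaks down: the
  join of the cone with a vector may fill the whole space, and then no direction of projection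
  isolates the vector in its fibre. There the lift is replaced by a root of a monic polynomial, at
  the price of an exceptional set over the zeros of a discarded leading coefficient. Vanishing
  ideals are handled only through polynomial functions, linear algebra and estimates. Leading forms
  are taken with respect to a degree bound instead of the exact degree, so cancellation in sums
  needs no separate treatment.\<close>

text \<open>Here \<open>s\<close> is the homogenizing variable: \<open>h 1\<close> is a polynomial of degree at most \<open>k\<close> and \<open>h 0\<close> is its
  homogeneous component of degree \<open>k\<close>, which is zero if the degree is less than \<open>k\<close>.\<close>

inductive homog_poly :: "nat \<Rightarrow> (complex \<Rightarrow> complex ^ 'n::finite \<Rightarrow> complex) \<Rightarrow> bool" where
  homog_poly_const: "homog_poly 0 (\<lambda>s x. c)"
| homog_poly_s: "homog_poly 1 (\<lambda>s x. s)"
| homog_poly_var: "homog_poly 1 (\<lambda>s x. x $ i)"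
| homog_poly_add: "homog_poly k f \<Longrightarrow> homog_poly k g \<Longrightarrow> homog_poly k (\<lambda>s x. f s x + g s x)"
| homog_poly_mult: "homog_poly k f \<Longrightarrow> homog_poly l g \<Longrightarrow> homog_poly (k + l) (\<lambda>s x. f s x * g s x)"

definition poly_fun_deg :: "nat \<Rightarrow> (complex ^ 'n::finite \<Rightarrow> complex) \<Rightarrow> bool" where
  "poly_fun_deg k f \<longleftrightarrow> (\<exists>h. homog_poly k h \<and> f = h 1)"

definition poly_fun :: "(complex ^ 'n::finite \<Rightarrow> complex) \<Rightarrow> bool" where
  "poly_fun f \<longleftrightarrow> (\<exists>k. poly_fun_deg k f)"

lemma homog_poly_scale: "homog_poly k h \<Longrightarrow> h (c * s) (c *s x) = c ^ k * h s x"
  by (induction rule: homog_poly.induct) (simp_all add: algebra_simps power_add)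

lemma homog_poly_spow: "homog_poly k (\<lambda>s x. s ^ k)"
proof (induction k)
  case 0 show ?case using homog_poly_const[of 1] by simp
next
  case (Suc k)
  from homog_poly_mult[OF homog_poly_s Suc] show ?case by simp
qed

lemma homog_poly_varpow: "homog_poly k (\<lambda>s x. (x $ i) ^ k)"
proof (induction k)
  case 0 show ?case using homog_poly_const[of 1] by simp
next
  case (Suc k)
  from homog_poly_mult[OF homog_poly_var Suc] show ?case by simp
qed

lemma homog_poly_cmult: "homog_poly k h \<Longrightarrow> homog_poly k (\<lambda>s x. c * h s x)"
  using homog_poly_mult[OF homog_poly_const, of k h c] by simp

lemma homog_poly_zero: "homog_poly k (\<lambda>s x. 0)"
  using homog_poly_cmult[OF homog_poly_spow, of k 0] by simp

lemma homog_poly_uminus: "homog_poly k h \<Longrightarrow> homog_poly k (\<lambda>s x. - h s x)"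
  using homog_poly_cmult[of k h "-1"] by simp

lemma homog_poly_diff: "homog_poly k f \<Longrightarrow> homog_poly k g \<Longrightarrow> homog_poly k (\<lambda>s x. f s x - g s x)"
  using homog_poly_add[OF _ homog_poly_uminus, of k f g] by simp

lemma homog_poly_sum: "(\<And>i. i \<in> I \<Longrightarrow> homog_poly k (f i)) \<Longrightarrow> homog_poly k (\<lambda>s x. \<Sum>i\<in>I. f i s x)"
  by (induction I rule: infinite_finite_induct) (auto intro: homog_poly_zero homog_poly_add)

lemma homog_poly_mult_eq: "homog_poly k f \<Longrightarrow> homog_poly l g \<Longrightarrow> m = k + l \<Longrightarrow> homog_poly m (\<lambda>s x. f s x * g s x)"
  using homog_poly_mult by blast

lemma homog_poly_raise: "homog_poly k h \<Longrightarrow> k \<le> l \<Longrightarrow> homog_poly l (\<lambda>s x. s ^ (l - k) * h s x)"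
  by (rule homog_poly_mult_eq[OF homog_poly_spow]) auto

lemma homog_poly_0_const: "homog_poly 0 h \<Longrightarrow> h s x = h 0 0"
  using homog_poly_scale[of 0 h 0 s x] by simp

lemma homog_poly_at_origin: "homog_poly k h \<Longrightarrow> 0 < k \<Longrightarrow> h 0 0 = 0"
  using homog_poly_scale[of k h 0 0 0] by (cases k) auto

text \<open>Freezing \<open>s\<close> at 0 turns the leading form into a homogeneous polynomial that
  is its own leading form. This makes the cone algebraic and equal to its own cone.\<close>

lemma homog_poly_at0: "homog_poly k h \<Longrightarrow> homog_poly k (\<lambda>s x. h 0 x)"
  by (induction rule: homog_poly.induct) (auto intro: homog_poly.intros homog_poly_zero simp del: One_nat_def)

lemma homog_poly_at0_scale: "homog_poly k h \<Longrightarrow> h 0 (c *s x) = c ^ k * h 0 x"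
  using homog_poly_scale[of k h c 0 x] by simp

lemma homog_poly_continuous: "homog_poly k h \<Longrightarrow> continuous_on UNIV (\<lambda>p. h (fst p) (snd p))"
  by (induction rule: homog_poly.induct) (auto intro!: continuous_intros)

lemma homog_poly_tendsto:
  assumes "homog_poly k h" "(s \<longlongrightarrow> s0) F" "(x \<longlongrightarrow> x0) F"
  shows "((\<lambda>j. h (s j) (x j)) \<longlongrightarrow> h s0 x0) F"
proof -
  have "isCont (\<lambda>p. h (fst p) (snd p)) (s0, x0)"
    using homog_poly_continuous[OF assms(1)] by (simp add: continuous_on_eq_continuous_at)
  from isCont_tendsto_compose[OF this tendsto_Pair[OF assms(2,3)]] show ?thesis by simp
qed

lemma homog_poly_compose_linear:
  assumes "homog_poly k h" "\<And>j. homog_poly 1 (\<lambda>s x. L s x $ j)"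
  shows "homog_poly k (\<lambda>s x. h s (L s x))"
  using assms(1)
proof (induction rule: homog_poly.induct)
  case homog_poly_var show ?case by (rule assms(2))
qed (auto intro: homog_poly.intros simp del: One_nat_def)

text \<open>The coefficients are required to vanish beyond \<open>k\<close> because the convolution
  in the product case also meets indices outside the range, where the truncated degree
  \<open>k - j\<close> says nothing.\<close>

lemma homog_poly_line:
  assumes "homog_poly k h"
  obtains c where "\<And>j. j \<le> k \<Longrightarrow> homog_poly (k - j) (c j)" "\<And>j. j > k \<Longrightarrow> c j = (\<lambda>s y. 0)"
    "\<And>s y z. h s (y + z *s v) = (\<Sum>j\<le>k. c j s y * z ^ j)"
proof -
  have "\<exists>c. (\<forall>j\<le>k. homog_poly (k - j) (c j)) \<and> (\<forall>j>k. c j = (\<lambda>s y. 0)) \<and>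
    (\<forall>s y z. h s (y + z *s v) = (\<Sum>j\<le>k. c j s y * z ^ j))"
    using assms
  proof (induction rule: homog_poly.induct)
    case (homog_poly_const c)
    show ?case
      by (rule exI[of _ "\<lambda>j s y. if j = 0 then c else 0"]) (auto intro: homog_poly.intros)
  next
    case homog_poly_s
    show ?case
      by (rule exI[of _ "\<lambda>j s y. if j = 0 then s else 0"])
        (use homog_poly.homog_poly_s homog_poly_zero[of 0] in \<open>auto simp: le_Suc_eq\<close>)
  next
    case (homog_poly_var i)
    have "homog_poly (1 - j) (\<lambda>s y. if j = 0 then y $ i else if j = 1 then v $ i else 0)" if "j \<le> 1" for j
      using that homog_poly.homog_poly_var[of i] homog_poly.homog_poly_const[of "v $ i"] by (cases "j = 0") auto
    then show ?case
      by (intro exI[of _ "\<lambda>j s y. if j = 0 then y $ i else if j = 1 then v $ i else 0"]) auto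
  next
    case (homog_poly_add k f g)
    then obtain c d where c: "\<forall>j\<le>k. homog_poly (k - j) (c j)" "\<forall>j>k. c j = (\<lambda>s y. 0)"
      "\<forall>s y z. f s (y + z *s v) = (\<Sum>j\<le>k. c j s y * z ^ j)"
      and d: "\<forall>j\<le>k. homog_poly (k - j) (d j)" "\<forall>j>k. d j = (\<lambda>s y. 0)"
      "\<forall>s y z. g s (y + z *s v) = (\<Sum>j\<le>k. d j s y * z ^ j)" by blast
    show ?case
      by (rule exI[of _ "\<lambda>j s y. c j s y + d j s y"])
        (use c d in \<open>auto intro: homog_poly.intros simp: algebra_simps sum.distrib\<close>)
  next
    case (homog_poly_mult k f l g)
    then obtain c d where c: "\<forall>j\<le>k. homog_poly (k - j) (c j)" "\<forall>j>k. c j = (\<lambda>s y. 0)"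
      "\<forall>s y z. f s (y + z *s v) = (\<Sum>j\<le>k. c j s y * z ^ j)"
      and d: "\<forall>j\<le>l. homog_poly (l - j) (d j)" "\<forall>j>l. d j = (\<lambda>s y. 0)"
      "\<forall>s y z. g s (y + z *s v) = (\<Sum>j\<le>l. d j s y * z ^ j)" by blast
    have 1: "homog_poly (k + l - j) (\<lambda>s y. c i s y * d (j - i) s y)" if "j \<le> k + l" "i \<le> j" for i j
    proof (cases "i \<le> k \<and> j - i \<le> l")
      case True
      then show ?thesis using c(1) d(1) that by (intro homog_poly_mult_eq[of "k - i" _ "l - (j - i)"]) auto
    next
      case False
      then have "c i = (\<lambda>s y. 0) \<or> d (j - i) = (\<lambda>s y. 0)" using c(2) d(2) by auto
      then show ?thesis using homog_poly_zero by auto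
    qed
    have 2: "(\<Sum>i\<le>j. c i s y * d (j - i) s y) = 0" if "j > k + l" for j s y
    proof (rule sum.neutral, intro ballI)
      fix i assume "i \<in> {..j}"
      then have "i > k \<or> j - i > l" using that by auto
      then show "c i s y * d (j - i) s y = 0" using c(2) d(2) by auto
    qed
    have 3: "f s (y + z *s v) * g s (y + z *s v) = (\<Sum>j\<le>k + l. (\<Sum>i\<le>j. c i s y * d (j - i) s y) * z ^ j)" for s y z
      using c d by (simp add: polynomial_product)
    show ?case
      by (rule exI[of _ "\<lambda>j s y. \<Sum>i\<le>j. c i s y * d (j - i) s y"])
        (use 1 2 3 in \<open>auto intro!: homog_poly_sum\<close>)
  qed
  then show ?thesis using that by blast
qed

text \<open>The top coefficient has degree 0 and is constant, while at the origin all lower ones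
  vanish as forms of positive degree. So \<open>h 0 v\<close> being nonzero means that the
  polynomial is monic along \<open>v\<close> up to a constant factor.\<close>

lemma homog_poly_line_top:
  assumes "homog_poly k h" "homog_poly 0 (c k)" "\<And>j. j \<le> k \<Longrightarrow> homog_poly (k - j) (c j)"
    and eq: "\<And>s y z. h s (y + z *s v) = (\<Sum>j\<le>k. c j s y * z ^ j)"
  shows "c k s y = h 0 v"
proof -
  have "c j 0 0 * 1 ^ j = 0" if "j < k" for j
    using homog_poly_at_origin[OF assms(3)[of j]] that by simp
  then have "(\<Sum>j\<in>{..k}-{k}. c j 0 0 * 1 ^ j) = 0" by (intro sum.neutral) auto
  then have "h 0 v = c k 0 0"
    using eq[of 0 0 1] by (simp add: sum.remove[of "{..k}" k])
  then show ?thesis using homog_poly_0_const[OF assms(2)] by simp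
qed

text \<open>Collecting the terms divisible by \<open>s\<close> leaves the leading form. Where that
  form vanishes, \<open>g 1\<close> agrees with \<open>h 1\<close> and has a smaller degree
  bound.\<close>

lemma homog_poly_split_s:
  assumes "homog_poly (Suc k) h"
  obtains g where "homog_poly k g" "\<And>s x. h s x = s * g s x + h 0 x"
proof -
  \<comment> \<open>For \<open>k = 0\<close> the degree \<open>k - 1\<close> is truncated, so the
    quotient is required to be zero instead; the product case relies on this.\<close>
  have "\<exists>g. (if k = 0 then \<forall>s x. g s x = 0 else homog_poly (k - 1) g) \<and> (\<forall>s x. h s x = s * g s x + h 0 x)"
    if "homog_poly k h" for k and h :: "complex \<Rightarrow> complex ^ 'n \<Rightarrow> complex"
    using that
  proof (induction rule: homog_poly.induct)
    case (homog_poly_const c)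
    show ?case by (rule exI[of _ "\<lambda>s x. 0"]) auto
  next
    case homog_poly_s
    show ?case by (rule exI[of _ "\<lambda>s x. 1"]) (auto intro: homog_poly.intros)
  next
    case (homog_poly_var i)
    show ?case by (rule exI[of _ "\<lambda>s x. 0"]) (auto intro: homog_poly.intros)
  next
    case (homog_poly_add k f g)
    then obtain f' g' where f': "if k = 0 then \<forall>s x. f' s x = 0 else homog_poly (k - 1) f'"
      "\<forall>s x. f s x = s * f' s x + f 0 x" 
      and g': "if k = 0 then \<forall>s x. g' s x = 0 else homog_poly (k - 1) g'"
      "\<forall>s x. g s x = s * g' s x + g 0 x" by blast
    have "f s x + g s x = s * (f' s x + g' s x) + (f 0 x + g 0 x)" for s x
      using f'(2)[rule_format, of s x] g'(2)[rule_format, of s x] by (simp add: algebra_simps)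
    moreover have "if k = 0 then \<forall>s x. f' s x + g' s x = 0 else homog_poly (k - 1) (\<lambda>s x. f' s x + g' s x)"
      using f'(1) g'(1) by (simp add: homog_poly.homog_poly_add split: if_splits)
    ultimately show ?case by (intro exI[of _ "\<lambda>s x. f' s x + g' s x"] conjI allI)
  next
    case (homog_poly_mult k f l g)
    then obtain f' g' where f': "if k = 0 then \<forall>s x. f' s x = 0 else homog_poly (k - 1) f'"
      "\<And>s x. f s x = s * f' s x + f 0 x" 
      and g': "if l = 0 then \<forall>s x. g' s x = 0 else homog_poly (l - 1) g'"
      "\<And>s x. g s x = s * g' s x + g 0 x" by blast
    let ?q = "\<lambda>s x. f' s x * g s x + f 0 x * g' s x"
    have eq: "f s x * g s x = s * ?q s x + f 0 x * g 0 x" for s x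
    proof -
      have "f s x * g s x = s * (f' s x * g s x) + f 0 x * g s x"
        by (subst f'(2)) (simp add: algebra_simps)
      also have "f 0 x * g s x = f 0 x * (s * g' s x) + f 0 x * g 0 x"
        by (subst g'(2)) (simp add: algebra_simps)
      finally show ?thesis by (simp add: algebra_simps)
    qed
    have "if k + l = 0 then \<forall>s x. ?q s x = 0 else homog_poly (k + l - 1) ?q"
    proof (cases "k + l = 0")
      case True then show ?thesis using f'(1) g'(1) by auto
    next
      case False
      have "homog_poly (k + l - 1) (\<lambda>s x. f' s x * g s x)"
      proof (cases "k = 0")
        case True then show ?thesis using f'(1) homog_poly_zero by simp
      next
        case False then show ?thesis using f'(1) homog_poly_mult(2) by (intro homog_poly_mult_eq[of "k - 1" _ l]) auto
      qed
      moreover have "homog_poly (k + l - 1) (\<lambda>s x. f 0 x * g' s x)"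
      proof (cases "l = 0")
        case True then show ?thesis using g'(1) homog_poly_zero by simp
      next
        case False then show ?thesis using g'(1) homog_poly_at0[OF homog_poly_mult(1)] by (intro homog_poly_mult_eq[of k _ "l - 1"]) auto
      qed
      ultimately have "homog_poly (k + l - 1) ?q" by (rule homog_poly_add)
      then show ?thesis using False by auto
    qed
    with eq show ?case by (intro exI[of _ ?q] conjI allI)
  qed
  from this[OF assms] obtain g where "homog_poly k g" and eq: "\<forall>s x. h s x = s * g s x + h 0 x"
    by (metis Suc_neq_Zero diff_Suc_1)
  with that show ?thesis by blast
qed

section \<open>Polynomial functions of bounded degree\<close>

lemma poly_fun_deg_homog_poly: "homog_poly k h \<Longrightarrow> poly_fun_deg k (h 1)"
  by (auto simp: poly_fun_deg_def)

lemma poly_fun_deg_const: "poly_fun_deg k (\<lambda>x. c)"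
  using poly_fun_deg_homog_poly[OF homog_poly_cmult[OF homog_poly_spow]] by simp

lemma poly_fun_deg_var: "poly_fun_deg 1 (\<lambda>x. x $ i)"
  using poly_fun_deg_homog_poly[OF homog_poly_var] by simp

lemma poly_fun_deg_add: "poly_fun_deg k f \<Longrightarrow> poly_fun_deg k g \<Longrightarrow> poly_fun_deg k (\<lambda>x. f x + g x)"
  unfolding poly_fun_deg_def using homog_poly_add by blast

lemma poly_fun_deg_mult: "poly_fun_deg k f \<Longrightarrow> poly_fun_deg l g \<Longrightarrow> poly_fun_deg (k + l) (\<lambda>x. f x * g x)"
  unfolding poly_fun_deg_def using homog_poly_mult by blast

lemma poly_fun_deg_diff: "poly_fun_deg k f \<Longrightarrow> poly_fun_deg k g \<Longrightarrow> poly_fun_deg k (\<lambda>x. f x - g x)"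
  unfolding poly_fun_deg_def using homog_poly_diff by blast

lemma poly_fun_deg_cmult: "poly_fun_deg k f \<Longrightarrow> poly_fun_deg k (\<lambda>x. c * f x)"
  unfolding poly_fun_deg_def using homog_poly_cmult by blast

lemma poly_fun_deg_mono: "poly_fun_deg k f \<Longrightarrow> k \<le> l \<Longrightarrow> poly_fun_deg l f"
  using poly_fun_deg_mult[OF poly_fun_deg_const, of k f "l - k" 1] by simp

lemma poly_fun_deg_varpow: "poly_fun_deg k (\<lambda>x. (x $ i) ^ k)"
  using poly_fun_deg_homog_poly[OF homog_poly_varpow, of k i] by simp

lemma pfunI: "poly_fun_deg k f \<Longrightarrow> poly_fun f" by (auto simp: poly_fun_def)

lemma poly_fun_const: "poly_fun (\<lambda>x. c)" using poly_fun_deg_const pfunI by blast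

lemma poly_fun_var: "poly_fun (\<lambda>x. x $ i)" using poly_fun_deg_var pfunI by blast

lemma poly_fun_add: "poly_fun f \<Longrightarrow> poly_fun g \<Longrightarrow> poly_fun (\<lambda>x. f x + g x)"
  unfolding poly_fun_def
  using poly_fun_deg_add[OF poly_fun_deg_mono[OF _ max.cobounded1] poly_fun_deg_mono[OF _ max.cobounded2]] by blast

lemma poly_fun_diff: "poly_fun f \<Longrightarrow> poly_fun g \<Longrightarrow> poly_fun (\<lambda>x. f x - g x)"
  unfolding poly_fun_def
  using poly_fun_deg_diff[OF poly_fun_deg_mono[OF _ max.cobounded1] poly_fun_deg_mono[OF _ max.cobounded2]] by blast

lemma poly_fun_mult: "poly_fun f \<Longrightarrow> poly_fun g \<Longrightarrow> poly_fun (\<lambda>x. f x * g x)"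
  unfolding poly_fun_def using poly_fun_deg_mult by blast

lemma poly_fun_sum: "(\<And>i. i \<in> I \<Longrightarrow> poly_fun (f i)) \<Longrightarrow> poly_fun (\<lambda>x. \<Sum>i\<in>I. f i x)"
  by (induction I rule: infinite_finite_induct) (auto intro: poly_fun_const poly_fun_add)

lemma poly_fun_power: "poly_fun f \<Longrightarrow> poly_fun (\<lambda>x. f x ^ k)"
  by (induction k) (auto intro: poly_fun_const poly_fun_mult)

lemma poly_fun_prod: "(\<And>i. i \<in> I \<Longrightarrow> poly_fun (f i)) \<Longrightarrow> poly_fun (\<lambda>x. \<Prod>i\<in>I. f i x)"
  by (induction I rule: infinite_finite_induct) (auto intro: poly_fun_const poly_fun_mult)

section \<open>Formal polynomials and their evaluation\<close>

lemma poly_fun_cpoly_eval: "poly_fun (cpoly_eval p)"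
  unfolding cpoly_eval_def by (intro poly_fun_sum poly_fun_mult poly_fun_const poly_fun_prod poly_fun_power poly_fun_var)

definition mono_fun :: "('n::finite \<Rightarrow> nat) \<Rightarrow> complex ^ 'n \<Rightarrow> complex" where
  "mono_fun m x = (\<Prod>i\<in>UNIV. x $ i ^ m i)"

lemma cpoly_eval_add: "cpoly_eval (p + q) x = cpoly_eval p x + cpoly_eval q x"
proof -
  let ?K = "Poly_Mapping.keys p \<union> Poly_Mapping.keys q"
  have *: "cpoly_eval r x = (\<Sum>m\<in>?K. Poly_Mapping.lookup r m * mono_fun (Poly_Mapping.lookup m) x)"
    if "Poly_Mapping.keys r \<subseteq> ?K" for r
    unfolding cpoly_eval_def mono_fun_def
    by (rule sum.mono_neutral_left) (use that in \<open>auto simp: in_keys_iff\<close>)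
  have "Poly_Mapping.keys (p + q) \<subseteq> ?K" by (rule Poly_Mapping.keys_add)
  then show ?thesis by (simp add: * lookup_add distrib_right sum.distrib)
qed

lemma cpoly_eval_single: "cpoly_eval (Poly_Mapping.single m c) x = c * mono_fun (Poly_Mapping.lookup m) x"
  by (cases "c = 0") (simp_all add: cpoly_eval_def mono_fun_def)

lemma lookup_surj: "\<exists>m :: 'n::finite \<Rightarrow>\<^sub>0 nat. Poly_Mapping.lookup m = f"
  by (rule exI[of _ "Abs_poly_mapping f"]) simp

text \<open>Evaluations of formal polynomials contain constants and coordinates and are closed under
  sums and products; a product is expanded into a double sum of monomials.\<close>

lemma poly_fun_is_cpoly_eval:
  fixes f :: "complex ^ 'n::finite \<Rightarrow> complex"
  assumes "poly_fun f"
  obtains p where "f = cpoly_eval p"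
proof -
  let ?P = "\<lambda>f. \<exists>p :: 'n cpoly. f = cpoly_eval p"
  have add: "?P (\<lambda>x. f x + g x)" if "?P f" "?P g" for f g :: "complex ^ 'n \<Rightarrow> complex"
  proof -
    from that obtain p q where "f = cpoly_eval p" "g = cpoly_eval q" by blast
    then have "(\<lambda>x. f x + g x) = cpoly_eval (p + q)" by (auto simp: cpoly_eval_add)
    then show ?thesis by blast
  qed
  have mono: "?P (\<lambda>x. c * mono_fun m x)" for c and m :: "'n \<Rightarrow> nat"
  proof -
    obtain m' where "Poly_Mapping.lookup m' = m" using lookup_surj by blast
    then have "(\<lambda>x. c * mono_fun m x) = cpoly_eval (Poly_Mapping.single m' c)"
      by (auto simp: cpoly_eval_single)
    then show ?thesis by blast
  qed
  have zero: "?P (\<lambda>x. 0)" using mono[of 0] by simp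
  have sum: "?P (\<lambda>x. \<Sum>i\<in>I. f i x)" if "\<And>i. i \<in> I \<Longrightarrow> ?P (f i)"
    for I :: "'c set" and f :: "'c \<Rightarrow> complex ^ 'n \<Rightarrow> complex"
    using that
  proof (induction I rule: infinite_finite_induct)
    case (infinite I) then show ?case using zero by simp
  next
    case empty then show ?case using zero by simp
  next
    case (insert i I)
    have "?P (\<lambda>x. f i x + (\<Sum>i\<in>I. f i x))" by (rule add) (use insert in auto)
    then show ?case using insert by simp
  qed
  have mult: "?P (\<lambda>x. f x * g x)" if "?P f" "?P g" for f g :: "complex ^ 'n \<Rightarrow> complex"
  proof -
    from that obtain p q where pq: "f = cpoly_eval p" "g = cpoly_eval q" by blast
    have "(\<lambda>x. f x * g x) = (\<lambda>x. \<Sum>m\<in>Poly_Mapping.keys p. \<Sum>m'\<in>Poly_Mapping.keys q.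
      (Poly_Mapping.lookup p m * Poly_Mapping.lookup q m') * mono_fun (\<lambda>i. Poly_Mapping.lookup m i + Poly_Mapping.lookup m' i) x)"
      by (simp add: pq cpoly_eval_def sum_product mono_fun_def power_add prod.distrib mult_ac)
    moreover have "?P \<dots>" by (intro sum mono)
    ultimately show ?thesis by (simp only:)
  qed
  have const: "?P (\<lambda>x. c)" for c
    using mono[of c "\<lambda>_. 0"] by (simp add: mono_fun_def)
  have var: "?P (\<lambda>x. x $ i)" for i
  proof -
    have "mono_fun (\<lambda>j. if j = i then 1 else 0) x = x $ i" for x :: "complex ^ 'n"
    proof -
      have "mono_fun (\<lambda>j. if j = i then 1 else 0) x = (\<Prod>j\<in>UNIV. if j = i then x $ j else 1)"
        unfolding mono_fun_def by (intro prod.cong) auto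
      then show ?thesis by simp
    qed
    then show ?thesis using mono[of 1 "\<lambda>j. if j = i then 1 else 0"] by simp
  qed
  have "?P (h s)" if "homog_poly k h" for k h s
    using that
  proof (induction rule: homog_poly.induct)
    case (homog_poly_add k f g) show ?case by (rule add[OF homog_poly_add(3,4)])
  next
    case (homog_poly_mult k f l g) show ?case by (rule mult[OF homog_poly_mult(3,4)])
  qed (rule const var)+
  then show ?thesis using assms that by (auto simp: poly_fun_def poly_fun_deg_def)
qed

section \<open>Algebraic sets through separating polynomials\<close>

text \<open>A point outside is separated from \<open>V\<close> by one of the defining polynomials;
  conversely all polynomials vanishing on \<open>V\<close> serve as equations. Closedness can then
  be tested one point at a time.\<close>

lemma algebraic_set_iff:
  "algebraic_set V \<longleftrightarrow> (\<forall>x. x \<notin> V \<longrightarrow> (\<exists>f. poly_fun f \<and> (\<forall>y\<in>V. f y = 0) \<and> f x \<noteq> 0))"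
proof
  assume "algebraic_set V"
  then obtain S where S: "V = {x. \<forall>p\<in>S. cpoly_eval p x = 0}" by (auto simp: algebraic_set_def)
  show "\<forall>x. x \<notin> V \<longrightarrow> (\<exists>f. poly_fun f \<and> (\<forall>y\<in>V. f y = 0) \<and> f x \<noteq> 0)"
  proof (intro allI impI)
    fix x assume "x \<notin> V"
    then obtain p where "p \<in> S" "cpoly_eval p x \<noteq> 0" using S by auto
    then show "\<exists>f. poly_fun f \<and> (\<forall>y\<in>V. f y = 0) \<and> f x \<noteq> 0"
      using S by (intro exI[of _ "cpoly_eval p"]) (auto simp: poly_fun_cpoly_eval)
  qed
next
  assume R: "\<forall>x. x \<notin> V \<longrightarrow> (\<exists>f. poly_fun f \<and> (\<forall>y\<in>V. f y = 0) \<and> f x \<noteq> 0)"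
  have "V = {x. \<forall>p\<in>{p. \<forall>y\<in>V. cpoly_eval p y = 0}. cpoly_eval p x = 0}"
    using R by auto (metis poly_fun_is_cpoly_eval)
  then show "algebraic_set V" unfolding algebraic_set_def by blast
qed

lemma algebraic_setI:
  "(\<And>x. x \<notin> V \<Longrightarrow> \<exists>f. poly_fun f \<and> (\<forall>y\<in>V. f y = 0) \<and> f x \<noteq> 0) \<Longrightarrow> algebraic_set V"
  by (auto simp: algebraic_set_iff)

lemma algebraic_setE:
  assumes "algebraic_set V" "x \<notin> V"
  obtains f where "poly_fun f" "\<And>y. y \<in> V \<Longrightarrow> f y = 0" "f x \<noteq> 0"
  using assms by (auto simp: algebraic_set_iff)

lemma algebraic_zero_set: "poly_fun f \<Longrightarrow> algebraic_set {x. f x = 0}"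
  by (rule algebraic_setI) auto

lemma algebraic_Inter: "(\<And>A. A \<in> \<A> \<Longrightarrow> algebraic_set A) \<Longrightarrow> algebraic_set (\<Inter>\<A>)"
proof (rule algebraic_setI)
  fix x assume A: "\<And>A. A \<in> \<A> \<Longrightarrow> algebraic_set A" and "x \<notin> \<Inter>\<A>"
  then obtain A where "A \<in> \<A>" "x \<notin> A" by auto
  with A[of A] show "\<exists>f. poly_fun f \<and> (\<forall>y\<in>\<Inter>\<A>. f y = 0) \<and> f x \<noteq> 0"
    by (metis InterE algebraic_setE)
qed

lemma algebraic_Int: "algebraic_set A \<Longrightarrow> algebraic_set B \<Longrightarrow> algebraic_set (A \<inter> B)"
  using algebraic_Inter[of "{A, B}"] by auto

section \<open>Projection along a direction\<close>

text \<open>With \<open>e $ i = 1\<close> this is the projection along \<open>e\<close> onto the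
  hyperplane \<open>x $ i = 0\<close>. The image stays in the same space, so repeated projections
  remain within one type.\<close>

definition proj_along :: "'n \<Rightarrow> complex ^ 'n \<Rightarrow> complex ^ 'n \<Rightarrow> complex ^ 'n::finite" where
  "proj_along i e x = x - (x $ i) *s e"

lemma proj_along_decomp: "proj_along i e x + (x $ i) *s e = x"
  by (simp add: proj_along_def)

lemma proj_along_nth: "e $ i = 1 \<Longrightarrow> proj_along i e x $ i = 0"
  by (simp add: proj_along_def)

lemma proj_along_add: "e $ i = 1 \<Longrightarrow> y $ i = 0 \<Longrightarrow> proj_along i e (y + z *s e) = y"
  by (simp add: proj_along_def)

lemma proj_along_scaleR: "proj_along i e (r *\<^sub>R x) = r *\<^sub>R proj_along i e x"
  by (simp add: proj_along_def vec_eq_iff scaleR_diff_right)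

lemma homog_poly_proj_along: "homog_poly k h \<Longrightarrow> homog_poly k (\<lambda>s x. h s (proj_along i e x))"
proof (rule homog_poly_compose_linear)
  fix j
  have "homog_poly 1 (\<lambda>(s::complex) x. x $ j - e $ j * x $ i)"
    by (intro homog_poly_diff homog_poly_var homog_poly_cmult)
  then show "homog_poly 1 (\<lambda>(s::complex) x. proj_along i e x $ j)"
    by (simp add: proj_along_def mult.commute)
qed

lemma poly_fun_deg_proj_along: "poly_fun_deg k f \<Longrightarrow> poly_fun_deg k (\<lambda>x. f (proj_along i e x))"
  unfolding poly_fun_deg_def using homog_poly_proj_along by blast

lemma poly_fun_proj_along: "poly_fun f \<Longrightarrow> poly_fun (\<lambda>x. f (proj_along i e x))"
  unfolding poly_fun_def using poly_fun_deg_proj_along by blast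

lemma tendsto_vec_smult:
  assumes "(f \<longlongrightarrow> c) F" "(g \<longlongrightarrow> x) F"
  shows "((\<lambda>j. f j *s g j) \<longlongrightarrow> c *s (x :: complex ^ 'n::finite)) F"
  by (rule vec_tendstoI) (auto intro!: tendsto_intros assms)

lemma tendsto_proj_along: "(x \<longlongrightarrow> a) F \<Longrightarrow> ((\<lambda>j. proj_along i e (x j)) \<longlongrightarrow> proj_along i e a) F"
  unfolding proj_along_def by (intro tendsto_intros tendsto_vec_smult)

section \<open>Restriction to lines and division with remainder\<close>

lemma poly_fun_deg_line:
  assumes "poly_fun_deg k p"
  obtains c where "\<And>j. j \<le> k \<Longrightarrow> poly_fun_deg (k - j) (c j)"
    "\<And>y z. p (y + z *s v) = (\<Sum>j\<le>k. c j y * z ^ j)"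
proof -
  from assms obtain h where h: "homog_poly k h" "p = h 1" by (auto simp: poly_fun_deg_def)
  obtain c where c: "\<And>j. j \<le> k \<Longrightarrow> homog_poly (k - j) (c j)" "\<And>j. j > k \<Longrightarrow> c j = (\<lambda>s y. 0)"
    "\<And>s y z. h s (y + z *s v) = (\<Sum>j\<le>k. c j s y * z ^ j)" by (rule homog_poly_line[OF h(1), where v = v]) blast
  show ?thesis by (rule that[of "\<lambda>j. c j 1"]) (use c h in \<open>auto intro: poly_fun_deg_homog_poly\<close>)
qed

lemma homog_poly_line_monic:
  assumes "homog_poly k h"
  obtains c where "\<And>j. j \<le> k \<Longrightarrow> poly_fun_deg (k - j) (c j)" "\<And>y. c k y = h 0 v"
    "\<And>y z. h 1 (y + z *s v) = (\<Sum>j\<le>k. c j y * z ^ j)"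
proof -
  obtain c where c: "\<And>j. j \<le> k \<Longrightarrow> homog_poly (k - j) (c j)" "\<And>j. j > k \<Longrightarrow> c j = (\<lambda>s y. 0)"
    "\<And>s y z. h s (y + z *s v) = (\<Sum>j\<le>k. c j s y * z ^ j)" by (rule homog_poly_line[OF assms, where v = v]) blast
  have "homog_poly 0 (c k)" using c(1)[of k] by simp
  from homog_poly_line_top[OF assms this c(1,3)] have "c k s y = h 0 v" for s y by blast
  then show ?thesis by (intro that[of "\<lambda>j. c j 1"]) (use c in \<open>auto intro: poly_fun_deg_homog_poly\<close>)
qed

lemma homog_poly_line_poly:
  assumes "homog_poly k h"
  obtains q :: "complex poly" where "degree q \<le> k" "coeff q k = h 0 v" "\<And>z. poly q z = h 1 (y + z *s v)"
proof -
  obtain c where c: "\<And>j. j \<le> k \<Longrightarrow> poly_fun_deg (k - j) (c j)" "\<And>y. c k y = h 0 v"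
    "\<And>y z. h 1 (y + z *s v) = (\<Sum>j\<le>k. c j y * z ^ j)" by (rule homog_poly_line_monic[OF assms, where v = v]) blast
  let ?q = "\<Sum>j\<le>k. monom (c j y) j"
  have "coeff ?q k = h 0 v" by (simp add: coeff_sum c(2))
  moreover have "degree ?q \<le> k" by (intro degree_sum_le) (auto intro: order.trans[OF degree_monom_le])
  ultimately show ?thesis by (intro that[of ?q]) (auto simp: poly_sum poly_monom c(3))
qed

lemma poly_fun_line_poly:
  assumes "poly_fun f"
  obtains q :: "complex poly" where "\<And>z. poly q z = f (y + z *s v)"
  using assms unfolding poly_fun_def poly_fun_deg_def by (metis homog_poly_line_poly)

text \<open>Index bookkeeping for multiplying a polynomial in \<open>z\<close> by
  \<open>z ^ n\<close>, as each division step does.\<close>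

lemma sum_shift_if:
  "(\<Sum>j<n + m. (if n \<le> j then g (j - n) else 0) * z ^ j) = (\<Sum>l<m. g l * (z :: complex) ^ (n + l))"
proof (induction m)
  case 0
  have "(\<Sum>j<n. (if n \<le> j then g (j - n) else 0) * z ^ j) = 0" by (intro sum.neutral) auto
  then show ?case by simp
next
  case (Suc m) then show ?case by simp
qed

text \<open>The leading coefficient of \<open>f\<close> along \<open>e\<close> is the nonzero
  constant \<open>f 0 e\<close>, so no denominators arise. The weighted bound, degree at most
  \<open>k - j\<close> for the \<open>j\<close>-th coefficient, survives each step; hence the
  remainder stays within degree \<open>k\<close>, as the estimates of Hilbert functions
  require.\<close>

lemma poly_fun_deg_division:
  assumes f: "homog_poly m f" "f 0 e \<noteq> 0" and g: "poly_fun_deg k g" and e: "e $ i = 1"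
  obtains Q r where "poly_fun Q" "\<And>j. j < m \<Longrightarrow> poly_fun_deg k (r j)"
    "\<And>x. g x = Q x * f 1 x + (\<Sum>j<m. r j (proj_along i e x) * (x $ i) ^ j)"
proof -
  obtain c where c: "\<And>j. j \<le> m \<Longrightarrow> poly_fun_deg (m - j) (c j)" "\<And>y. c m y = f 0 e"
    "\<And>y z. f 1 (y + z *s e) = (\<Sum>j\<le>m. c j y * z ^ j)" by (rule homog_poly_line_monic[OF f(1), where v = e]) blast
  define a where "a = f 0 e"
  have a: "a \<noteq> 0" using f(2) by (simp add: a_def)
  have fx: "f 1 x = (\<Sum>j<m. c j (proj_along i e x) * (x $ i) ^ j) + a * (x $ i) ^ m" for x
    using c(3)[of "proj_along i e x" "x $ i"] c(2) by (simp add: proj_along_decomp lessThan_Suc_atMost[symmetric] a_def)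
  let ?res = "\<lambda>g. \<exists>Q r. poly_fun Q \<and> (\<forall>j<m. poly_fun_deg k (r j)) \<and>
    (\<forall>x. g x = Q x * f 1 x + (\<Sum>j<m. r j (proj_along i e x) * (x $ i) ^ j))"
  have main: "?res g" if "J \<le> k + 1" "\<forall>j<J. poly_fun_deg (k - j) (d j)"
    "\<forall>x. g x = (\<Sum>j<J. d j (proj_along i e x) * (x $ i) ^ j)" for J g d
    using that
  proof (induction J arbitrary: g d)
    case 0
    then show ?case
      by (intro exI[of _ "\<lambda>x. 0"] exI[of _ "\<lambda>j x. 0"]) (auto intro: poly_fun_const poly_fun_deg_const)
  next
    case (Suc J)
    show ?case
    proof (cases "Suc J \<le> m")
      case True
      let ?r = "\<lambda>j. if j < Suc J then d j else (\<lambda>x. 0)"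
      have "(\<Sum>j<Suc J. d j (proj_along i e x) * (x $ i) ^ j) = (\<Sum>j<m. ?r j (proj_along i e x) * (x $ i) ^ j)" for x
        by (rule sum.mono_neutral_cong_left) (use True in auto)
      moreover have "poly_fun_deg k (?r j)" for j
      proof (cases "j < Suc J")
        case True then show ?thesis using Suc.prems(2) poly_fun_deg_mono[of "k - j" "d j" k] by auto
      qed (simp add: poly_fun_deg_const)
      ultimately show ?thesis using Suc.prems(3)
        by (intro exI[of _ "\<lambda>x. 0"] exI[of _ ?r]) (auto intro: poly_fun_const)
    next
      case False
      \<comment> \<open>\<open>n\<close> is the power of \<open>x $ i\<close> by which
        \<open>f\<close> is multiplied to cancel the current top term.\<close>
      then obtain n where J: "J = n + m" by (metis not_less_eq_eq le_Suc_ex add.commute not_less)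
      let ?t = "\<lambda>y. d J y / a"
      let ?d = "\<lambda>j y. d j y - (if n \<le> j then ?t y * c (j - n) y else 0)"
      let ?g = "\<lambda>x. g x - ?t (proj_along i e x) * (x $ i) ^ n * f 1 x"
      have tpf: "poly_fun_deg (k - J) ?t"
        using poly_fun_deg_cmult[of "k - J" "d J" "1 / a"] Suc.prems(2) by simp
      have "poly_fun_deg (k - j) (?d j)" if j: "j < J" for j
      proof -
        have 1: "poly_fun_deg (k - j) (d j)" using Suc.prems(2) j by simp
        have 2: "poly_fun_deg (k - j) (\<lambda>y. if n \<le> j then ?t y * c (j - n) y else 0)"
        proof (cases "n \<le> j")
          case True
          have "poly_fun_deg ((k - J) + (m - (j - n))) (\<lambda>y. ?t y * c (j - n) y)"
            by (intro poly_fun_deg_mult tpf c(1)) (use j J in auto)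
          moreover have "(k - J) + (m - (j - n)) = k - j" using j J True Suc.prems(1) by auto
          ultimately show ?thesis using True by simp
        qed (simp add: poly_fun_deg_const)
        from poly_fun_deg_diff[OF 1 2] show ?thesis .
      qed
      moreover have "?g x = (\<Sum>j<J. ?d j (proj_along i e x) * (x $ i) ^ j)" for x
      proof -
        obtain y z where yz: "proj_along i e x = y" "x $ i = z" by blast
        have "(\<Sum>j<J. ?d j y * z ^ j) = (\<Sum>j<J. d j y * z ^ j) -
            (\<Sum>j<n + m. (if n \<le> j then ?t y * c (j - n) y else 0) * z ^ j)"
          by (simp add: sum_subtractf left_diff_distrib J)
        also have "\<dots> = (\<Sum>j<J. d j y * z ^ j) - ?t y * z ^ n * (\<Sum>l<m. c l y * z ^ l)"
          by (subst sum_shift_if) (simp add: sum_distrib_left power_add mult_ac)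
        also have "\<dots> = ?g x"
          using Suc.prems(3) a by (simp add: fx yz J power_add field_simps)
        finally show ?thesis unfolding yz by (rule sym)
      qed
      ultimately have "?res ?g" using Suc.prems(1) by (intro Suc.IH[of ?d]) auto
      then obtain Q r where Q: "poly_fun Q" "\<forall>j<m. poly_fun_deg k (r j)"
        "\<forall>x. ?g x = Q x * f 1 x + (\<Sum>j<m. r j (proj_along i e x) * (x $ i) ^ j)" by blast
      have "poly_fun (\<lambda>x. Q x + ?t (proj_along i e x) * (x $ i) ^ n)"
        by (intro poly_fun_add Q poly_fun_mult poly_fun_power poly_fun_var pfunI[OF poly_fun_deg_proj_along[OF tpf]])
      moreover have "g x = (Q x + ?t (proj_along i e x) * (x $ i) ^ n) * f 1 x + (\<Sum>j<m. r j (proj_along i e x) * (x $ i) ^ j)" for x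
        using Q(3)[rule_format, of x] by (simp add: algebra_simps)
      ultimately show ?thesis using Q(2) by blast
    qed
  qed
  obtain d where d: "\<And>j. j \<le> k \<Longrightarrow> poly_fun_deg (k - j) (d j)"
    "\<And>y z. g (y + z *s e) = (\<Sum>j\<le>k. d j y * z ^ j)" by (rule poly_fun_deg_line[OF g, where v = e]) blast
  have "g x = (\<Sum>j<k + 1. d j (proj_along i e x) * (x $ i) ^ j)" for x
    using d(2)[of "proj_along i e x" "x $ i"] by (simp add: proj_along_decomp lessThan_Suc_atMost)
  then have "?res g" using d(1) by (intro main[of "k + 1" d]) auto
  then show ?thesis using that by blast
qed

section \<open>Images of algebraic sets under projection\<close>

text \<open>Fraction-free Gaussian elimination.\<close>

lemma elimination:
  fixes M :: "'a \<Rightarrow> nat \<Rightarrow> complex ^ 'n::finite \<Rightarrow> complex"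
  assumes "finite J" "\<And>a b. a \<in> A \<Longrightarrow> b \<in> J \<Longrightarrow> poly_fun (M a b)"
    and "\<And>u. \<forall>a\<in>A. (\<Sum>b\<in>J. M a b y0 * u b) = 0 \<Longrightarrow> \<forall>b\<in>J. u b = 0"
  shows "\<exists>g. poly_fun g \<and> g y0 \<noteq> 0 \<and>
    (\<forall>y u. (\<forall>a\<in>A. (\<Sum>b\<in>J. M a b y * u b) = 0) \<longrightarrow> (\<exists>b\<in>J. u b \<noteq> 0) \<longrightarrow> g y = 0)"
  using assms
proof (induction J arbitrary: M rule: finite_induct)
  case empty
  show ?case by (rule exI[of _ "\<lambda>x. 1"]) (auto intro: poly_fun_const)
next
  case (insert b0 J)
  have "\<exists>a0\<in>A. M a0 b0 y0 \<noteq> 0"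
  proof (rule ccontr)
    assume "\<not> ?thesis"
    \<comment> \<open>If the column of \<open>b0\<close> vanished at \<open>y0\<close>, the unit
      vector at \<open>b0\<close> would be a nonzero solution.\<close>
    then have "\<forall>a\<in>A. (\<Sum>b\<in>insert b0 J. M a b y0 * (if b = b0 then 1 else 0)) = 0"
      using insert.hyps by (auto intro!: sum.neutral)
    from insert.prems(2)[OF this] show False by simp
  qed
  then obtain a0 where a0: "a0 \<in> A" "M a0 b0 y0 \<noteq> 0" by blast
  define M' where "M' a b y = M a0 b0 y * M a b y - M a b0 y * M a0 b y" for a b y
  have M'_sum: "(\<Sum>b\<in>J. M' a b y * u b) =
    M a0 b0 y * (\<Sum>b\<in>J. M a b y * u b) - M a b0 y * (\<Sum>b\<in>J. M a0 b y * u b)" for a y u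
    by (simp add: M'_def sum_subtractf sum_distrib_left algebra_simps)
  have "\<exists>g. poly_fun g \<and> g y0 \<noteq> 0 \<and>
    (\<forall>y u. (\<forall>a\<in>A. (\<Sum>b\<in>J. M' a b y * u b) = 0) \<longrightarrow> (\<exists>b\<in>J. u b \<noteq> 0) \<longrightarrow> g y = 0)"
  proof (rule insert.IH)
    show "poly_fun (M' a b)" if "a \<in> A" "b \<in> J" for a b
      unfolding M'_def using that a0 insert.prems(1) by (intro poly_fun_diff poly_fun_mult) auto
    show "\<forall>b\<in>J. u b = 0" if u: "\<forall>a\<in>A. (\<Sum>b\<in>J. M' a b y0 * u b) = 0" for u
    proof -
      \<comment> \<open>The value at \<open>b0\<close> is forced by row \<open>a0\<close>; it
        extends a solution of the reduced system to one of the full system at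
        \<open>y0\<close>.\<close>
      define w where "w = u(b0 := - (\<Sum>b\<in>J. M a0 b y0 * u b) / M a0 b0 y0)"
      have wJ: "(\<Sum>b\<in>J. M a b y0 * w b) = (\<Sum>b\<in>J. M a b y0 * u b)" for a
        by (intro sum.cong) (use insert.hyps in \<open>auto simp: w_def\<close>)
      have "\<forall>a\<in>A. (\<Sum>b\<in>insert b0 J. M a b y0 * w b) = 0"
        using u a0 insert.hyps by (simp add: wJ M'_sum) (simp add: w_def field_simps)
      from insert.prems(2)[OF this] show ?thesis using insert.hyps by (auto simp: w_def split: if_splits)
    qed
  qed
  then obtain g where g: "poly_fun g" "g y0 \<noteq> 0"
    "\<And>y u. \<forall>a\<in>A. (\<Sum>b\<in>J. M' a b y * u b) = 0 \<Longrightarrow> \<exists>b\<in>J. u b \<noteq> 0 \<Longrightarrow> g y = 0" by blast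
  \<comment> \<open>The factor \<open>M a0 b0 y\<close> makes the product vanish also where the
    pivot is zero and elimination is impossible.\<close>
  have "M a0 b0 y * g y = 0"
    if u: "\<forall>a\<in>A. (\<Sum>b\<in>insert b0 J. M a b y * u b) = 0" and nz: "\<exists>b\<in>insert b0 J. u b \<noteq> 0" for y u
  proof (cases "M a0 b0 y = 0")
    case False
    have row: "(\<Sum>b\<in>J. M a b y * u b) = - M a b0 y * u b0" if "a \<in> A" for a
      using u that insert.hyps by (simp add: eq_neg_iff_add_eq_0 add.commute)
    have "\<exists>b\<in>J. u b \<noteq> 0"
    proof (rule ccontr)
      assume *: "\<not> ?thesis"
      then have "u b0 = 0" using row[OF a0(1)] False by simp
      then show False using nz * by auto
    qed
    moreover have "\<forall>a\<in>A. (\<Sum>b\<in>J. M' a b y * u b) = 0"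
      using row a0(1) by (simp add: M'_sum)
    ultimately show ?thesis using g(3) by simp
  qed simp
  moreover have "poly_fun (\<lambda>y. M a0 b0 y * g y)"
    using insert.prems(1) a0 g by (intro poly_fun_mult) auto
  ultimately show ?case using a0 g by (intro exI[of _ "\<lambda>y. M a0 b0 y * g y"]) auto
qed

text \<open>A nonzero element of least degree must be constant: if it had a root, dividing it into
  an element not vanishing there would leave a nonzero remainder of smaller degree.\<close>

lemma poly_ideal_one:
  fixes S :: "complex poly set"
  assumes add: "\<And>p q. p \<in> S \<Longrightarrow> q \<in> S \<Longrightarrow> p + q \<in> S" and mult: "\<And>p q. q \<in> S \<Longrightarrow> p * q \<in> S"
    and nz: "p0 \<in> S" "p0 \<noteq> 0" and root: "\<And>z. \<exists>q\<in>S. poly q z \<noteq> 0"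
  shows "1 \<in> S"
proof -
  obtain d where d: "d \<in> S" "d \<noteq> 0" and min: "\<And>q. q \<in> S \<Longrightarrow> q \<noteq> 0 \<Longrightarrow> degree d \<le> degree q"
    using ex_has_least_nat[of "\<lambda>q. q \<in> S \<and> q \<noteq> 0" p0 degree] nz by auto
  have "degree d = 0"
  proof (rule ccontr)
    assume "degree d \<noteq> 0"
    then obtain z where z: "poly d z = 0"
      using fundamental_theorem_of_algebra[of d] by (auto simp: constant_degree)
    obtain q where q: "q \<in> S" "poly q z \<noteq> 0" using root by blast
    have eq: "q mod d = q + (- (q div d)) * d" by (simp add: minus_div_mult_eq_mod[symmetric])
    have "q mod d \<in> S" unfolding eq by (intro add mult q d)
    moreover have "poly (q mod d) z \<noteq> 0" unfolding eq using z q by simp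
    then have "q mod d \<noteq> 0" by auto
    ultimately have "degree d \<le> degree (q mod d)" using min by blast
    moreover have "degree (q mod d) < degree d"
      using degree_mod_less'[OF d(2) \<open>q mod d \<noteq> 0\<close>] .
    ultimately show False by simp
  qed
  then obtain c where c: "d = [:c:]" by (rule degree_eq_zeroE)
  then have "[:1 / c:] * d = 1" using d(2) by (simp add: one_pCons)
  then show ?thesis using mult[OF d(1)] by metis
qed

lemma algebraic_empty: "algebraic_set ({} :: (complex ^ 'n::finite) set)"
  by (rule algebraic_setI) (auto intro!: exI[of _ "\<lambda>x. 1"] poly_fun_const)

text \<open>A linear functional \<open>u\<close> on polynomials modulo \<open>f\<close> that annihilates all multiples of the restrictions
  of polynomials vanishing on \<open>V\<close> to the line through \<open>y\<close> is a solution of a linear system with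
  coefficients polynomial in \<open>y\<close>. There is a nonzero one, evaluation at a common root, if \<open>y\<close> is in
  the image, and none otherwise.\<close>

lemma algebraic_proj_along_image:
  fixes V :: "(complex ^ 'n::finite) set"
  assumes V: "algebraic_set V" and f: "homog_poly m f" "\<And>x. x \<in> V \<Longrightarrow> f 1 x = 0" "f 0 e \<noteq> 0" and e: "e $ i = 1"
  shows "algebraic_set (proj_along i e ` V)"
proof (cases "m = 0")
  case True
  then have "f 1 x \<noteq> 0" for x using f(1,3) homog_poly_0_const[of f] by metis
  then have "V = {}" using f(2) by auto
  then show ?thesis by (simp add: algebraic_empty)
next
  case False
  show ?thesis
  proof (rule algebraic_setI)
    fix y0 assume y0: "y0 \<notin> proj_along i e ` V"
    show "\<exists>g. poly_fun g \<and> (\<forall>y\<in>proj_along i e ` V. g y = 0) \<and> g y0 \<noteq> 0"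
    proof (cases "y0 $ i = 0")
      case False
      then show ?thesis by (intro exI[of _ "\<lambda>x. x $ i"]) (auto simp: poly_fun_var proj_along_nth[OF e])
    next
      case y0i: True
      \<comment> \<open>A pair \<open>(h, a)\<close> stands for \<open>h\<close> times the
        \<open>a\<close>-th power of the coordinate. A functional killing all these products kills
        every multiple of the restriction of \<open>h\<close> to a line.\<close>
      define A where "A = {h. poly_fun h \<and> (\<forall>x\<in>V. h x = 0)} \<times> (UNIV :: nat set)"
      define rem where "rem h a r \<longleftrightarrow> (\<forall>j<m. poly_fun (r j)) \<and>
        (\<exists>Q. poly_fun Q \<and> (\<forall>x. h x * (x $ i) ^ a = Q x * f 1 x + (\<Sum>j<m. r j (proj_along i e x) * (x $ i) ^ j)))" for h a r
      define M where "M = (\<lambda>(h, a). SOME r. rem h a r)"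
      have M: "rem h a (M (h, a))" if "(h, a) \<in> A" for h a
      proof -
        have "poly_fun h" using that by (simp add: A_def)
        then obtain k where k: "poly_fun_deg k h" unfolding poly_fun_def ..
        obtain Q r where "poly_fun Q" "\<And>j. j < m \<Longrightarrow> poly_fun_deg (k + a) (r j)"
          "\<And>x. h x * (x $ i) ^ a = Q x * f 1 x + (\<Sum>j<m. r j (proj_along i e x) * (x $ i) ^ j)"
          by (rule poly_fun_deg_division[OF f(1,3) poly_fun_deg_mult[OF k poly_fun_deg_varpow] e]) blast
        then have "rem h a r" unfolding rem_def by (blast intro: pfunI)
        then show ?thesis unfolding M_def case_prod_conv by (rule someI[where P = "rem h a"])
      qed
      obtain p where p: "degree p \<le> m" "coeff p m = f 0 e" "\<And>z. poly p z = f 1 (y0 + z *s e)"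
        by (rule homog_poly_line_poly[OF f(1), where v = e and y = y0]) blast
      have degp: "degree p = m" using p f(3) by (metis le_degree order_antisym)
      have p0: "p \<noteq> 0" using degp False by auto
      have inj: "\<forall>b\<in>{..<m}. u b = 0"
        if u: "\<forall>a\<in>A. (\<Sum>b\<in>{..<m}. M a b y0 * u b) = 0" for u
      proof -
        \<comment> \<open>\<open>U\<close> is the functional on polynomials modulo \<open>p\<close>
          that takes the values \<open>u b\<close> on the powers below \<open>m\<close>.\<close>
        define U where "U q = (\<Sum>b<m. u b * coeff (q mod p) b)" for q
        have U_add: "U (q + q') = U q + U q'" for q q'
          by (simp add: U_def poly_mod_add_left algebra_simps sum.distrib)
        have U_smult: "U (smult c q) = c * U q" for c q
          by (simp add: U_def mod_smult_left algebra_simps sum_distrib_left)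
        \<comment> \<open>The largest ideal in the kernel of \<open>U\<close>. It contains
          \<open>p\<close> and the restrictions of all polynomials vanishing on \<open>V\<close>,
          which have no common root because \<open>y0\<close> is not in the image.\<close>
        define S where "S = {q. \<forall>t. U (t * q) = 0}"
        have "1 \<in> S"
        proof (rule poly_ideal_one)
          show "q + q' \<in> S" if "q \<in> S" "q' \<in> S" for q q'
            using that by (simp add: S_def distrib_left U_add)
          show "q' * q \<in> S" if "q \<in> S" for q q'
            using that by (simp add: S_def mult.assoc[symmetric])
          show pS: "p \<in> S" by (simp add: S_def U_def)
          show "p \<noteq> 0" by fact
          show "\<exists>q\<in>S. poly q z \<noteq> 0" for z
          proof (cases "poly p z = 0")
            case False then show ?thesis using pS by blast
          next
            case True
            have "y0 + z *s e \<notin> V"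
            proof
              assume "y0 + z *s e \<in> V"
              then have "proj_along i e (y0 + z *s e) \<in> proj_along i e ` V" by blast
              then show False using y0 proj_along_add[OF e y0i] by simp
            qed
            then obtain h where h: "poly_fun h" "\<And>x. x \<in> V \<Longrightarrow> h x = 0" "h (y0 + z *s e) \<noteq> 0"
              using algebraic_setE[OF V] by blast
            obtain hq where hq: "\<And>z. poly hq z = h (y0 + z *s e)"
              by (rule poly_fun_line_poly[OF h(1), where v = e and y = y0]) blast
            have U0: "U (monom 1 a * hq) = 0" for a
            proof -
              have hA: "(h, a) \<in> A" using h by (auto simp: A_def)
              obtain Q where Q: "poly_fun Q"
                "\<And>x. h x * (x $ i) ^ a = Q x * f 1 x + (\<Sum>j<m. M (h, a) j (proj_along i e x) * (x $ i) ^ j)"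
                using M[OF hA] by (auto simp: rem_def)
              obtain Qq where Qq: "\<And>z. poly Qq z = Q (y0 + z *s e)"
                by (rule poly_fun_line_poly[OF Q(1), where v = e and y = y0]) blast
              define R where "R = (\<Sum>j<m. monom (M (h, a) j y0) j)"
              have "poly (monom 1 a * hq) w = poly (Qq * p + R) w" for w
                using Q(2)[of "y0 + w *s e"] y0i e
                by (simp add: hq Qq p(3) R_def poly_sum poly_monom proj_along_add mult.commute)
              then have eq: "monom 1 a * hq = Qq * p + R" by (simp add: poly_eq_poly_eq_iff[symmetric] fun_eq_iff)
              have "degree R < m"
              proof -
                have "degree R \<le> m - 1" unfolding R_def
                  by (intro degree_sum_le) (auto intro: order.trans[OF degree_monom_le])
                then show ?thesis using False \<open>m \<noteq> 0\<close> by simp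
              qed
              then have "(monom 1 a * hq) mod p = R" unfolding eq using degp
                by (simp add: mod_poly_less poly_mod_add_left)
              moreover have "coeff R b = M (h, a) b y0" if "b < m" for b
                using that by (simp add: R_def coeff_sum)
              ultimately have "U (monom 1 a * hq) = (\<Sum>b<m. M (h, a) b y0 * u b)"
                by (simp add: U_def mult.commute)
              then show ?thesis using u hA by simp
            qed
            have U_sum: "U (\<Sum>j\<in>I. g j) = (\<Sum>j\<in>I. U (g j))" if "finite I" for I :: "nat set" and g
              using that by (induction I) (auto simp: U_add U_def[of 0])
            have "U (t * hq) = 0" for t
            proof -
              have "t * hq = (\<Sum>j\<le>degree t. monom (coeff t j) j) * hq" by (simp add: poly_as_sum_of_monoms)
              also have "\<dots> = (\<Sum>j\<le>degree t. smult (coeff t j) (monom 1 j * hq))"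
                unfolding sum_distrib_right
                by (intro sum.cong refl) (simp add: mult_smult_left[symmetric] smult_monom del: mult_smult_left)
              finally show ?thesis by (simp add: U_sum U_smult U0)
            qed
            then show ?thesis using h(3) hq by (intro bexI[of _ hq]) (auto simp: S_def)
          qed
        qed
        then have "U (monom 1 b) = 0" for b by (simp add: S_def)
        moreover have "U (monom 1 b) = u b" if "b < m" for b
        proof -
          have "degree (monom (1::complex) b) < degree p" using that degp by (simp add: degree_monom_eq)
          then have "monom 1 b mod p = monom 1 b" by (rule mod_poly_less)
          then show ?thesis using that by (simp add: U_def if_distrib cong: if_cong)
        qed
        ultimately show ?thesis by simp
      qed
      have pfM: "poly_fun (M a b)" if "a \<in> A" "b \<in> {..<m}" for a b
        using M[of "fst a" "snd a"] that by (simp add: rem_def)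
      have "finite {..<m}" by simp
      from elimination[of "{..<m}" A M y0, OF this pfM inj] obtain g where g: "poly_fun g" "g y0 \<noteq> 0"
        "\<And>y u. \<forall>a\<in>A. (\<Sum>b\<in>{..<m}. M a b y * u b) = 0 \<Longrightarrow> \<exists>b\<in>{..<m}. u b \<noteq> 0 \<Longrightarrow> g y = 0"
        by blast
      \<comment> \<open>The powers of the coordinate of \<open>x\<close> solve the system; the
        zeroth power is 1 and occurs because \<open>m\<close> is positive.\<close>
      have "g (proj_along i e x) = 0" if "x \<in> V" for x
      proof (rule g(3)[of _ "\<lambda>b. (x $ i) ^ b"])
        show "\<exists>b\<in>{..<m}. x $ i ^ b \<noteq> 0" using \<open>m \<noteq> 0\<close> by (intro bexI[of _ 0]) auto
        show "\<forall>a\<in>A. (\<Sum>b<m. M a b (proj_along i e x) * x $ i ^ b) = 0"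
        proof
          fix a assume a: "a \<in> A"
          obtain h n where hn: "a = (h, n)" by (cases a)
          from M[of h n] a hn obtain Q where
            "h x * (x $ i) ^ n = Q x * f 1 x + (\<Sum>j<m. M (h, n) j (proj_along i e x) * (x $ i) ^ j)"
            by (auto simp: rem_def)
          moreover have "h x = 0" using a hn that by (auto simp: A_def)
          ultimately show "(\<Sum>b<m. M a b (proj_along i e x) * x $ i ^ b) = 0" using f(2)[OF that] hn by simp
        qed
      qed
      with g show ?thesis by blast
    qed
  qed
qed

section \<open>Fibres of a projection\<close>

text \<open>On a line in direction \<open>e\<close> the polynomial \<open>f\<close> has top
  coefficient \<open>f 0 e\<close>, so it is not zero there and has finitely many roots.\<close>

lemma finite_proj_along_fibre:
  fixes V :: "(complex ^ 'n::finite) set"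
  assumes f: "homog_poly m f" "\<And>x. x \<in> V \<Longrightarrow> f 1 x = 0" "f 0 e \<noteq> 0"
  shows "finite {x \<in> V. proj_along i e x = y}"
proof -
  obtain p where p: "degree p \<le> m" "coeff p m = f 0 e" "\<And>z. poly p z = f 1 (y + z *s e)"
    by (rule homog_poly_line_poly[OF f(1), where v = e and y = y]) blast
  have "p \<noteq> 0" using p f(3) by auto
  then have "finite {z. poly p z = 0}" by (rule poly_roots_finite)
  moreover have "{x \<in> V. proj_along i e x = y} \<subseteq> (\<lambda>z. y + z *s e) ` {z. poly p z = 0}"
  proof
    fix x assume "x \<in> {x \<in> V. proj_along i e x = y}"
    then have x: "x \<in> V" "x = y + (x $ i) *s e" using proj_along_decomp[of i e x] by auto
    then have "poly p (x $ i) = 0" using p(3) f(2) by metis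
    then show "x \<in> (\<lambda>z. y + z *s e) ` {z. poly p z = 0}" using x by blast
  qed
  ultimately show ?thesis using finite_surj by blast
qed

text \<open>By continuity \<open>f\<close> has no zero near \<open>(0, e)\<close>. A point whose
  \<open>z\<close> is too large would land in that neighbourhood after division by \<open>z\<close>,
  and homogeneity carries the nonvanishing back to the point.\<close>

lemma proj_along_coordinate_bound:
  fixes V :: "(complex ^ 'n::finite) set"
  assumes f: "homog_poly m f" "\<And>x. x \<in> V \<Longrightarrow> f 1 x = 0" "f 0 e \<noteq> 0"
  obtains K where "K > 0" "\<And>y z. y + z *s e \<in> V \<Longrightarrow> norm z \<le> K * (1 + norm y)"
proof -
  have cont: "isCont (\<lambda>p. f (fst p) (snd p)) (0, e)"
    using homog_poly_continuous[OF f(1)] by (simp add: continuous_on_eq_continuous_at)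
  obtain d where d: "d > 0" "\<And>p. dist p (0, e) < d \<Longrightarrow> dist (f (fst p) (snd p)) (f 0 e) < norm (f 0 e)"
    using cont f(3) unfolding continuous_at_eps_delta by (metis fst_conv snd_conv zero_less_norm_iff)
  \<comment> \<open>The constant leaves half of the radius \<open>d\<close> for \<open>1 / z\<close>
    and half for \<open>y\<close> divided by \<open>z\<close>.\<close>
  have "norm z \<le> (2 / d) * (1 + norm y)" if V: "y + z *s e \<in> V" for y z
  proof (rule ccontr)
    assume "\<not> ?thesis"
    then have z: "norm z > (2 / d) * (1 + norm y)" by simp
    have "(2 / d) * (1 + norm y) > 0" using d by (intro mult_pos_pos) (auto intro: add_pos_nonneg)
    then have z0: "norm z > 0" using z by linarith
    let ?x = "(1 / z) *s y + e"
    have zx: "z *s ?x = y + z *s e" using z0 by (simp add: vec_eq_iff algebra_simps)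
    have half: "1 / norm z < d / 2" "norm y / norm z < d / 2"
      using z z0 d by (auto simp: norm_divide field_simps intro: le_less_trans[rotated])
    have nsm: "norm (c *s x) = norm c * norm x" for c and x :: "complex ^ 'n"
      by (simp add: norm_vec_def norm_mult L2_set_right_distrib)
    have "dist (1 / z, ?x) (0, e) = norm (1 / z, (1 / z) *s y)"
      by (simp add: dist_norm)
    also have "\<dots> \<le> norm (1 / z) + norm ((1 / z) *s y)"
      by (rule norm_Pair_le)
    also have "\<dots> < d" using add_strict_mono[OF half] by (simp only: nsm norm_divide norm_one) simp
    finally have "dist (f (1 / z) ?x) (f 0 e) < norm (f 0 e)" using d(2)[of "(1 / z, ?x)"] by simp
    then have "f (1 / z) ?x \<noteq> 0" by (auto simp: dist_norm)
    moreover have "z ^ m * f (1 / z) ?x = f 1 (y + z *s e)"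
      using homog_poly_scale[OF f(1), of z "1 / z" ?x] z0 zx by simp
    ultimately show False using f(2)[OF V] z0 by auto
  qed
  then show ?thesis using that[of "2 / d"] d by simp
qed

section \<open>Hilbert functions and dimension\<close>

text \<open>\<open>spanned X k M\<close> and \<open>indep X k N\<close> bound the Hilbert function of \<open>X\<close> at \<open>k\<close> by \<open>M\<close> from above and by
  \<open>N\<close> from below.\<close>

definition spanned :: "(complex ^ 'n::finite) set \<Rightarrow> nat \<Rightarrow> nat \<Rightarrow> bool" where
  "spanned X k M \<longleftrightarrow> (\<exists>(I :: nat set) b. finite I \<and> card I \<le> M \<and>
     (\<forall>p. poly_fun_deg k p \<longrightarrow> (\<exists>a. \<forall>x\<in>X. p x = (\<Sum>l\<in>I. a l * b l x))))"

definition indep :: "(complex ^ 'n::finite) set \<Rightarrow> nat \<Rightarrow> nat \<Rightarrow> bool" where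
  "indep X k N \<longleftrightarrow> (\<exists>p. (\<forall>t<N. poly_fun_deg k (p t)) \<and>
     (\<forall>c. (\<forall>x\<in>X. (\<Sum>t<N. c t * p t x) = 0) \<longrightarrow> (\<forall>t<N. c t = 0)))"

text \<open>Only an upper estimate, so it passes to subsets. An exact dimension arises when it meets
  a chain of the same length.\<close>

definition growth :: "(complex ^ 'n::finite) set \<Rightarrow> nat \<Rightarrow> bool" where
  "growth X d \<longleftrightarrow> (\<exists>c. \<forall>k. spanned X k (c * (k + 1) ^ d))"

lemma linear_relation:
  fixes a :: "'t \<Rightarrow> 'i \<Rightarrow> complex"
  assumes "finite I" "finite T" "card I < card T"
  shows "\<exists>c. (\<exists>t\<in>T. c t \<noteq> 0) \<and> (\<forall>l\<in>I. (\<Sum>t\<in>T. c t * a t l) = 0)"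
  using assms
proof (induction I arbitrary: T a rule: finite_induct)
  case empty
  then have "T \<noteq> {}" by auto
  then show ?case by (intro exI[of _ "\<lambda>_. 1"]) auto
next
  case (insert l0 I)
  show ?case
  proof (cases "\<forall>t\<in>T. a t l0 = 0")
    case True
    have "card I < card T" using insert by simp
    from insert.IH[OF insert.prems(1) this, of a] True show ?thesis by auto
  next
    case False
    then obtain t0 where t0: "t0 \<in> T" "a t0 l0 \<noteq> 0" by blast
    let ?T = "T - {t0}"
    have T: "finite ?T" "card I < card ?T" using insert t0 by auto
    from insert.IH[OF T, of "\<lambda>t l. a t l - (a t l0 / a t0 l0) * a t0 l"]
    obtain c where c: "\<exists>t\<in>?T. c t \<noteq> 0"
      "\<forall>l\<in>I. (\<Sum>t\<in>?T. c t * (a t l - (a t l0 / a t0 l0) * a t0 l)) = 0" by blast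
    define d where "d = c(t0 := - (\<Sum>t\<in>?T. c t * a t l0) / a t0 l0)"
    have sum: "(\<Sum>t\<in>T. d t * a t l) = d t0 * a t0 l + (\<Sum>t\<in>?T. c t * a t l)" for l
      by (subst sum.remove[OF insert.prems(1) t0(1)]) (auto simp: d_def intro!: sum.cong)
    have "(\<Sum>t\<in>T. d t * a t l) = 0" if "l \<in> insert l0 I" for l
    proof (cases "l = l0")
      case True then show ?thesis using t0 by (simp add: sum) (simp add: d_def)
    next
      case False
      then have "(\<Sum>t\<in>?T. c t * (a t l - (a t l0 / a t0 l0) * a t0 l)) = 0" using c that by blast
      moreover have "(\<Sum>t\<in>?T. c t * (a t l - (a t l0 / a t0 l0) * a t0 l)) =
        (\<Sum>t\<in>?T. c t * a t l) - (\<Sum>t\<in>?T. c t * a t l0) / a t0 l0 * a t0 l"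
        by (simp add: right_diff_distrib sum_subtractf sum_divide_distrib sum_distrib_right mult.assoc)
      ultimately show ?thesis by (simp add: sum) (simp add: d_def)
    qed
    moreover have "\<exists>t\<in>T. d t \<noteq> 0" using c(1) by (auto simp: d_def)
    ultimately show ?thesis by blast
  qed
qed

text \<open>More than \<open>card I\<close> functions would have linearly dependent coefficient
  vectors. The parametrization \<open>g\<close> is meant for the join of a set with a vector, where
  polynomials are expanded on a product.\<close>

lemma indep_le:
  assumes "indep X k N" "X \<subseteq> g ` T" "finite I"
    and "\<And>p. poly_fun_deg k p \<Longrightarrow> \<exists>a. \<forall>t\<in>T. p (g t) = (\<Sum>l\<in>I. a l * b l t)"
  shows "N \<le> card I"
proof (rule ccontr)
  assume "\<not> ?thesis"
  then have N: "card I < card {..<N}" by simp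
  obtain p where p: "\<forall>t<N. poly_fun_deg k (p t)"
    "\<And>c. \<forall>x\<in>X. (\<Sum>t<N. c t * p t x) = 0 \<Longrightarrow> \<forall>t<N. c t = 0" using assms(1) unfolding indep_def by blast
  have "\<forall>t. \<exists>a. t < N \<longrightarrow> (\<forall>x\<in>T. p t (g x) = (\<Sum>l\<in>I. a l * b l x))" using p(1) assms(4) by blast
  then obtain a where a: "\<And>t x. t < N \<Longrightarrow> x \<in> T \<Longrightarrow> p t (g x) = (\<Sum>l\<in>I. a t l * b l x)" by metis
  obtain c where c: "\<exists>t\<in>{..<N}. c t \<noteq> 0" "\<forall>l\<in>I. (\<Sum>t<N. c t * a t l) = 0"
    using linear_relation[OF assms(3) _ N, of a] by auto
  have "(\<Sum>t<N. c t * p t x) = 0" if "x \<in> X" for x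
  proof -
    from that assms(2) obtain y where y: "x = g y" "y \<in> T" by auto
    have "(\<Sum>t<N. c t * p t x) = (\<Sum>t<N. \<Sum>l\<in>I. c t * a t l * b l y)"
      using a y by (simp add: sum_distrib_left mult.assoc)
    also have "\<dots> = (\<Sum>l\<in>I. (\<Sum>t<N. c t * a t l) * b l y)"
      by (subst sum.swap) (simp add: sum_distrib_right)
    also have "\<dots> = 0" using c(2) by simp
    finally show ?thesis .
  qed
  then show False using p(2)[of c] c(1) by auto
qed

lemma indep_le_spanned: "indep X k N \<Longrightarrow> spanned X k M \<Longrightarrow> N \<le> M"
  unfolding spanned_def
proof (elim exE conjE)
  fix I :: "nat set" and b
  assume A: "indep X k N" "finite I" "card I \<le> M"
    "\<forall>p. poly_fun_deg k p \<longrightarrow> (\<exists>a. \<forall>x\<in>X. p x = (\<Sum>l\<in>I. a l * b l x))"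
  have "N \<le> card I" by (rule indep_le[where g = "\<lambda>x. x" and b = b, OF A(1) _ A(2)]) (use A(4) in auto)
  with A(3) show ?thesis by simp
qed

lemma spanned_mono: "spanned X k M \<Longrightarrow> Y \<subseteq> X \<Longrightarrow> M \<le> M' \<Longrightarrow> spanned Y k M'"
proof -
  assume A: "spanned X k M" and B: "Y \<subseteq> X" "M \<le> M'"
  obtain I :: "nat set" and b where I: "finite I" "card I \<le> M"
    "\<And>p. poly_fun_deg k p \<Longrightarrow> \<exists>a. \<forall>x\<in>X. p x = (\<Sum>l\<in>I. a l * b l x)"
    using A unfolding spanned_def by blast
  have "\<exists>a. \<forall>x\<in>Y. p x = (\<Sum>l\<in>I. a l * b l x)" if "poly_fun_deg k p" for p
    using I(3)[OF that] B(1) by (auto dest: subsetD)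
  then show "spanned Y k M'"
    unfolding spanned_def using I(1,2) B(2) by (intro exI[of _ I] exI[of _ b]) auto
qed

lemma growth_mono: "growth X d \<Longrightarrow> Y \<subseteq> X \<Longrightarrow> growth Y d"
  unfolding growth_def using spanned_mono[OF _ _ order.refl] by blast

text \<open>Spanning functions on \<open>Y\<close>, multiplied by the powers of
  \<open>\<zeta>\<close> below \<open>m\<close>, span on \<open>X\<close>. For a finite projection
  \<open>m\<close> is constant in \<open>k\<close>; for splitting off a coordinate it is
  \<open>k + 1\<close>.\<close>

lemma spanned_extend:
  assumes "\<And>p. poly_fun_deg k p \<Longrightarrow> \<exists>q. (\<forall>j<m. poly_fun_deg k (q j)) \<and> (\<forall>x\<in>X. p x = (\<Sum>j<m. q j (\<pi> x) * \<zeta> x ^ j))"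
    and "\<pi> ` X \<subseteq> Y" "spanned Y k M"
  shows "spanned X k (m * M)"
proof -
  obtain I :: "nat set" and b where I: "finite I" "card I \<le> M"
    "\<And>p. poly_fun_deg k p \<Longrightarrow> \<exists>a. \<forall>x\<in>Y. p x = (\<Sum>l\<in>I. a l * b l x)"
    using assms(3) unfolding spanned_def by blast
  \<comment> \<open>The pairing is there because \<open>spanned\<close> asks for natural numbers as
    indices.\<close>
  let ?J = "prod_encode ` ({..<m} \<times> I)"
  let ?b = "\<lambda>u x. b (snd (prod_decode u)) (\<pi> x) * \<zeta> x ^ fst (prod_decode u)"
  have inj: "inj_on prod_encode A" for A by (simp add: inj_prod_encode)
  have "card ?J \<le> m * M" using I by (simp add: card_image[OF inj] card_cartesian_product)
  moreover have "\<exists>a. \<forall>x\<in>X. p x = (\<Sum>u\<in>?J. a u * ?b u x)" if p: "poly_fun_deg k p" for p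
  proof -
    obtain q where q: "\<forall>j<m. poly_fun_deg k (q j)" "\<forall>x\<in>X. p x = (\<Sum>j<m. q j (\<pi> x) * \<zeta> x ^ j)"
      using assms(1)[OF p] by blast
    have "\<forall>j. \<exists>a. j < m \<longrightarrow> (\<forall>x\<in>Y. q j x = (\<Sum>l\<in>I. a l * b l x))" using I(3) q(1) by blast
    then obtain a where a: "\<And>j x. j < m \<Longrightarrow> x \<in> Y \<Longrightarrow> q j x = (\<Sum>l\<in>I. a j l * b l x)" by metis
    have "p x = (\<Sum>u\<in>?J. a (fst (prod_decode u)) (snd (prod_decode u)) * ?b u x)" if "x \<in> X" for x
    proof -
      have "\<pi> x \<in> Y" using that assms(2) by auto
      then have "p x = (\<Sum>j<m. \<Sum>l\<in>I. a j l * (b l (\<pi> x) * \<zeta> x ^ j))"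
        using q(2) a that by (simp add: sum_distrib_right mult.assoc)
      also have "\<dots> = (\<Sum>(j, l)\<in>{..<m} \<times> I. a j l * (b l (\<pi> x) * \<zeta> x ^ j))"
        by (rule sum.cartesian_product)
      also have "\<dots> = (\<Sum>u\<in>?J. a (fst (prod_decode u)) (snd (prod_decode u)) * ?b u x)"
        by (subst sum.reindex[OF inj]) (auto intro!: sum.cong)
      finally show ?thesis .
    qed
    then show ?thesis by (intro exI[of _ "\<lambda>u. a (fst (prod_decode u)) (snd (prod_decode u))"] ballI)
  qed
  moreover have "finite ?J" using I(1) by simp
  ultimately show ?thesis unfolding spanned_def by (intro exI[of _ ?J] exI[of _ ?b] conjI allI impI)
qed

lemma spanned_proj_along:
  fixes V :: "(complex ^ 'n::finite) set"
  assumes f: "homog_poly m f" "\<And>x. x \<in> V \<Longrightarrow> f 1 x = 0" "f 0 e \<noteq> 0" and e: "e $ i = 1"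
    and "spanned (proj_along i e ` V) k M"
  shows "spanned V k (m * M)"
proof (rule spanned_extend[where \<pi> = "proj_along i e" and \<zeta> = "\<lambda>x. x $ i" and X = V, OF _ order.refl assms(5)])
  fix p :: "complex ^ 'n \<Rightarrow> complex" assume "poly_fun_deg k p"
  then obtain Q r where
    "\<And>j. j < m \<Longrightarrow> poly_fun_deg k (r j)" "\<And>x. p x = Q x * f 1 x + (\<Sum>j<m. r j (proj_along i e x) * (x $ i) ^ j)"
    by (rule poly_fun_deg_division[OF f(1,3) _ e]) blast
  then show "\<exists>q. (\<forall>j<m. poly_fun_deg k (q j)) \<and> (\<forall>x\<in>V. p x = (\<Sum>j<m. q j (proj_along i e x) * (x $ i) ^ j))"
    using f(2) by (intro exI[of _ r]) simp
qed

lemma growth_proj_along: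
  fixes V :: "(complex ^ 'n::finite) set"
  assumes f: "homog_poly m f" "\<And>x. x \<in> V \<Longrightarrow> f 1 x = 0" "f 0 e \<noteq> 0" and e: "e $ i = 1"
    and "growth (proj_along i e ` V) d"
  shows "growth V d"
proof -
  obtain c where "\<And>k. spanned (proj_along i e ` V) k (c * (k + 1) ^ d)" using assms(5) by (auto simp: growth_def)
  then have "spanned V k (m * c * (k + 1) ^ d)" for k
    using spanned_proj_along[OF f e] by (simp add: mult.assoc)
  then show ?thesis unfolding growth_def by blast
qed

section \<open>Coordinate subspaces\<close>

definition coord_space :: "'n set \<Rightarrow> (complex ^ 'n::finite) set" where
  "coord_space D = {x. \<forall>i. i \<notin> D \<longrightarrow> x $ i = 0}"

lemma coord_space_empty: "coord_space {} = {0}" by (auto simp: coord_space_def vec_eq_iff)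

lemma coord_space_UNIV: "coord_space UNIV = UNIV" by (auto simp: coord_space_def)

lemma coord_space_mono: "D \<subseteq> E \<Longrightarrow> coord_space D \<subseteq> coord_space E" by (auto simp: coord_space_def)

lemma coord_space_smult: "x \<in> coord_space D \<Longrightarrow> c *s x \<in> coord_space D" by (auto simp: coord_space_def)

lemma coord_space_add: "x \<in> coord_space D \<Longrightarrow> y \<in> coord_space D \<Longrightarrow> x + y \<in> coord_space D" by (auto simp: coord_space_def)

lemma coord_space_diff: "x \<in> coord_space D \<Longrightarrow> y \<in> coord_space D \<Longrightarrow> x - y \<in> coord_space D" by (auto simp: coord_space_def)

lemma zero_in_coord_space: "0 \<in> coord_space D" by (auto simp: coord_space_def)

lemma proj_along_coord_space: "e $ i = 1 \<Longrightarrow> e \<in> coord_space D \<Longrightarrow> x \<in> coord_space D \<Longrightarrow> proj_along i e x \<in> coord_space (D - {i})"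
  by (auto simp: coord_space_def proj_along_def)

lemma coord_space_Diff_nth: "y \<in> coord_space (D - {i}) \<Longrightarrow> y $ i = 0" by (auto simp: coord_space_def)

lemma algebraic_coord_space:
  fixes D :: "'n::finite set"
  shows "algebraic_set (coord_space D)"
proof (rule algebraic_setI)
  fix x :: "complex ^ 'n" assume "x \<notin> coord_space D"
  then obtain i where "i \<notin> D" "x $ i \<noteq> 0" by (auto simp: coord_space_def)
  then show "\<exists>f. poly_fun f \<and> (\<forall>y\<in>coord_space D. f y = 0) \<and> f x \<noteq> 0"
    by (intro exI[of _ "\<lambda>x. x $ i"]) (auto simp: coord_space_def poly_fun_var)
qed

lemma growth_coord_space:
  fixes D :: "'n::finite set"
  shows "growth (coord_space D) (card D)"
proof -
  have "spanned (coord_space D) k ((k + 1) ^ card D)" for k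
    using finite[of D]
  proof (induction D rule: finite_induct)
    case empty
    have "spanned (coord_space {}) k 1" unfolding spanned_def
      by (rule exI[of _ "{0}"], rule exI[of _ "\<lambda>l x. 1"]) (auto simp: coord_space_empty)
    then show ?case by simp
  next
    case (insert i D)
    let ?e = "axis i 1 :: complex ^ 'n"
    have "spanned (coord_space (insert i D)) k ((k + 1) * (k + 1) ^ card D)"
    proof (rule spanned_extend[where \<pi> = "proj_along i ?e" and \<zeta> = "\<lambda>x. x $ i", OF _ _ insert.IH])
      have "?e \<in> coord_space (insert i D)" by (auto simp: coord_space_def axis_def)
      then have "proj_along i ?e x \<in> coord_space (insert i D - {i})" if "x \<in> coord_space (insert i D)" for x
        using that by (intro proj_along_coord_space) (auto simp: axis_def)
      then show "proj_along i ?e ` coord_space (insert i D) \<subseteq> coord_space D" using insert.hyps by auto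
      fix p :: "complex ^ 'n \<Rightarrow> complex" assume "poly_fun_deg k p"
      then obtain c where c: "\<And>j. j \<le> k \<Longrightarrow> poly_fun_deg (k - j) (c j)"
        "\<And>y z. p (y + z *s ?e) = (\<Sum>j\<le>k. c j y * z ^ j)" by (rule poly_fun_deg_line) blast
      have "p x = (\<Sum>j<k + 1. c j (proj_along i ?e x) * (x $ i) ^ j)" for x
        using c(2)[of "proj_along i ?e x" "x $ i"] by (simp add: proj_along_decomp lessThan_Suc_atMost)
      moreover have "poly_fun_deg k (c j)" if "j < k + 1" for j
        using c(1)[of j] that poly_fun_deg_mono by fastforce
      ultimately show "\<exists>q. (\<forall>j<k + 1. poly_fun_deg k (q j)) \<and>
          (\<forall>x\<in>coord_space (insert i D). p x = (\<Sum>j<k + 1. q j (proj_along i ?e x) * (x $ i) ^ j))" by blast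
    qed
    then show ?case using insert.hyps by simp
  qed
  then show ?thesis unfolding growth_def by (intro exI[of _ 1]) simp
qed

section \<open>Chains of irreducible sets\<close>

text \<open>This is primality of the vanishing ideal: the zero sets of the two factors cover
  \<open>Z\<close>.\<close>

lemma irreducible_product:
  assumes Z: "irreducible_algebraic_set Z" and fg: "poly_fun f" "poly_fun g" "\<And>x. x \<in> Z \<Longrightarrow> f x * g x = 0"
  shows "(\<forall>x\<in>Z. f x = 0) \<or> (\<forall>x\<in>Z. g x = 0)"
proof -
  have alg: "algebraic_set (Z \<inter> {x. f x = 0})" "algebraic_set (Z \<inter> {x. g x = 0})"
    using Z fg by (auto simp: irreducible_algebraic_set_def intro!: algebraic_Int algebraic_zero_set)
  have "Z = (Z \<inter> {x. f x = 0}) \<union> (Z \<inter> {x. g x = 0})" using fg by auto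
  with Z alg have "Z = Z \<inter> {x. f x = 0} \<or> Z = Z \<inter> {x. g x = 0}"
    unfolding irreducible_algebraic_set_def by blast
  then show ?thesis by blast
qed

text \<open>\<open>f\<close> is not a zero divisor on \<open>Z\<close>, so multiples of \<open>f\<close> can be added to functions independent on \<open>Z'\<close>.\<close>

lemma indep_add:
  assumes "irreducible_algebraic_set Z" "Z' \<subseteq> Z" "poly_fun_deg \<delta> f" "\<And>x. x \<in> Z' \<Longrightarrow> f x = 0"
    "x0 \<in> Z" "f x0 \<noteq> 0" "indep Z' (k + \<delta>) N1" "indep Z k N2"
  shows "indep Z (k + \<delta>) (N1 + N2)"
proof -
  obtain p where p: "\<forall>t<N1. poly_fun_deg (k + \<delta>) (p t)"
    "\<And>c. \<forall>x\<in>Z'. (\<Sum>t<N1. c t * p t x) = 0 \<Longrightarrow> \<forall>t<N1. c t = 0" using assms(7) unfolding indep_def by blast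
  obtain q where q: "\<forall>t<N2. poly_fun_deg k (q t)"
    "\<And>c. \<forall>x\<in>Z. (\<Sum>t<N2. c t * q t x) = 0 \<Longrightarrow> \<forall>t<N2. c t = 0" using assms(8) unfolding indep_def by blast
  define r where "r t = (if t < N1 then p t else (\<lambda>x. q (t - N1) x * f x))" for t
  have split: "(\<Sum>t<N1 + N2. c t * r t x) =
    (\<Sum>t<N1. c t * p t x) + f x * (\<Sum>t<N2. c (N1 + t) * q t x)" for c x
  proof -
    have "(\<Sum>t<N1 + N2. c t * r t x) = (\<Sum>t<N1. c t * r t x) + (\<Sum>t<N2. c (N1 + t) * r (N1 + t) x)"
      by (induction N2) simp_all
    then show ?thesis by (simp add: r_def sum_distrib_left mult_ac)
  qed
  show ?thesis unfolding indep_def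
  proof (intro exI[of _ r] conjI allI impI)
    fix t assume "t < N1 + N2"
    then show "poly_fun_deg (k + \<delta>) (r t)" using p(1) q(1) poly_fun_deg_mult[OF _ assms(3)] by (auto simp: r_def)
  next
    fix c t assume c: "\<forall>x\<in>Z. (\<Sum>t<N1 + N2. c t * r t x) = 0" and t: "t < N1 + N2"
    have c1: "\<forall>t<N1. c t = 0"
    proof (rule p(2), rule ballI)
      fix x assume x: "x \<in> Z'"
      then have "(\<Sum>t<N1. c t * p t x) + f x * (\<Sum>t<N2. c (N1 + t) * q t x) = 0"
        using c assms(2) split[of c x] by (metis subsetD)
      then show "(\<Sum>t<N1. c t * p t x) = 0" using assms(4)[OF x] by simp
    qed
    then have "f x * (\<Sum>t<N2. c (N1 + t) * q t x) = 0" if "x \<in> Z" for x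
      using c that split by simp
    then have "(\<forall>x\<in>Z. f x = 0) \<or> (\<forall>x\<in>Z. (\<Sum>t<N2. c (N1 + t) * q t x) = 0)"
      using q(1) by (intro irreducible_product[OF assms(1) pfunI[OF assms(3)]] poly_fun_sum poly_fun_mult poly_fun_const)
        (auto intro: pfunI)
    then have "\<forall>t<N2. c (N1 + t) = 0" using assms(5,6) by (intro q(2)) auto
    then show "c t = 0" using c1 t by (metis add_diff_inverse_nat nat_add_left_cancel_less)
  qed
qed

definition irr_chain :: "nat \<Rightarrow> (nat \<Rightarrow> (complex ^ 'n::finite) set) \<Rightarrow> bool" where
  "irr_chain d Z \<longleftrightarrow> (\<forall>i\<le>d. irreducible_algebraic_set (Z i)) \<and> (\<forall>i<d. Z i \<subset> Z (Suc i))"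

lemma irr_chain_subset: "irr_chain d Z \<Longrightarrow> i \<le> d \<Longrightarrow> Z i \<subseteq> Z d"
  by (rule inc_induct[of i d "\<lambda>i. Z i \<subseteq> Z d"]) (auto simp: irr_chain_def)

text \<open>For each link there is a polynomial vanishing on the smaller set but not on the larger.
  With these the count of independent polynomials obeys Pascal's rule, and the binomial coefficient
  grows in \<open>k\<close> with order \<open>e\<close>.\<close>

lemma irr_chain_indep:
  assumes "irr_chain e Z"
  obtains \<delta> where "\<And>k. indep (Z e) (k * \<delta>) ((k + e) choose e)"
proof -
  have "\<exists>k f x. poly_fun_deg k f \<and> (\<forall>y\<in>Z i. f y = 0) \<and> x \<in> Z (Suc i) \<and> f x \<noteq> 0" if "i < e" for i
  proof -
    have "Z i \<subset> Z (Suc i)" using assms that by (auto simp: irr_chain_def)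
    then obtain x where x: "x \<in> Z (Suc i)" "x \<notin> Z i" by auto
    moreover have "algebraic_set (Z i)"
      using assms that by (auto simp: irr_chain_def irreducible_algebraic_set_def)
    ultimately obtain f where "poly_fun f" "\<And>y. y \<in> Z i \<Longrightarrow> f y = 0" "f x \<noteq> 0"
      by (meson algebraic_setE)
    with x show ?thesis by (auto simp: poly_fun_def)
  qed
  then obtain K f x where f: "\<And>i. i < e \<Longrightarrow> poly_fun_deg (K i) (f i)" "\<And>i y. i < e \<Longrightarrow> y \<in> Z i \<Longrightarrow> f i y = 0"
    "\<And>i. i < e \<Longrightarrow> x i \<in> Z (Suc i)" "\<And>i. i < e \<Longrightarrow> f i (x i) \<noteq> 0"
    by metis
  \<comment> \<open>A common degree bound for all links, so that one step size serves the whole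
    chain.\<close>
  define \<delta> where "\<delta> = (\<Sum>i<e. K i)"
  have f\<delta>: "poly_fun_deg \<delta> (f i)" if "i < e" for i
    using f(1)[OF that] by (rule poly_fun_deg_mono) (auto simp: \<delta>_def that intro!: member_le_sum)
  have one: "indep Y k 1" if "Y \<noteq> {}" for Y :: "(complex ^ 'n) set" and k
    unfolding indep_def by (rule exI[of _ "\<lambda>t x. 1"]) (use that in \<open>auto intro: poly_fun_deg_const\<close>)
  have ne: "Z i \<noteq> {}" if "i \<le> e" for i
    using assms that by (auto simp: irr_chain_def irreducible_algebraic_set_def)
  have "indep (Z i) (k * \<delta>) ((k + i) choose i)" if "i \<le> e" for i k
    using that
  proof (induction i arbitrary: k)
    case 0 then show ?case using one[OF ne] by simp
  next
    case (Suc i)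
    show ?case
    proof (induction k)
      case 0 then show ?case using one[OF ne[OF Suc.prems]] by simp
    next
      case (Suc k)
      have i: "i < e" using Suc.prems \<open>Suc i \<le> e\<close> by simp
      \<comment> \<open>Pascal's rule: polynomials independent on \<open>Z i\<close> at the new
        degree, together with multiples of \<open>f i\<close> by polynomials independent on
        \<open>Z (Suc i)\<close> at the old one.\<close>
      have "indep (Z (Suc i)) (k * \<delta> + \<delta>) (((Suc k + i) choose i) + ((k + Suc i) choose Suc i))"
      proof (rule indep_add[of "Z (Suc i)" "Z i" \<delta> "f i" "x i"])
        show "irreducible_algebraic_set (Z (Suc i))" "Z i \<subseteq> Z (Suc i)"
          using assms i by (auto simp: irr_chain_def)
        show "indep (Z i) (k * \<delta> + \<delta>) (Suc k + i choose i)"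
          using \<open>\<And>k. i \<le> e \<Longrightarrow> indep (Z i) (k * \<delta>) (k + i choose i)\<close>[of "Suc k"] i
          by (simp add: add.commute)
      qed (use f f\<delta> i Suc in auto)
      then show ?case by (simp add: add.commute)
    qed
  qed
  then show ?thesis using that by blast
qed

text \<open>In \<open>k\<close> the left side grows with order \<open>e\<close> and the right side
  with order at most \<open>d\<close>.\<close>

lemma binomial_growth_bound:
  assumes "\<And>k. (k + e) choose e \<le> c * (k * \<delta> + 1) ^ d"
  shows "e \<le> d"
proof (rule ccontr)
  assume "\<not> e \<le> d"
  then have ed: "d < e" by simp
  \<comment> \<open>One more than the constant that the estimates accumulate, which makes the last
    comparison strict.\<close>
  define k where "k = c * (\<delta> + 1) ^ d * e ^ e + 1"
  have k: "k \<ge> 1" by (simp add: k_def)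
  have "(real k / real e) ^ e \<le> (real (k + e) / real e) ^ e"
    by (intro power_mono divide_right_mono) auto
  also have "\<dots> \<le> real ((k + e) choose e)"
    by (rule binomial_ge_n_over_k_pow_k) simp
  also have "\<dots> \<le> real (c * (k * \<delta> + 1) ^ d)" using assms by (simp only: of_nat_le_iff)
  also have "\<dots> \<le> real (c * ((\<delta> + 1) * k) ^ d)"
  proof -
    have "k * \<delta> + 1 \<le> (\<delta> + 1) * k" using k by (simp add: algebra_simps)
    then show ?thesis by (simp only: of_nat_le_iff) (intro mult_left_mono power_mono, auto)
  qed
  finally have "real k ^ e \<le> real (c * ((\<delta> + 1) * k) ^ d) * real e ^ e"
    using ed by (simp add: power_divide field_simps)
  then have "k ^ e \<le> c * ((\<delta> + 1) * k) ^ d * e ^ e"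
    by (metis of_nat_le_iff of_nat_mult of_nat_power)
  also have "\<dots> = (k - 1) * k ^ d" 
  proof -
    have "k - 1 = c * (\<delta> + 1) ^ d * e ^ e" by (simp add: k_def)
    then show ?thesis by (simp only: power_mult_distrib mult_ac)
  qed
  also have "\<dots> < k * k ^ d" using k by (intro mult_strict_right_mono) auto
  also have "\<dots> = k ^ Suc d" by simp
  also have "\<dots> \<le> k ^ e" using ed k by (intro power_increasing) auto
  finally show False by simp
qed

lemma irr_chain_le_growth:
  assumes "irr_chain e Z" "Z e \<subseteq> X" "growth X d"
  shows "e \<le> d"
proof -
  obtain \<delta> where \<delta>: "\<And>k. indep (Z e) (k * \<delta>) ((k + e) choose e)"
    by (rule irr_chain_indep[OF assms(1)]) blast
  obtain c where c: "\<And>k. spanned X k (c * (k + 1) ^ d)" using assms(3) by (auto simp: growth_def)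
  have "(k + e) choose e \<le> c * (k * \<delta> + 1) ^ d" for k
    using indep_le_spanned[OF \<delta> spanned_mono[OF c assms(2) order.refl]] .
  then show ?thesis by (rule binomial_growth_bound)
qed

lemma algebraic_dim_le:
  fixes V :: "(complex ^ 'n::finite) set"
  assumes "growth V d"
  shows "algebraic_dim V \<le> enat d"
  unfolding algebraic_dim_def
proof (rule SUP_least, elim CollectE exE)
  fix e and Z :: "nat \<Rightarrow> (complex ^ 'n) set"
  assume Z: "(\<forall>i\<le>e. irreducible_algebraic_set (Z i) \<and> Z i \<subseteq> V) \<and> (\<forall>i<e. Z i \<subset> Z (Suc i))"
  then have "irr_chain e Z" "Z e \<subseteq> V" by (auto simp: irr_chain_def)
  from irr_chain_le_growth[OF this assms] show "enat e \<le> enat d" by simp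
qed

lemma algebraic_dim_ge:
  assumes "irr_chain d Z" "Z d \<subseteq> V"
  shows "enat d \<le> algebraic_dim V"
  unfolding algebraic_dim_def
proof (rule SUP_upper, rule CollectI, rule exI[of _ Z])
  show "(\<forall>i\<le>d. irreducible_algebraic_set (Z i) \<and> Z i \<subseteq> V) \<and> (\<forall>i<d. Z i \<subset> Z (Suc i))"
    using assms irr_chain_subset[OF assms(1)] by (auto simp: irr_chain_def)
qed

text \<open>On the line through \<open>a\<close> and \<open>b\<close> both functions become nonzero
  univariate polynomials, and their product has a point where it is nonzero.\<close>

lemma coord_space_nonzero_product:
  assumes "poly_fun f" "poly_fun g" "a \<in> coord_space D" "f a \<noteq> 0" "b \<in> coord_space D" "g b \<noteq> 0"
  obtains x where "x \<in> coord_space D" "f x \<noteq> 0" "g x \<noteq> 0"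
proof -
  obtain p where p: "\<And>z. poly p z = f (a + z *s (b - a))"
    by (rule poly_fun_line_poly[OF assms(1), where v = "b - a" and y = a]) blast
  obtain q where q: "\<And>z. poly q z = g (a + z *s (b - a))"
    by (rule poly_fun_line_poly[OF assms(2), where v = "b - a" and y = a]) blast
  have "poly p 0 \<noteq> 0" "poly q 1 \<noteq> 0" using p[of 0] q[of 1] assms by auto
  then have "p * q \<noteq> 0" by auto
  then obtain z where "poly (p * q) z \<noteq> 0" using poly_all_0_iff_0 by blast
  then show ?thesis using p q assms(3,5)
    by (intro that[of "a + z *s (b - a)"]) (auto intro: coord_space_add coord_space_smult coord_space_diff)
qed

lemma irreducible_coord_space: "irreducible_algebraic_set (coord_space D)"
  unfolding irreducible_algebraic_set_def
proof (intro conjI allI impI)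
  show "algebraic_set (coord_space D)" by (rule algebraic_coord_space)
  show "coord_space D \<noteq> {}" using zero_in_coord_space by blast
  fix A B assume AB: "algebraic_set A" "algebraic_set B" "coord_space D = A \<union> B"
  show "coord_space D = A \<or> coord_space D = B"
  proof (rule ccontr)
    assume "\<not> ?thesis"
    then obtain a b where ab: "a \<in> coord_space D" "a \<notin> A" "b \<in> coord_space D" "b \<notin> B" using AB(3) by blast
    obtain f where f: "poly_fun f" "\<And>y. y \<in> A \<Longrightarrow> f y = 0" "f a \<noteq> 0" using algebraic_setE[OF AB(1) ab(2)] by blast
    obtain g where g: "poly_fun g" "\<And>y. y \<in> B \<Longrightarrow> g y = 0" "g b \<noteq> 0" using algebraic_setE[OF AB(2) ab(4)] by blast
    obtain x where "x \<in> coord_space D" "f x \<noteq> 0" "g x \<noteq> 0"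
      using coord_space_nonzero_product[OF f(1) g(1) ab(1) f(3) ab(3) g(3)] by blast
    then show False using f g AB(3) by blast
  qed
qed

lemma irr_chain_coord_space:
  obtains Z where "irr_chain (card D) Z" "Z (card D) = coord_space D"
proof -
  have "\<exists>Z. irr_chain (card D) Z \<and> Z (card D) = coord_space D"
    using finite[of D]
  proof (induction D rule: finite_induct)
    case empty
    show ?case by (rule exI[of _ "\<lambda>_. coord_space {}"]) (auto simp: irr_chain_def irreducible_coord_space)
  next
    case (insert i D)
    then obtain Z where Z: "irr_chain (card D) Z" "Z (card D) = coord_space D" by blast
    have "axis i 1 \<in> coord_space (insert i D) - coord_space D" using insert.hyps by (auto simp: coord_space_def axis_def)
    then have "coord_space D \<subset> coord_space (insert i D)" using coord_space_mono[of D "insert i D"] by blast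
    then have "irr_chain (Suc (card D)) (Z(Suc (card D) := coord_space (insert i D)))"
      using Z irreducible_coord_space[of "insert i D"] by (auto simp: irr_chain_def le_Suc_eq less_Suc_eq)
    moreover have "card (insert i D) = Suc (card D)" using insert.hyps by simp
    ultimately show ?case
      by (intro exI[of _ "Z(Suc (card D) := coord_space (insert i D))"] conjI) (simp_all only: fun_upd_same)
  qed
  then show ?thesis using that by blast
qed

section \<open>Lifting irreducible sets through a projection\<close>

text \<open>A minimal algebraic subset of \<open>Y\<close> with image \<open>Z\<close> is irreducible. It exists by Zorn's lemma, since
  the fibres are finite.\<close>

lemma irreducible_lift:
  fixes V :: "(complex ^ 'n::finite) set"
  assumes f: "homog_poly m f" "\<And>x. x \<in> V \<Longrightarrow> f 1 x = 0" "f 0 e \<noteq> 0" and e: "e $ i = 1"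
    and Y: "algebraic_set Y" "Y \<subseteq> V" and Z: "irreducible_algebraic_set Z" "Z \<subseteq> proj_along i e ` Y"
  obtains Y' where "irreducible_algebraic_set Y'" "Y' \<subseteq> Y" "proj_along i e ` Y' = Z"
proof -
  define \<Y> where "\<Y> = {W. algebraic_set W \<and> W \<subseteq> Y \<and> proj_along i e ` W = Z}"
  define Y0 where "Y0 = Y \<inter> {x. proj_along i e x \<in> Z}"
  have fib: "finite {x \<in> Y. proj_along i e x = y}" for y
    by (rule rev_finite_subset[OF finite_proj_along_fibre[OF f, where i = i and y = y]]) (use Y(2) in auto)
  have "algebraic_set {x. proj_along i e x \<in> Z}"
  proof (rule algebraic_setI)
    fix x assume "x \<notin> {x. proj_along i e x \<in> Z}"
    then obtain g where "poly_fun g" "\<And>y. y \<in> Z \<Longrightarrow> g y = 0" "g (proj_along i e x) \<noteq> 0"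
      using Z(1) algebraic_setE[of Z "proj_along i e x"] by (auto simp: irreducible_algebraic_set_def)
    then show "\<exists>g. poly_fun g \<and> (\<forall>y\<in>{x. proj_along i e x \<in> Z}. g y = 0) \<and> g x \<noteq> 0"
      by (intro exI[of _ "\<lambda>x. g (proj_along i e x)"]) (auto intro: poly_fun_proj_along)
  qed
  then have Y0: "Y0 \<in> \<Y>" using Y Z unfolding \<Y>_def Y0_def by (auto intro: algebraic_Int)
  have "\<exists>W\<in>\<Y>. \<forall>X\<in>\<Y>. X \<subseteq> W \<longrightarrow> X = W"
  proof (rule predicate_Zorn[of \<Y> "\<lambda>A B. B \<subseteq> A", simplified])
    show "partial_order_on \<Y> (relation_of (\<lambda>A B. B \<subseteq> A) \<Y>)"
      by (rule partial_order_on_relation_ofI) auto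
    fix \<C> assume "\<C> \<in> Chains (relation_of (\<lambda>A B. B \<subseteq> A) \<Y>)"
    then have C: "\<C> \<subseteq> \<Y>" "\<And>A B. A \<in> \<C> \<Longrightarrow> B \<in> \<C> \<Longrightarrow> A \<subseteq> B \<or> B \<subseteq> A"
      by (auto simp: Chains_def relation_of_def)
    show "\<exists>U\<in>\<Y>. \<forall>A\<in>\<C>. U \<subseteq> A"
    proof (cases "\<C> = {}")
      case True then show ?thesis using Y0 by auto
    next
      case False
      have "z \<in> proj_along i e ` \<Inter>\<C>" if z: "z \<in> Z" for z
      proof -
        \<comment> \<open>Take a member of the chain whose fibre over \<open>z\<close> is smallest.
          A member inside it has the same fibre, so this fibre lies in the whole
          intersection.\<close>
        define c where "c A = card {x \<in> A. proj_along i e x = z}" for A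
        obtain A where A: "A \<in> \<C>" "\<And>B. B \<in> \<C> \<Longrightarrow> c A \<le> c B"
          using ex_has_least_nat[of "\<lambda>A. A \<in> \<C>" _ c] False by blast
        have "A \<in> \<Y>" using A C by blast
        then obtain x where x: "x \<in> A" "proj_along i e x = z" using z by (auto simp: \<Y>_def)
        have "x \<in> B" if B: "B \<in> \<C>" for B
        proof (cases "A \<subseteq> B")
          case False
          then have BA: "B \<subseteq> A" using C(2)[OF A(1) B] by blast
          have "finite {x \<in> A. proj_along i e x = z}"
            using fib[of z] \<open>A \<in> \<Y>\<close> by (auto simp: \<Y>_def elim: rev_finite_subset)
          then have "{x \<in> B. proj_along i e x = z} = {x \<in> A. proj_along i e x = z}"
            using A(2)[OF B] BA unfolding c_def by (intro card_seteq) auto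
          then show ?thesis using x by blast
        qed (use x in blast)
        then show ?thesis using x by blast
      qed
      moreover have "proj_along i e ` \<Inter>\<C> \<subseteq> Z" using False C(1) by (auto simp: \<Y>_def)
      ultimately have "proj_along i e ` \<Inter>\<C> = Z" by blast
      moreover have "algebraic_set (\<Inter>\<C>)" using C(1) by (intro algebraic_Inter) (auto simp: \<Y>_def)
      moreover have "\<Inter>\<C> \<subseteq> Y" using False C(1) unfolding \<Y>_def by blast
      ultimately have "\<Inter>\<C> \<in> \<Y>" unfolding \<Y>_def by simp
      then show ?thesis by blast
    qed
  qed
  then obtain W where W: "W \<in> \<Y>" "\<And>X. X \<in> \<Y> \<Longrightarrow> X \<subseteq> W \<Longrightarrow> X = W" by blast
  have "irreducible_algebraic_set W"
    unfolding irreducible_algebraic_set_def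
  proof (intro conjI allI impI)
    show "algebraic_set W" using W by (auto simp: \<Y>_def)
    show "W \<noteq> {}" using W Z by (auto simp: \<Y>_def irreducible_algebraic_set_def)
    fix A B assume AB: "algebraic_set A" "algebraic_set B" "W = A \<union> B"
    have sub: "A \<subseteq> V" "B \<subseteq> V" "A \<subseteq> Y" "B \<subseteq> Y" using W AB Y(2) by (auto simp: \<Y>_def)
    \<comment> \<open>The images of \<open>A\<close> and \<open>B\<close> are closed and cover
      \<open>Z\<close>, so one of them is already \<open>Z\<close>; minimality of \<open>W\<close>
      then makes that part all of \<open>W\<close>.\<close>
    have "algebraic_set (proj_along i e ` A)" "algebraic_set (proj_along i e ` B)"
      using sub f(2) by (auto intro!: algebraic_proj_along_image[OF _ f(1) _ f(3) e] AB)
    moreover have "Z = proj_along i e ` A \<union> proj_along i e ` B" using W AB by (auto simp: \<Y>_def)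
    ultimately have "Z = proj_along i e ` A \<or> Z = proj_along i e ` B"
      using Z(1) unfolding irreducible_algebraic_set_def by blast
    then have "A \<in> \<Y> \<or> B \<in> \<Y>" using AB sub by (auto simp: \<Y>_def)
    then show "W = A \<or> W = B" using W(2) AB(3) by blast
  qed
  then show ?thesis using that W by (auto simp: \<Y>_def)
qed

text \<open>Lifting starts with the largest set, and each further lift is made inside the one just
  found. Inclusions stay strict because the images differ.\<close>

lemma irr_chain_lift:
  fixes V :: "(complex ^ 'n::finite) set"
  assumes f: "homog_poly m f" "\<And>x. x \<in> V \<Longrightarrow> f 1 x = 0" "f 0 e \<noteq> 0" and e: "e $ i = 1"
    and "algebraic_set V" "irr_chain d Z" "Z d \<subseteq> proj_along i e ` V"
  obtains Y where "irr_chain d Y" "Y d \<subseteq> V"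
proof -
  have "\<exists>Y. irr_chain d Y \<and> Y d \<subseteq> W \<and> (\<forall>j\<le>d. proj_along i e ` Y j = Z j)"
    if "algebraic_set W" "W \<subseteq> V" "irr_chain d Z" "Z d \<subseteq> proj_along i e ` W" for W d
    using that
  proof (induction d arbitrary: W)
    case 0
    have "irreducible_algebraic_set (Z 0)" using 0 by (auto simp: irr_chain_def)
    from irreducible_lift[OF f e 0(1,2) this 0(4)] obtain Y' where
      "irreducible_algebraic_set Y'" "Y' \<subseteq> W" "proj_along i e ` Y' = Z 0" by blast
    then show ?case by (intro exI[of _ "\<lambda>_. Y'"]) (auto simp: irr_chain_def)
  next
    case (Suc d)
    have irr: "irreducible_algebraic_set (Z (Suc d))" "irr_chain d Z" and ss: "Z d \<subset> Z (Suc d)"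
      using Suc.prems by (auto simp: irr_chain_def)
    from irreducible_lift[OF f e Suc.prems(1,2) irr(1) Suc.prems(4)] obtain Y' where
      Y': "irreducible_algebraic_set Y'" "Y' \<subseteq> W" "proj_along i e ` Y' = Z (Suc d)" by blast
    have "algebraic_set Y'" "Y' \<subseteq> V" "Z d \<subseteq> proj_along i e ` Y'"
      using Y' Suc.prems(2) ss by (auto simp: irreducible_algebraic_set_def)
    from Suc.IH[OF this(1,2) irr(2) this(3)]
    obtain Y where Y: "irr_chain d Y" "Y d \<subseteq> Y'" "\<forall>j\<le>d. proj_along i e ` Y j = Z j" by blast
    have "Y d \<noteq> Y'" using Y(3) Y'(3) ss by auto
    then have "irr_chain (Suc d) (Y(Suc d := Y'))"
      using Y Y' by (auto simp: irr_chain_def le_Suc_eq less_Suc_eq)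
    moreover have "\<forall>j\<le>Suc d. proj_along i e ` (Y(Suc d := Y')) j = Z j" using Y Y' by (auto simp: le_Suc_eq)
    ultimately show ?case using Y' by (intro exI[of _ "Y(Suc d := Y')"] conjI) (simp_all only: fun_upd_same)
  qed
  from this[of V d] assms that show ?thesis by blast
qed

section \<open>The cone of common zeros of leading forms\<close>

lemma norm_vec_smult: "norm (c *s x) = norm c * norm (x :: complex ^ 'n::finite)"
  by (simp add: norm_vec_def norm_mult L2_set_right_distrib)

lemma scaleR_conv_smult: "r *\<^sub>R x = complex_of_real r *s (x :: complex ^ 'n::finite)"
  by (simp add: vec_eq_iff) (simp add: scaleR_conv_of_real)

text \<open>A bound \<open>k\<close> above the true degree gives the zero form and hence no
  condition, so these are the common zeros of the components of exact highest degree.\<close>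

definition leading_cone :: "(complex ^ 'n::finite) set \<Rightarrow> (complex ^ 'n) set" where
  "leading_cone V = {v. \<forall>k h. homog_poly k h \<longrightarrow> (\<forall>x\<in>V. h 1 x = 0) \<longrightarrow> h 0 v = 0}"

lemma leading_coneD: "v \<in> leading_cone V \<Longrightarrow> homog_poly k h \<Longrightarrow> (\<And>x. x \<in> V \<Longrightarrow> h 1 x = 0) \<Longrightarrow> h 0 v = 0"
  by (auto simp: leading_cone_def)

lemma leading_coneI: "(\<And>k h. homog_poly k h \<Longrightarrow> (\<And>x. x \<in> V \<Longrightarrow> h 1 x = 0) \<Longrightarrow> h 0 v = 0) \<Longrightarrow> v \<in> leading_cone V"
  by (auto simp: leading_cone_def)

lemma not_leading_coneE:
  assumes "v \<notin> leading_cone V"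
  obtains k h where "homog_poly k h" "\<And>x. x \<in> V \<Longrightarrow> h 1 x = 0" "h 0 v \<noteq> 0"
  using assms by (auto simp: leading_cone_def)

lemma leading_cone_smult: "v \<in> leading_cone V \<Longrightarrow> c *s v \<in> leading_cone V"
proof (rule leading_coneI)
  fix k h
  assume "v \<in> leading_cone V" and h: "homog_poly k h" "\<And>x. x \<in> V \<Longrightarrow> h 1 x = 0"
  then have "h 0 v = 0" by (rule leading_coneD)
  then show "h 0 (c *s v) = 0" using homog_poly_at0_scale[OF h(1)] by simp
qed

lemma leading_cone_mono:
  assumes "V \<subseteq> W" shows "leading_cone V \<subseteq> leading_cone W"
proof (intro subsetI leading_coneI)
  fix v k h assume "v \<in> leading_cone V" "homog_poly k h" "\<And>x. x \<in> W \<Longrightarrow> h 1 x = 0"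
  then show "h 0 v = 0" using assms leading_coneD[of v V k h] by (meson subsetD)
qed

lemma algebraic_leading_cone: "algebraic_set (leading_cone V)"
proof (rule algebraic_setI)
  fix x assume "x \<notin> leading_cone V"
  then obtain k h where h: "homog_poly k h" "\<And>x. x \<in> V \<Longrightarrow> h 1 x = 0" "h 0 x \<noteq> 0" by (rule not_leading_coneE) blast
  have "poly_fun (h 0)" using poly_fun_deg_homog_poly[OF homog_poly_at0[OF h(1)]] by (rule pfunI)
  moreover have "\<forall>y\<in>leading_cone V. h 0 y = 0" using leading_coneD h by blast
  ultimately show "\<exists>f. poly_fun f \<and> (\<forall>y\<in>leading_cone V. f y = 0) \<and> f x \<noteq> 0" using h(3) by blast
qed

text \<open>Homogeneity moves the scaling of \<open>v\<close> into the homogenizing variable, which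
  tends to 0 as \<open>c\<close> grows.\<close>

lemma conic_subset_leading_cone:
  assumes "\<And>c. c *s v \<in> X"
  shows "v \<in> leading_cone X"
proof (rule leading_coneI)
  fix k h
  assume h: "homog_poly k h" "\<And>x. x \<in> X \<Longrightarrow> h 1 x = 0"
  have "h (1 / c) v = 0" if "c \<noteq> 0" for c
    using homog_poly_scale[OF h(1), of "1 / c" 1 "c *s v"] h(2)[OF assms, of c] that by simp
  then have "h (1 / of_nat (Suc j)) v = 0" for j using of_nat_neq_0 by blast
  moreover have "(\<lambda>j. h (1 / of_nat (Suc j)) v) \<longlonglongrightarrow> h 0 v"
    by (intro homog_poly_tendsto[OF h(1)] tendsto_intros LIMSEQ_Suc[OF lim_1_over_n])
  ultimately show "h 0 v = 0" by (simp add: LIMSEQ_const_iff)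
qed

text \<open>It lets a direction chosen outside the cone of \<open>V\<close> serve for projecting the
  cone as well.\<close>

lemma leading_cone_idem: "leading_cone (leading_cone V) = leading_cone V"
proof
  show "leading_cone V \<subseteq> leading_cone (leading_cone V)" by (auto intro: conic_subset_leading_cone leading_cone_smult)
  show "leading_cone (leading_cone V) \<subseteq> leading_cone V"
  proof (intro subsetI leading_coneI)
    fix w k h
    assume w: "w \<in> leading_cone (leading_cone V)" and h: "homog_poly k h" "\<And>x. x \<in> V \<Longrightarrow> h 1 x = 0"
    show "h 0 w = 0" using leading_coneD[OF w homog_poly_at0[OF h(1)]] leading_coneD[OF _ h] by blast
  qed
qed

lemma leading_cone_subset_coord_space:
  assumes "V \<subseteq> coord_space D"
  shows "leading_cone V \<subseteq> coord_space D"
proof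
  fix v assume v: "v \<in> leading_cone V"
  have "v $ i = 0" if "i \<notin> D" for i
    by (rule leading_coneD[OF v homog_poly_var]) (use assms that in \<open>auto simp: coord_space_def\<close>)
  then show "v \<in> coord_space D" by (simp add: coord_space_def)
qed

lemma leading_cone_coord_space: "leading_cone (coord_space D) = coord_space D"
  using leading_cone_subset_coord_space[of "coord_space D" D] by (auto intro: conic_subset_leading_cone coord_space_smult)

lemma leading_cone_empty: "leading_cone {} = {}"
  using homog_poly_const[of 1] by (force simp: leading_cone_def)

lemma zero_in_leading_cone:
  assumes "V \<noteq> {}" shows "0 \<in> leading_cone V"
proof (rule leading_coneI)
  fix k h
  assume h: "homog_poly k h" "\<And>x. x \<in> V \<Longrightarrow> h 1 x = 0"
  show "h 0 0 = 0"
  proof (cases "k = 0")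
    case True
    obtain x where "x \<in> V" using assms by blast
    then show ?thesis using h True homog_poly_0_const[of h 1 x] by simp
  next
    case False then show ?thesis using homog_poly_at_origin[OF h(1)] by simp
  qed
qed

text \<open>Scaling a point by \<open>1 / T j\<close> puts the same factor into the homogenizing
  variable, so in the limit an equation of \<open>V\<close> turns into its leading form.\<close>

lemma limit_in_leading_cone:
  assumes "\<And>j. x j \<in> V" "filterlim T at_top sequentially" "(\<lambda>j. (1 / T j) *\<^sub>R x j) \<longlonglongrightarrow> v"
  shows "v \<in> leading_cone V"
proof (rule leading_coneI)
  fix k h
  assume h: "homog_poly k h" "\<And>x. x \<in> V \<Longrightarrow> h 1 x = 0"
  have "(\<lambda>j. 1 / T j) \<longlonglongrightarrow> 0"
    using tendsto_inverse_0_at_top[OF assms(2)] by (simp add: inverse_eq_divide)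
  then have "(\<lambda>j. complex_of_real (1 / T j)) \<longlonglongrightarrow> 0"
    by (subst of_real_0[symmetric]) (rule tendsto_of_real)
  then have "(\<lambda>j. h (complex_of_real (1 / T j)) ((1 / T j) *\<^sub>R x j)) \<longlonglongrightarrow> h 0 v"
    by (rule homog_poly_tendsto[OF h(1) _ assms(3)])
  moreover have "h (complex_of_real (1 / T j)) ((1 / T j) *\<^sub>R x j) = 0" for j
    using homog_poly_scale[OF h(1), of "complex_of_real (1 / T j)" 1 "x j"] h(2)[OF assms(1)[of j]]
    by (simp add: scaleR_conv_smult)
  ultimately show "h 0 v = 0" by (simp add: LIMSEQ_const_iff)
qed

lemma proj_along_leading_cone: "v \<in> leading_cone V \<Longrightarrow> proj_along i e v \<in> leading_cone (proj_along i e ` V)"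
proof (rule leading_coneI)
  fix k h
  assume "v \<in> leading_cone V" and h: "homog_poly k h" "\<And>x. x \<in> proj_along i e ` V \<Longrightarrow> h 1 x = 0"
  then show "h 0 (proj_along i e v) = 0" using leading_coneD[OF _ homog_poly_proj_along[OF h(1)]] by blast
qed

lemma normalize_direction:
  assumes "e \<in> coord_space D" "e \<notin> leading_cone X" "X \<noteq> {}"
  obtains i e' where "i \<in> D" "e' $ i = 1" "e' \<in> coord_space D" "e' \<notin> leading_cone X"
proof -
  have "e \<noteq> 0" using assms zero_in_leading_cone by blast
  then obtain i where i: "e $ i \<noteq> 0" by (auto simp: vec_eq_iff)
  then have "i \<in> D" using assms(1) by (auto simp: coord_space_def)
  moreover have "(1 / e $ i) *s e \<notin> leading_cone X"
  proof
    assume "(1 / e $ i) *s e \<in> leading_cone X"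
    from leading_cone_smult[OF this, of "e $ i"] show False using assms(2) i by simp
  qed
  ultimately show ?thesis
    using i assms(1) by (intro that[of i "(1 / e $ i) *s e"]) (auto intro: coord_space_smult)
qed

text \<open>The leading form may vanish on \<open>coord_space D\<close> although the polynomial does
  not. Then splitting off \<open>s\<close> gives the same function there with a smaller degree
  bound, and this ends at a form that does not vanish.\<close>

lemma coord_space_leading_form:
  assumes "homog_poly k h" "p \<in> coord_space D" "h 1 p \<noteq> 0"
  obtains l g e where "homog_poly l g" "\<And>x. x \<in> coord_space D \<Longrightarrow> g 1 x = h 1 x" "e \<in> coord_space D" "g 0 e \<noteq> 0"
proof -
  have "\<exists>l g e. homog_poly l g \<and> (\<forall>x\<in>coord_space D. g 1 x = h 1 x) \<and> e \<in> coord_space D \<and> g 0 e \<noteq> 0"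
    using assms
  proof (induction k arbitrary: h)
    case 0
    then show ?case using homog_poly_0_const[of h 1 p] homog_poly_0_const[of h 0 p] by metis
  next
    case (Suc k)
    show ?case
    proof (cases "\<exists>e\<in>coord_space D. h 0 e \<noteq> 0")
      case True then show ?thesis using Suc.prems(1) by blast
    next
      case False
      obtain g where g: "homog_poly k g" "\<And>s x. h s x = s * g s x + h 0 x"
        by (rule homog_poly_split_s[OF Suc.prems(1)]) blast
      have eq: "g 1 x = h 1 x" if "x \<in> coord_space D" for x using g(2)[of 1 x] False that by auto
      from Suc.IH[OF g(1) Suc.prems(2)] Suc.prems(2,3) eq show ?thesis by metis
    qed
  qed
  then show ?thesis using that by blast
qed

lemma direction_off_leading_cone:
  assumes "poly_fun f" "\<And>x. x \<in> X \<Longrightarrow> f x = 0" "X \<subseteq> coord_space D" "p \<in> coord_space D" "f p \<noteq> 0"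
  obtains e where "e \<in> coord_space D" "e \<notin> leading_cone X"
proof -
  obtain k h where h: "homog_poly k h" "f = h 1" using assms(1) by (auto simp: poly_fun_def poly_fun_deg_def)
  obtain l g e where g: "homog_poly l g" "\<And>x. x \<in> coord_space D \<Longrightarrow> g 1 x = h 1 x" "e \<in> coord_space D" "g 0 e \<noteq> 0"
    using coord_space_leading_form[OF h(1) assms(4)] assms(5) h(2) by blast
  have "e \<notin> leading_cone X" using leading_coneD[of e X l g] g assms(2,3) h(2) by fastforce
  then show ?thesis using that g by blast
qed

text \<open>On lines through \<open>V\<close> in direction \<open>v\<close> the polynomial
  \<open>h\<close> vanishes identically, so all its coefficients along \<open>v\<close> vanish on
  \<open>V\<close>. Their leading forms vanish at \<open>w\<close> and recombine to
  \<open>h 0\<close>.\<close>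

lemma join_subset_leading_cone:
  assumes w: "w \<in> leading_cone V" and X: "\<And>x z. x \<in> V \<Longrightarrow> x + z *s v \<in> X"
  shows "w + z *s v \<in> leading_cone X"
proof (rule leading_coneI)
  fix k h
  assume h: "homog_poly k h" "\<And>x. x \<in> X \<Longrightarrow> h 1 x = 0"
  obtain c where c: "\<And>j. j \<le> k \<Longrightarrow> homog_poly (k - j) (c j)" "\<And>j. j > k \<Longrightarrow> c j = (\<lambda>s y. 0)"
    "\<And>s y z. h s (y + z *s v) = (\<Sum>j\<le>k. c j s y * z ^ j)" by (rule homog_poly_line[OF h(1), where v = v]) blast
  have "c j 0 w = 0" if j: "j \<le> k" for j
  proof (rule leading_coneD[OF w c(1)[OF j]])
    fix x assume x: "x \<in> V"
    let ?q = "\<Sum>j\<le>k. monom (c j 1 x) j"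
    have "poly ?q z = 0" for z
      using h(2)[OF X[OF x, of z]] c(3)[of 1 x z] by (simp add: poly_sum poly_monom)
    then have "?q = 0" by (simp add: poly_all_0_iff_0[symmetric])
    then have "coeff ?q j = 0" by simp
    then show "c j 1 x = 0" using j by (simp add: coeff_sum)
  qed
  then show "h 0 (w + z *s v) = 0" by (simp add: c(3))
qed

section \<open>Convergence of rescaled points\<close>

text \<open>The coordinate lost under projection is bounded linearly in the projected point, so
  after rescaling it stays bounded and has a convergent subsequence.\<close>

lemma compactness:
  fixes V :: "(complex ^ 'n::finite) set"
  assumes e: "e \<notin> leading_cone V" "e $ i = 1" and x: "\<And>j. x j \<in> V"
    and T: "filterlim T at_top sequentially" "\<And>j. T j > 0"
    and y: "(\<lambda>j. (1 / T j) *\<^sub>R proj_along i e (x j)) \<longlonglongrightarrow> y"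
  obtains r w where "strict_mono (r :: nat \<Rightarrow> nat)" "w \<in> leading_cone V" "proj_along i e w = y"
    "(\<lambda>j. (1 / T (r j)) *\<^sub>R x (r j)) \<longlonglongrightarrow> w"
proof -
  obtain m f where f: "homog_poly m f" "\<And>x. x \<in> V \<Longrightarrow> f 1 x = 0" "f 0 e \<noteq> 0"
    using e(1) by (rule not_leading_coneE) blast
  obtain K where K: "K > 0" "\<And>y z. y + z *s e \<in> V \<Longrightarrow> norm z \<le> K * (1 + norm y)"
    by (rule proj_along_coordinate_bound[OF f]) blast+
  define z where "z j = complex_of_real (1 / T j) * x j $ i" for j
  have T0: "(\<lambda>j. 1 / T j) \<longlonglongrightarrow> 0"
    using tendsto_inverse_0_at_top[OF T(1)] by (simp add: inverse_eq_divide)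
  have zb: "norm (z j) \<le> K * (1 / T j + norm ((1 / T j) *\<^sub>R proj_along i e (x j)))" for j
  proof -
    have "norm (x j $ i) \<le> K * (1 + norm (proj_along i e (x j)))"
      using K(2)[of "proj_along i e (x j)" "x j $ i"] x by (simp add: proj_along_decomp)
    then have "(1 / T j) * norm (x j $ i) \<le> (1 / T j) * (K * (1 + norm (proj_along i e (x j))))"
      using T(2)[of j] by (intro mult_left_mono) auto
    then show ?thesis using T(2)[of j] by (simp add: z_def norm_mult norm_divide algebra_simps)
  qed
  have "(\<lambda>j. K * (1 / T j + norm ((1 / T j) *\<^sub>R proj_along i e (x j)))) \<longlonglongrightarrow> K * (0 + norm y)"
    by (intro tendsto_intros T0 y)
  then have "Bseq (\<lambda>j. K * (1 / T j + norm ((1 / T j) *\<^sub>R proj_along i e (x j))))"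
    by (intro convergent_imp_Bseq) (auto simp: convergent_def)
  then obtain B where B: "\<And>j. norm (K * (1 / T j + norm ((1 / T j) *\<^sub>R proj_along i e (x j)))) \<le> B"
    by (auto simp: Bseq_def)
  have "norm (z j) \<le> B" for j using zb[of j] B[of j] by (metis abs_ge_self order.trans real_norm_def)
  then have "bounded (range z)" by (auto simp: bounded_iff)
  then obtain l r where r: "strict_mono (r :: nat \<Rightarrow> nat)" "(z \<circ> r) \<longlonglongrightarrow> l"
    using bounded_imp_convergent_subsequence by blast
  have eq: "(1 / T j) *\<^sub>R proj_along i e (x j) + z j *s e = (1 / T j) *\<^sub>R x j" for j
  proof -
    have "(1 / T j) *\<^sub>R x j = (1 / T j) *\<^sub>R (proj_along i e (x j) + (x j $ i) *s e)" by (simp add: proj_along_decomp)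
    then show ?thesis by (simp add: scaleR_add_right z_def scaleR_conv_smult)
  qed
  have "(\<lambda>j. (1 / T (r j)) *\<^sub>R proj_along i e (x (r j)) + z (r j) *s e) \<longlonglongrightarrow> y + l *s e"
    using LIMSEQ_subseq_LIMSEQ[OF y r(1)] r(2)
    by (intro tendsto_intros tendsto_vec_smult) (auto simp: o_def)
  then have lim: "(\<lambda>j. (1 / T (r j)) *\<^sub>R x (r j)) \<longlonglongrightarrow> y + l *s e" by (simp add: eq)
  have Tr: "filterlim (\<lambda>j. T (r j)) at_top sequentially"
    using filterlim_compose[OF T(1) filterlim_subseq[OF r(1)]] by (simp add: o_def)
  have "y + l *s e \<in> leading_cone V" by (rule limit_in_leading_cone[OF _ Tr lim]) (rule x)
  moreover have "proj_along i e (y + l *s e) = y"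
  proof (rule LIMSEQ_unique)
    show "(\<lambda>j. proj_along i e ((1 / T (r j)) *\<^sub>R x (r j))) \<longlonglongrightarrow> proj_along i e (y + l *s e)"
      by (rule tendsto_proj_along[OF lim])
    show "(\<lambda>j. proj_along i e ((1 / T (r j)) *\<^sub>R x (r j))) \<longlonglongrightarrow> y"
      using LIMSEQ_subseq_LIMSEQ[OF y r(1)] by (simp add: proj_along_scaleR o_def)
  qed
  ultimately show ?thesis using that r(1) lim by blast
qed

text \<open>The lower limit of the rescaled sets over all real scales, so that one statement covers
  every sequence \<open>T\<close>.\<close>

definition inner_cone :: "(complex ^ 'n::finite) set \<Rightarrow> (complex ^ 'n) set" where
  "inner_cone V = {v. \<forall>\<epsilon>>0. \<forall>\<^sub>F t in at_top. \<exists>x\<in>V. dist ((1 / t) *\<^sub>R x) v < \<epsilon>}"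

lemma inner_cone_mono: "V \<subseteq> W \<Longrightarrow> inner_cone V \<subseteq> inner_cone W"
  unfolding inner_cone_def by (intro subsetI CollectI allI impI) (drule CollectD, drule spec, drule mp,
    assumption, erule eventually_mono, blast)

text \<open>Points nearly minimizing the distance to \<open>v\<close> are chosen at every index,
  also where the rescaled set is still far from \<open>v\<close>. The slack \<open>1 / Suc j\<close>
  avoids asking that the infimum be attained.\<close>

lemma inner_cone_sequence:
  assumes v: "v \<in> inner_cone V" and T: "filterlim T at_top sequentially"
  obtains x where "\<And>j. x j \<in> V" "(\<lambda>j. (1 / T j) *\<^sub>R x j) \<longlonglongrightarrow> v"
proof -
  have ev: "\<forall>\<^sub>F t in at_top. \<exists>x\<in>V. dist ((1 / t) *\<^sub>R x) v < \<epsilon>" if "\<epsilon> > 0" for \<epsilon>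
    using v that by (simp add: inner_cone_def)
  have ne: "V \<noteq> {}"
    using eventually_happens[OF ev[of 1]] by auto
  define S where "S j = (\<lambda>x. (1 / T j) *\<^sub>R x) ` V" for j
  have Sne: "S j \<noteq> {}" for j using ne by (simp add: S_def)
  have "\<exists>x\<in>V. dist v ((1 / T j) *\<^sub>R x) < infdist v (S j) + 1 / Suc j" for j
  proof -
    have "(INF a\<in>S j. dist v a) < infdist v (S j) + 1 / Suc j"
      using Sne by (simp add: infdist_def)
    then obtain a where "a \<in> S j" "dist v a < infdist v (S j) + 1 / Suc j"
      using Sne[of j] by (subst (asm) cINF_less_iff) auto
    then show ?thesis by (auto simp: S_def)
  qed
  then obtain x where x: "\<And>j. x j \<in> V" "\<And>j. dist v ((1 / T j) *\<^sub>R x j) < infdist v (S j) + 1 / Suc j"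
    by metis
  have "(\<lambda>j. infdist v (S j)) \<longlonglongrightarrow> 0"
  proof (rule tendstoI)
    fix \<epsilon> :: real assume "\<epsilon> > 0"
    have "\<forall>\<^sub>F j in sequentially. \<exists>x\<in>V. dist ((1 / T j) *\<^sub>R x) v < \<epsilon>"
      using filterlim_iff[THEN iffD1, OF T] ev[OF \<open>\<epsilon> > 0\<close>] by blast
    then show "\<forall>\<^sub>F j in sequentially. dist (infdist v (S j)) 0 < \<epsilon>"
    proof (rule eventually_mono)
      fix j assume "\<exists>x\<in>V. dist ((1 / T j) *\<^sub>R x) v < \<epsilon>"
      then obtain y where "y \<in> V" "dist ((1 / T j) *\<^sub>R y) v < \<epsilon>" by blast
      moreover from \<open>y \<in> V\<close> have "infdist v (S j) \<le> dist v ((1 / T j) *\<^sub>R y)"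
        by (intro infdist_le) (auto simp: S_def)
      ultimately show "dist (infdist v (S j)) 0 < \<epsilon>" by (simp add: infdist_nonneg dist_commute)
    qed
  qed
  then have lim: "(\<lambda>j. infdist v (S j) + 1 / Suc j) \<longlonglongrightarrow> 0 + 0"
    by (intro tendsto_add LIMSEQ_Suc[OF lim_1_over_n])
  have "(\<lambda>j. dist ((1 / T j) *\<^sub>R x j) v) \<longlonglongrightarrow> 0"
  proof (rule tendsto_sandwich[where f = "\<lambda>_. 0" and h = "\<lambda>j. infdist v (S j) + 1 / Suc j"])
    show "(\<lambda>j. infdist v (S j) + 1 / Suc j) \<longlonglongrightarrow> 0" using lim by (simp only: add_0)
    show "\<forall>\<^sub>F j in sequentially. dist ((1 / T j) *\<^sub>R x j) v \<le> infdist v (S j) + 1 / Suc j"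
      using less_imp_le[OF x(2)] by (simp only: dist_commute eventually_True)
  qed simp_all
  then have "(\<lambda>j. (1 / T j) *\<^sub>R x j) \<longlonglongrightarrow> v" by (rule tendsto_dist_iff[THEN iffD2])
  with x(1) show ?thesis using that by blast
qed

lemma proj_along_leading_cone_surj:
  fixes V :: "(complex ^ 'n::finite) set"
  assumes "e \<notin> leading_cone V" "e $ i = 1" "w \<in> inner_cone (proj_along i e ` V)"
  shows "w \<in> proj_along i e ` leading_cone V"
proof -
  let ?T = "\<lambda>j. real (Suc j)"
  have T: "filterlim ?T at_top sequentially"
    by (rule filterlim_compose[OF filterlim_real_sequentially filterlim_Suc])
  obtain u where u: "\<And>j. u j \<in> proj_along i e ` V" "(\<lambda>j. (1 / ?T j) *\<^sub>R u j) \<longlonglongrightarrow> w"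
    using inner_cone_sequence[OF assms(3) T] by blast
  have "\<forall>j. \<exists>y. y \<in> V \<and> u j = proj_along i e y" using u(1) by blast
  then obtain x where x: "\<And>j. x j \<in> V" "\<And>j. u j = proj_along i e (x j)" by metis
  have "(\<lambda>j. (1 / ?T j) *\<^sub>R proj_along i e (x j)) \<longlonglongrightarrow> w" using u(2) x(2) by simp
  from compactness[OF assms(1,2) x(1) T _ this] show ?thesis by auto
qed

section \<open>Codimension at least two\<close>

text \<open>The join is parametrized by \<open>V\<close> times a line, so its Hilbert function has
  order at most \<open>d + 1\<close>. If every polynomial vanishing on it vanished on
  \<open>coord_space D\<close>, the order would have to be at least \<open>card D\<close>.\<close>

lemma join_not_dense:
  fixes V :: "(complex ^ 'n::finite) set"
  assumes "growth V d" "d + 2 \<le> card D"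
  obtains p a where "poly_fun p" "\<And>x z. x \<in> V \<Longrightarrow> p (x + z *s v) = 0" "a \<in> coord_space D" "p a \<noteq> 0"
proof -
  have "\<exists>p a. poly_fun p \<and> (\<forall>x\<in>V. \<forall>z. p (x + z *s v) = 0) \<and> a \<in> coord_space D \<and> p a \<noteq> 0"
  proof (rule ccontr)
    assume "\<not> ?thesis"
    then have dense: "\<And>p a. poly_fun p \<Longrightarrow> (\<forall>x\<in>V. \<forall>z. p (x + z *s v) = 0) \<Longrightarrow> a \<in> coord_space D \<Longrightarrow> p a = 0" by blast
    obtain Z where Z: "irr_chain (card D) Z" "Z (card D) = coord_space D" by (rule irr_chain_coord_space)
    obtain \<delta> where \<delta>: "\<And>k. indep (coord_space D) (k * \<delta>) ((k + card D) choose card D)"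
      using irr_chain_indep[OF Z(1)] Z(2) by metis
    obtain c where c: "\<And>k. spanned V k (c * (k + 1) ^ d)" using assms(1) by (auto simp: growth_def)
    let ?g = "\<lambda>(x, z). x + z *s v" and ?T = "V \<times> (UNIV :: complex set)"
    have "(k + card D) choose card D \<le> c * (k * \<delta> + 1) ^ (d + 1)" for k
    proof -
      let ?k = "k * \<delta>"
      obtain p where p: "\<forall>t<(k + card D) choose card D. poly_fun_deg ?k (p t)"
        "\<And>c. \<forall>x\<in>coord_space D. (\<Sum>t<(k + card D) choose card D. c t * p t x) = 0 \<Longrightarrow>
          \<forall>t<(k + card D) choose card D. c t = 0"
        using \<delta>[of k] unfolding indep_def by blast
      \<comment> \<open>By \<open>dense\<close>, a combination that vanishes on the join vanishes on
        \<open>coord_space D\<close>, so independence there passes to the join.\<close>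
      have ind: "indep (?g ` ?T) ?k ((k + card D) choose card D)"
        unfolding indep_def
      proof (rule exI[of _ p], rule conjI, goal_cases)
        case 1
        show ?case by (rule p(1))
      next
        case 2
        show ?case
        proof (rule allI, rule impI)
        fix c assume c: "\<forall>x\<in>?g ` ?T. (\<Sum>t<(k + card D) choose card D. c t * p t x) = 0"
        show "\<forall>t<(k + card D) choose card D. c t = 0"
        proof (rule p(2), rule ballI)
          fix a assume "a \<in> coord_space D"
          show "(\<Sum>t<(k + card D) choose card D. c t * p t a) = 0"
          proof (rule dense[OF _ _ \<open>a \<in> coord_space D\<close>])
            show "poly_fun (\<lambda>a. \<Sum>t<(k + card D) choose card D. c t * p t a)"
              using p(1) by (intro poly_fun_sum poly_fun_mult poly_fun_const) (auto intro: pfunI)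
            show "\<forall>x\<in>V. \<forall>z. (\<Sum>t<(k + card D) choose card D. c t * p t (x + z *s v)) = 0"
              using c by auto
          qed
        qed
        qed
      qed
      obtain I :: "nat set" and b where I: "finite I" "card I \<le> c * (?k + 1) ^ d"
        "\<And>p. poly_fun_deg ?k p \<Longrightarrow> \<exists>a. \<forall>x\<in>V. p x = (\<Sum>l\<in>I. a l * b l x)"
        using c[of ?k] unfolding spanned_def by blast
      \<comment> \<open>Pulled back to the product, polynomials are combinations of spanning
        functions on \<open>V\<close> times powers of \<open>z\<close> up to \<open>?k\<close>; the
        line costs a factor \<open>?k + 1\<close>.\<close>
      have "(k + card D) choose card D \<le> card (I \<times> {..?k})"
      proof (rule indep_le[OF ind order.refl, where b = "\<lambda>(l, j) (x, z). b l x * z ^ j"])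
        show "finite (I \<times> {..?k})" using I by simp
        fix p :: "complex ^ 'n \<Rightarrow> complex" assume "poly_fun_deg ?k p"
        then obtain q where q: "\<And>j. j \<le> ?k \<Longrightarrow> poly_fun_deg (?k - j) (q j)"
          "\<And>y z. p (y + z *s v) = (\<Sum>j\<le>?k. q j y * z ^ j)" by (rule poly_fun_deg_line) blast
        have "\<forall>j. \<exists>a. j \<le> ?k \<longrightarrow> (\<forall>x\<in>V. q j x = (\<Sum>l\<in>I. a l * b l x))"
          using I(3) poly_fun_deg_mono[OF q(1) diff_le_self] by blast
        then obtain a where a: "\<And>j x. j \<le> ?k \<Longrightarrow> x \<in> V \<Longrightarrow> q j x = (\<Sum>l\<in>I. a j l * b l x)" by metis
        have "p (x + z *s v) = (\<Sum>(l, j)\<in>I \<times> {..?k}. a j l * (b l x * z ^ j))" if "x \<in> V" for x z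
        proof -
          have "p (x + z *s v) = (\<Sum>j\<le>?k. \<Sum>l\<in>I. a j l * (b l x * z ^ j))"
            using that by (simp add: q(2) a sum_distrib_right mult.assoc)
          also have "\<dots> = (\<Sum>l\<in>I. \<Sum>j\<le>?k. a j l * (b l x * z ^ j))" by (rule sum.swap)
          also have "\<dots> = (\<Sum>(l, j)\<in>I \<times> {..?k}. a j l * (b l x * z ^ j))"
            by (rule sum.cartesian_product)
          finally show ?thesis .
        qed
        then show "\<exists>a. \<forall>t\<in>?T. p (?g t) = (\<Sum>l\<in>I \<times> {..?k}. a l * (\<lambda>(l, j) (x, z). b l x * z ^ j) l t)"
          by (intro exI[of _ "\<lambda>(l, j). a j l"]) (auto intro!: sum.cong)
      qed
      also have "\<dots> = card I * (?k + 1)" by (simp add: card_cartesian_product)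
      also have "\<dots> \<le> c * (?k + 1) ^ d * (?k + 1)" using I(2) by (rule mult_right_mono) simp
      finally show ?thesis by (simp add: mult_ac)
    qed
    then have "card D \<le> d + 1" by (rule binomial_growth_bound)
    with assms(2) show False by simp
  qed
  then show ?thesis using that by blast
qed

text \<open>Choosing the \<open>j\<close>-th bad scale at least \<open>Suc j\<close> makes the
  scales positive and divergent at once.\<close>

lemma not_inner_cone:
  assumes "v \<notin> inner_cone V"
  obtains \<epsilon> T where "\<epsilon> > 0" "\<And>j. T j > (0::real)" "filterlim T at_top sequentially"
    "\<And>j x. x \<in> V \<Longrightarrow> dist ((1 / T j) *\<^sub>R x) v \<ge> \<epsilon>"
proof -
  obtain \<epsilon> where \<epsilon>: "\<epsilon> > 0" "\<not> (\<forall>\<^sub>F t in at_top. \<exists>x\<in>V. dist ((1 / t) *\<^sub>R x) v < \<epsilon>)"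
    using assms by (auto simp: inner_cone_def)
  have "\<exists>t. t \<ge> real (Suc j) \<and> (\<forall>x\<in>V. dist ((1 / t) *\<^sub>R x) v \<ge> \<epsilon>)" for j
    using \<epsilon>(2) unfolding eventually_at_top_linorder by (meson not_less)
  then obtain T where T: "\<And>j. T j \<ge> real (Suc j)" "\<And>j x. x \<in> V \<Longrightarrow> dist ((1 / T j) *\<^sub>R x) v \<ge> \<epsilon>"
    by metis
  have "filterlim (\<lambda>j. real (Suc j)) at_top sequentially"
    by (rule filterlim_compose[OF filterlim_real_sequentially filterlim_Suc])
  then have "filterlim T at_top sequentially"
    by (rule filterlim_at_top_mono) (use T(1) in auto)
  moreover have "T j > 0" for j using T(1)[of j] by (simp add: less_le_trans[rotated])
  ultimately show ?thesis using that \<epsilon>(1) T(2) by blast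
qed

text \<open>Projecting along a direction outside the join of the cone with \<open>v\<close>, the fibre of the cone
  through \<open>v\<close> is \<open>v\<close> alone, so points of \<open>V\<close> whose projections approach that of \<open>v\<close> approach \<open>v\<close>.\<close>

lemma leading_cone_subset_inner_cone_small:
  fixes V :: "(complex ^ 'n::finite) set"
  assumes V: "algebraic_set V" "V \<subseteq> coord_space D" and gr: "growth V d" "d + 2 \<le> card D"
    and IH: "\<And>i W. i \<in> D \<Longrightarrow> algebraic_set W \<Longrightarrow> W \<subseteq> coord_space (D - {i}) \<Longrightarrow> leading_cone W \<subseteq> inner_cone W"
  shows "leading_cone V \<subseteq> inner_cone V"
proof
  fix v assume v: "v \<in> leading_cone V"
  have ne: "V \<noteq> {}" using v leading_cone_empty by auto
  have vD: "v \<in> coord_space D" using v leading_cone_subset_coord_space[OF V(2)] by blast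
  define X where "X = (\<lambda>(x, z). x + z *s v) ` (V \<times> UNIV)"
  obtain p a where p: "poly_fun p" "\<And>x z. x \<in> V \<Longrightarrow> p (x + z *s v) = 0" "a \<in> coord_space D" "p a \<noteq> 0"
    by (rule join_not_dense[OF gr, where v = v]) blast
  have XD: "X \<subseteq> coord_space D" using V(2) vD by (auto simp: X_def intro!: coord_space_add coord_space_smult)
  have "p x = 0" if "x \<in> X" for x using that p(2) by (auto simp: X_def)
  then obtain e0 where e0: "e0 \<in> coord_space D" "e0 \<notin> leading_cone X"
    using direction_off_leading_cone[OF p(1) _ XD p(3,4)] by blast
  have "X \<noteq> {}" using ne by (simp add: X_def)
  with e0 obtain i e where e: "i \<in> D" "e $ i = 1" "e \<in> coord_space D" "e \<notin> leading_cone X"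
    by (rule normalize_direction) blast
  have Xmem: "x + z *s v \<in> X" if "x \<in> V" for x z
    unfolding X_def by (rule image_eqI[of _ _ "(x, z)"]) (use that in auto)
  have "V \<subseteq> X" using Xmem[where z = 0] by auto
  then have eV: "e \<notin> leading_cone V" using e(4) leading_cone_mono by blast
  then obtain m f where f: "homog_poly m f" "\<And>x. x \<in> V \<Longrightarrow> f 1 x = 0" "f 0 e \<noteq> 0" by (rule not_leading_coneE) blast
  have "algebraic_set (proj_along i e ` V)" by (rule algebraic_proj_along_image[OF V(1) f e(2)])
  moreover have "proj_along i e ` V \<subseteq> coord_space (D - {i})" using V(2) e by (auto intro: proj_along_coord_space)
  ultimately have pv: "proj_along i e v \<in> inner_cone (proj_along i e ` V)"
    using IH[OF e(1)] proj_along_leading_cone[OF v] by blast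
  show "v \<in> inner_cone V"
  proof (rule ccontr)
    assume "v \<notin> inner_cone V"
    then obtain \<epsilon> T where T: "\<epsilon> > 0" "\<And>j. T j > (0::real)" "filterlim T at_top sequentially"
      "\<And>j x. x \<in> V \<Longrightarrow> dist ((1 / T j) *\<^sub>R x) v \<ge> \<epsilon>" by (rule not_inner_cone) blast
    obtain u where u: "\<And>j. u j \<in> proj_along i e ` V" "(\<lambda>j. (1 / T j) *\<^sub>R u j) \<longlonglongrightarrow> proj_along i e v"
      using inner_cone_sequence[OF pv T(3)] by blast
    have "\<forall>j. \<exists>y. y \<in> V \<and> u j = proj_along i e y" using u(1) by blast
  then obtain x where x: "\<And>j. x j \<in> V" "\<And>j. u j = proj_along i e (x j)" by metis
    have "(\<lambda>j. (1 / T j) *\<^sub>R proj_along i e (x j)) \<longlonglongrightarrow> proj_along i e v" using u(2) x(2) by simp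
    from compactness[OF eV e(2) x(1) T(3,2) this] obtain r w where
      w: "strict_mono (r :: nat \<Rightarrow> nat)" "w \<in> leading_cone V" "proj_along i e w = proj_along i e v"
      "(\<lambda>j. (1 / T (r j)) *\<^sub>R x (r j)) \<longlonglongrightarrow> w" by blast
    have "w = v"
    proof (rule ccontr)
      assume "w \<noteq> v"
      \<comment> \<open>Equal projections make \<open>w\<close> and \<open>v\<close> differ by a
        multiple of \<open>e\<close>. Since the difference lies in the cone of the join, so would
        \<open>e\<close>.\<close>
      define \<mu> where "\<mu> = w $ i - v $ i"
      have wv: "w + (-1) *s v = \<mu> *s e"
        using proj_along_decomp[of i e w] proj_along_decomp[of i e v] w(3)
        by (simp add: \<mu>_def vec_eq_iff proj_along_def algebra_simps)
      then have "\<mu> \<noteq> 0" using \<open>w \<noteq> v\<close> by auto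
      have "w + (-1) *s v \<in> leading_cone X" by (rule join_subset_leading_cone[OF w(2)]) (rule Xmem)
      from leading_cone_smult[OF this, of "1 / \<mu>"] have "(1 / \<mu>) *s (\<mu> *s e) \<in> leading_cone X" unfolding wv .
      then have "e \<in> leading_cone X" using \<open>\<mu> \<noteq> 0\<close> by simp
      then show False using e by blast
    qed
    then have "\<forall>\<^sub>F j in sequentially. dist ((1 / T (r j)) *\<^sub>R x (r j)) v < \<epsilon>"
      using w(4) T(1) by (auto dest: tendstoD)
    then obtain j where "dist ((1 / T (r j)) *\<^sub>R x (r j)) v < \<epsilon>"
      using eventually_happens trivial_limit_sequentially by blast
    then show False using T(4)[OF x(1)[of "r j"], of "r j"] by simp
  qed
qed

section \<open>Estimates for univariate polynomials\<close>

text \<open>The quotient is locally bounded, so each root of \<open>a\<close> is a root of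
  \<open>r\<close>, and linear factors can be cancelled one by one.\<close>

lemma poly_dvd_of_bound:
  fixes a r :: "complex poly"
  assumes "a \<noteq> 0" "\<And>z. norm (poly r z) \<le> B z * norm (poly a z)" "continuous_on UNIV B"
  shows "a dvd r"
  using assms(1,2)
proof (induction "degree a" arbitrary: a r)
  case 0
  then obtain c where "a = [:c:]" "c \<noteq> 0" by (metis degree_eq_zeroE pCons_0_0)
  then show ?case by (metis const_poly_dvd_iff dvd_field_iff)
next
  case (Suc n)
  obtain \<rho> where \<rho>: "poly a \<rho> = 0"
    using fundamental_theorem_of_algebra[of a] Suc.hyps(2) by (auto simp: constant_degree)
  then obtain a' where a': "a = [:-\<rho>, 1:] * a'" by (auto simp: poly_eq_0_iff_dvd)
  have "poly r \<rho> = 0" using Suc.prems(2)[of \<rho>] \<rho> by simp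
  then obtain r' where r': "r = [:-\<rho>, 1:] * r'" by (auto simp: poly_eq_0_iff_dvd)
  have a'0: "a' \<noteq> 0" using a' Suc.prems(1) by auto
  have "degree a = Suc (degree a')" unfolding a' using a'0 by (subst degree_mult_eq) auto
  then have deg: "n = degree a'" using Suc.hyps(2) by simp
  have off: "norm (poly r' z) \<le> B z * norm (poly a' z)" if "z \<noteq> \<rho>" for z
  proof -
    have "norm (z - \<rho>) * norm (poly r' z) \<le> norm (z - \<rho>) * (B z * norm (poly a' z))"
      using Suc.prems(2)[of z] by (simp add: a' r' norm_mult[symmetric] algebra_simps)
    then show ?thesis using that by simp
  qed
  \<comment> \<open>At the cancelled root itself the estimate is recovered as a limit from nearby
    points.\<close>
  have "norm (poly r' z) \<le> B z * norm (poly a' z)" for z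
  proof (cases "z = \<rho>")
    case True
    have "isCont B \<rho>" using assms(3) by (simp add: continuous_on_eq_continuous_at)
    then have "((\<lambda>z. B z * norm (poly a' z)) \<longlongrightarrow> B \<rho> * norm (poly a' \<rho>)) (at \<rho>)"
      by (intro tendsto_intros) (auto simp: isCont_def poly_isCont[unfolded isCont_def])
    moreover have "((\<lambda>z. norm (poly r' z)) \<longlongrightarrow> norm (poly r' \<rho>)) (at \<rho>)"
      by (intro tendsto_norm) (use poly_isCont[unfolded isCont_def] in blast)
    moreover have "\<forall>\<^sub>F z in at \<rho>. norm (poly r' z) \<le> B z * norm (poly a' z)"
      using off by (auto simp: eventually_at_filter)
    ultimately show ?thesis unfolding True by (intro tendsto_le[OF at_neq_bot])
  qed (use off in blast)
  from Suc.hyps(1)[OF deg a'0 this] show ?case unfolding a' r' by (rule mult_dvd_mono[OF dvd_refl])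
qed

text \<open>Up to the leading coefficient, coefficients are elementary symmetric functions of the
  roots. Each linear factor at most doubles the estimate, whence the power of 2 in place of binomial
  coefficients.\<close>

lemma coeff_bound_of_roots:
  fixes p :: "complex poly"
  assumes "M \<ge> 0" "\<And>z. poly p z = 0 \<Longrightarrow> norm z \<le> M" "j \<le> degree p"
  shows "norm (coeff p j) \<le> 2 ^ degree p * M ^ (degree p - j) * norm (lead_coeff p)"
  using assms(2,3)
proof (induction "degree p" arbitrary: p j)
  case 0 then show ?case by simp
next
  case (Suc n)
  obtain \<rho> where \<rho>: "poly p \<rho> = 0"
    using fundamental_theorem_of_algebra[of p] Suc.hyps(2) by (auto simp: constant_degree)
  then obtain q where q: "p = [:-\<rho>, 1:] * q" by (auto simp: poly_eq_0_iff_dvd)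
  have q0: "q \<noteq> 0" using q Suc.hyps(2) by auto
  have "degree p = Suc (degree q)" unfolding q using q0 by (subst degree_mult_eq) auto
  then have deg: "n = degree q" using Suc.hyps(2) by simp
  have lead: "lead_coeff p = lead_coeff q" unfolding q lead_coeff_mult by simp
  have IH: "norm (coeff q j) \<le> 2 ^ n * M ^ (n - j) * norm (lead_coeff q)" if "j \<le> n" for j
    using Suc.hyps(1)[OF deg, of j] Suc.prems(1) that deg by (auto simp: q)
  have \<rho>M: "norm \<rho> \<le> M" using Suc.prems(1)[OF \<rho>] .
  have c: "coeff p j = (if j = 0 then 0 else coeff q (j - 1)) - \<rho> * coeff q j"
    unfolding q by (cases j) (simp_all add: coeff_pCons)
  have 1: "norm (if j = 0 then 0 else coeff q (j - 1)) \<le> 2 ^ n * M ^ (Suc n - j) * norm (lead_coeff q)"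
  proof (cases j)
    case j: (Suc k)
    then have "k \<le> n" using Suc.prems(2) Suc.hyps(2) by simp
    from IH[OF this] show ?thesis by (simp add: j)
  qed (use assms(1) in simp)
  have 2: "norm (\<rho> * coeff q j) \<le> 2 ^ n * M ^ (Suc n - j) * norm (lead_coeff q)"
  proof (cases "j \<le> n")
    case True
    have "norm (\<rho> * coeff q j) \<le> M * (2 ^ n * M ^ (n - j) * norm (lead_coeff q))"
      unfolding norm_mult by (intro mult_mono \<rho>M IH True) (use assms(1) in auto)
    also have "\<dots> = 2 ^ n * M ^ (Suc n - j) * norm (lead_coeff q)"
      using True by (simp add: Suc_diff_le mult_ac)
    finally show ?thesis .
  next
    case False
    then have "coeff q j = 0" using deg by (simp add: coeff_eq_0)
    then show ?thesis using assms(1) by simp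
  qed
  have "norm (coeff p j) \<le> 2 ^ n * M ^ (Suc n - j) * norm (lead_coeff q) +
      2 ^ n * M ^ (Suc n - j) * norm (lead_coeff q)"
    unfolding c by (rule order.trans[OF norm_triangle_ineq4 add_mono[OF 1 2]])
  then show ?case unfolding lead[symmetric] Suc.hyps(2)[symmetric] by (simp add: mult_ac)
qed

text \<open>The modulus of a monic polynomial at \<open>z0\<close> is the product of the distances
  from \<open>z0\<close> to its roots.\<close>

lemma root_near:
  fixes p :: "complex poly"
  assumes "lead_coeff p = 1" "\<eta> > 0" "norm (poly p z0) < \<eta> ^ degree p"
  obtains z where "poly p z = 0" "norm (z - z0) < \<eta>"
proof -
  have "norm (poly p z0) \<ge> \<eta> ^ degree p" if "lead_coeff p = 1" "\<And>z. poly p z = 0 \<Longrightarrow> norm (z - z0) \<ge> \<eta>"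
    for p :: "complex poly"
    using that
  proof (induction "degree p" arbitrary: p)
    case 0
    then obtain c where "p = [:c:]" by (metis degree_eq_zeroE)
    then show ?case using 0 by simp
  next
    case (Suc n)
    obtain \<rho> where \<rho>: "poly p \<rho> = 0"
      using fundamental_theorem_of_algebra[of p] Suc.hyps(2) by (auto simp: constant_degree)
    then obtain q where q: "p = [:-\<rho>, 1:] * q" by (auto simp: poly_eq_0_iff_dvd)
    have q0: "q \<noteq> 0" using q Suc.hyps(2) by auto
    have "degree p = Suc (degree q)" unfolding q using q0 by (subst degree_mult_eq) auto
    then have deg: "n = degree q" using Suc.hyps(2) by simp
    have lead: "lead_coeff q = 1" using Suc.prems(1) unfolding q lead_coeff_mult by simp
    have "\<eta> ^ n \<le> norm (poly q z0)"
      unfolding deg by (rule Suc.hyps(1)[OF deg lead]) (use Suc.prems(2) q in auto)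
    moreover have "\<eta> \<le> norm (z0 - \<rho>)" using Suc.prems(2)[OF \<rho>] by (simp add: norm_minus_commute)
    ultimately have "\<eta> * \<eta> ^ n \<le> norm (z0 - \<rho>) * norm (poly q z0)"
      using assms(2) by (intro mult_mono) auto
    also have "\<dots> = norm (poly p z0)" unfolding q by (simp add: norm_mult[symmetric] algebra_simps)
    finally show ?case unfolding Suc.hyps(2)[symmetric] by simp
  qed
  from this[OF assms(1)] assms(3) show ?thesis using that by (meson not_less)
qed

section \<open>Polynomials on coordinate subspaces\<close>

lemma poly_fun_continuous: "poly_fun f \<Longrightarrow> continuous_on UNIV f"
proof -
  assume "poly_fun f"
  then obtain k h where h: "homog_poly k h" "f = h 1" by (auto simp: poly_fun_def poly_fun_deg_def)
  show ?thesis unfolding continuous_on_def h(2)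
    by (intro ballI homog_poly_tendsto[OF h(1)] tendsto_intros)
qed

lemma coord_space_dense:
  assumes a: "poly_fun a" "b \<in> coord_space D" "a b \<noteq> 0" and y: "y \<in> coord_space D" and "\<delta> > 0"
  obtains u where "u \<in> coord_space D" "dist u y < \<delta>" "a u \<noteq> 0"
proof -
  obtain p where p: "\<And>z. poly p z = a (y + z *s (b - y))"
    by (rule poly_fun_line_poly[OF a(1), where v = "b - y" and y = y]) blast
  have "poly p 1 \<noteq> 0" using p[of 1] a(3) by simp
  then have "p \<noteq> 0" by auto
  then have "finite {z. poly p z = 0}" by (rule poly_roots_finite)
  then have 1: "\<forall>\<^sub>F z in at 0. poly p z \<noteq> 0"
    using islimpt_finite[of _ 0] by (force simp: islimpt_iff_eventually)
  have "((\<lambda>z. y + z *s (b - y)) \<longlongrightarrow> y + 0 *s (b - y)) (at 0)"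
    by (intro tendsto_intros tendsto_vec_smult)
  then have "\<forall>\<^sub>F z in at 0. dist (y + z *s (b - y)) y < \<delta>"
    using assms(5) by (auto dest: tendstoD)
  with 1 have "\<forall>\<^sub>F z in at 0. poly p z \<noteq> 0 \<and> dist (y + z *s (b - y)) y < \<delta>"
    by (rule eventually_conj)
  then obtain z where "poly p z \<noteq> 0" "dist (y + z *s (b - y)) y < \<delta>"
    using eventually_happens'[OF at_neq_bot] by blast
  then show ?thesis using p a(2) y by (intro that[of "y + z *s (b - y)"]) (auto intro: coord_space_add coord_space_smult coord_space_diff)
qed

text \<open>Points with \<open>a\<close> nonzero are dense in the subspace, so the inequality
  extends by continuity.\<close>

lemma coord_space_closure_le:
  fixes \<phi> :: "complex ^ 'n::finite \<Rightarrow> real"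
  assumes a: "poly_fun a" "b \<in> coord_space D" "a b \<noteq> 0" and \<phi>: "continuous_on UNIV \<phi>"
    "\<And>y. y \<in> coord_space D \<Longrightarrow> a y \<noteq> 0 \<Longrightarrow> \<phi> y \<le> 0" and y: "y \<in> coord_space D"
  shows "\<phi> y \<le> 0"
proof (rule ccontr)
  assume "\<not> ?thesis"
  then have pos: "\<phi> y > 0" by simp
  have "isCont \<phi> y" using \<phi>(1) by (simp add: continuous_on_eq_continuous_at)
  then obtain \<delta> where \<delta>: "\<delta> > 0" "\<And>u. dist u y < \<delta> \<Longrightarrow> dist (\<phi> u) (\<phi> y) < \<phi> y"
    using pos unfolding continuous_at_eps_delta by metis
  obtain u where u: "u \<in> coord_space D" "dist u y < \<delta>" "a u \<noteq> 0" using coord_space_dense[OF a y \<delta>(1)] by blast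
  from \<delta>(2)[OF u(2)] \<phi>(2)[OF u(1,3)] pos show False by (simp add: dist_real_def)
qed

text \<open>Along a direction in which \<open>a\<close> is monic up to a constant, the remainder of
  \<open>p\<close> is still bounded by a continuous multiple of \<open>a\<close> on each line. It is
  therefore divisible by \<open>a\<close> there, yet of smaller degree, hence zero.\<close>

lemma poly_fun_divides_of_bound:
  fixes B :: "complex ^ 'n::finite \<Rightarrow> real"
  assumes a: "poly_fun a" "b \<in> coord_space D" "a b \<noteq> 0" and p: "poly_fun p"
    and bound: "\<And>y. y \<in> coord_space D \<Longrightarrow> norm (p y) \<le> B y * norm (a y)" and B: "continuous_on UNIV B"
  obtains q where "poly_fun q" "\<And>y. y \<in> coord_space D \<Longrightarrow> p y = q y * a y"
proof -
  obtain k0 h where h: "homog_poly k0 h" "a = h 1" using a(1) by (auto simp: poly_fun_def poly_fun_deg_def)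
  \<comment> \<open>The leading form of \<open>a\<close> may vanish on the subspace, so
    \<open>a\<close> is replaced by a polynomial that equals it there and has a usable
    direction.\<close>
  obtain k g e0 where g: "homog_poly k g" "\<And>x. x \<in> coord_space D \<Longrightarrow> g 1 x = a x" "e0 \<in> coord_space D" "g 0 e0 \<noteq> 0"
    using coord_space_leading_form[OF h(1) a(2)] a(3) h(2) by metis
  show ?thesis
  proof (cases "k = 0")
    case True
    then have c: "a y = g 0 e0" if "y \<in> coord_space D" for y
      using g(2)[OF that] g(1) homog_poly_0_const[of g] by metis
    have "poly_fun (\<lambda>y. p y * (1 / g 0 e0))" by (intro poly_fun_mult p poly_fun_const)
    then show ?thesis by (rule that) (simp add: c g(4))
  next
    case False
    then have "e0 \<noteq> 0" using homog_poly_at_origin[OF g(1)] g(4) by auto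
    then obtain i where i: "e0 $ i \<noteq> 0" by (auto simp: vec_eq_iff)
    define e where "e = (1 / e0 $ i) *s e0"
    have e: "e $ i = 1" "e \<in> coord_space D" "g 0 e \<noteq> 0"
      using i g(3,4) homog_poly_at0_scale[OF g(1)] by (auto simp: e_def intro: coord_space_smult)
    obtain l where l: "poly_fun_deg l p" using p by (auto simp: poly_fun_def)
    obtain Q r where Q: "poly_fun Q" "\<And>j. j < k \<Longrightarrow> poly_fun_deg l (r j)"
      "\<And>x. p x = Q x * g 1 x + (\<Sum>j<k. r j (proj_along i e x) * (x $ i) ^ j)"
      by (rule poly_fun_deg_division[OF g(1) e(3) l e(1)]) blast
    have "p y0 = Q y0 * a y0" if y0: "y0 \<in> coord_space D" for y0
    proof -
      define y where "y = proj_along i e y0"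
      have yi: "y $ i = 0" unfolding y_def by (rule proj_along_nth[OF e(1)])
      have yD: "y + z *s e \<in> coord_space D" for z
        unfolding y_def proj_along_def using y0 e(2) by (intro coord_space_add coord_space_diff coord_space_smult)
      obtain A where A: "degree A \<le> k" "coeff A k = g 0 e" "\<And>z. poly A z = g 1 (y + z *s e)"
        by (rule homog_poly_line_poly[OF g(1), where v = e and y = y]) blast
      have degA: "degree A = k" using A e(3) by (metis le_degree order_antisym)
      define R where "R = (\<Sum>j<k. monom (r j y) j)"
      have R: "poly R z = p (y + z *s e) - Q (y + z *s e) * g 1 (y + z *s e)" for z
        using Q(3)[of "y + z *s e"] e(1) yi by (simp add: R_def poly_sum poly_monom proj_along_add)
      have lc: "continuous_on UNIV (\<lambda>z. y + z *s e)"
        by (simp add: continuous_on_def tendsto_intros tendsto_vec_smult)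
      have "A dvd R"
      proof (rule poly_dvd_of_bound)
        show "A \<noteq> 0" using degA False by auto
        fix z
        have "norm (poly R z) \<le> norm (p (y + z *s e)) + norm (Q (y + z *s e)) * norm (poly A z)"
          unfolding R A(3) norm_mult[symmetric] by (rule norm_triangle_ineq4)
        also have "norm (p (y + z *s e)) \<le> B (y + z *s e) * norm (poly A z)"
          using bound[OF yD] g(2)[OF yD] by (simp add: A(3))
        finally show "norm (poly R z) \<le> (B (y + z *s e) + norm (Q (y + z *s e))) * norm (poly A z)"
          by (simp add: algebra_simps)
      next
        show "continuous_on UNIV (\<lambda>z. B (y + z *s e) + norm (Q (y + z *s e)))"
          by (intro continuous_on_add continuous_on_norm continuous_on_compose2[OF B lc]
              continuous_on_compose2[OF poly_fun_continuous[OF Q(1)] lc]) auto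
      qed
      moreover have "degree R < degree A"
      proof -
        have "degree R \<le> k - 1" unfolding R_def
          by (intro degree_sum_le) (auto intro: order.trans[OF degree_monom_le])
        then show ?thesis using False degA by simp
      qed
      ultimately have "R = 0" using dvd_imp_degree_le by fastforce
      then have "p (y + z *s e) = Q (y + z *s e) * a (y + z *s e)" for z
        using R[of z] g(2)[OF yD] by simp
      from this[of "y0 $ i"] show ?thesis by (simp add: y_def proj_along_decomp)
    qed
    with Q(1) show ?thesis using that by blast
  qed
qed

text \<open>While the degree bound exceeds \<open>N\<close>, evaluating at growing multiples of
  \<open>y\<close> shows that the leading form vanishes on the subspace, and a factor
  \<open>s\<close> can be split off.\<close>

lemma degree_of_growth:
  assumes "homog_poly k h" "\<And>y. y \<in> coord_space D \<Longrightarrow> norm (h 1 y) \<le> K * (1 + norm y) ^ N"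
  shows "\<exists>g. homog_poly N g \<and> (\<forall>y\<in>coord_space D. g 1 y = h 1 y)"
  using assms
proof (induction k arbitrary: h)
  case 0
  then show ?case by (intro exI[of _ "\<lambda>s x. s ^ (N - 0) * h s x"] conjI homog_poly_raise) auto
next
  case (Suc k)
  show ?case
  proof (cases "Suc k \<le> N")
    case True
    then show ?thesis using Suc.prems(1)
      by (intro exI[of _ "\<lambda>s x. s ^ (N - Suc k) * h s x"] conjI homog_poly_raise) auto
  next
    case False
    have h0: "h 0 y = 0" if y: "y \<in> coord_space D" for y
    proof -
      let ?t = "\<lambda>j. complex_of_real (1 / Suc j)"
      have "(\<lambda>j. ?t j) \<longlonglongrightarrow> 0"
        by (subst of_real_0[symmetric]) (rule tendsto_of_real, rule LIMSEQ_Suc[OF lim_1_over_n])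
      then have 1: "(\<lambda>j. h (?t j) y) \<longlonglongrightarrow> h 0 y" by (rule homog_poly_tendsto[OF Suc.prems(1) _ tendsto_const])
      have bd: "norm (h (?t j) y) \<le> (K * (1 + norm y) ^ N) * (1 / Suc j)" for j
      proof -
        let ?n = "real (Suc j)"
        have n: "?n \<ge> 1" by simp
        have K: "K \<ge> 0"
          using order.trans[OF norm_ge_zero Suc.prems(2)[OF zero_in_coord_space]] by simp
        have st: "(1 / ?n) ^ Suc k * ?n ^ N \<le> 1 / ?n"
        proof -
          have "?n ^ N \<le> ?n ^ k" using False n by (intro power_increasing) auto
          then have "(1 / ?n) ^ Suc k * ?n ^ N \<le> (1 / ?n) ^ Suc k * ?n ^ k"
            by (intro mult_left_mono) auto
          also have "\<dots> = 1 / ?n" by (simp add: power_divide)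
          finally show ?thesis .
        qed
        have "h (?t j) y = ?t j ^ Suc k * h 1 (of_real ?n *s y)"
          using homog_poly_scale[OF Suc.prems(1), of "?t j" 1 "of_real ?n *s y"] by (simp del: of_nat_Suc)
        then have "norm (h (?t j) y) = (1 / ?n) ^ Suc k * norm (h 1 (of_real ?n *s y))"
          by (simp add: norm_mult norm_power norm_divide del: of_nat_Suc)
        also have "\<dots> \<le> (1 / ?n) ^ Suc k * (K * (1 + norm (complex_of_real ?n *s y)) ^ N)"
          by (intro mult_left_mono Suc.prems(2) coord_space_smult y) auto
        also have "\<dots> \<le> (1 / ?n) ^ Suc k * (K * (?n * (1 + norm y)) ^ N)"
        proof -
          have "1 + norm (complex_of_real ?n *s y) \<le> ?n * (1 + norm y)"
            using n unfolding norm_vec_smult by (simp add: algebra_simps del: of_nat_Suc)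
          then show ?thesis using K by (intro mult_left_mono power_mono) auto
        qed
        also have "\<dots> = (K * (1 + norm y) ^ N) * ((1 / ?n) ^ Suc k * ?n ^ N)"
          by (simp only: power_mult_distrib mult_ac)
        also have "\<dots> \<le> (K * (1 + norm y) ^ N) * (1 / ?n)"
          using K by (intro mult_left_mono st) auto
        finally show ?thesis .
      qed
      have "(\<lambda>j. (K * (1 + norm y) ^ N) * (1 / Suc j)) \<longlonglongrightarrow> (K * (1 + norm y) ^ N) * 0"
        by (intro tendsto_mult tendsto_const LIMSEQ_Suc[OF lim_1_over_n])
      then have lim0: "(\<lambda>j. (K * (1 + norm y) ^ N) * (1 / Suc j)) \<longlonglongrightarrow> 0" by (simp only: mult_zero_right)
      have "(\<lambda>j. h (?t j) y) \<longlonglongrightarrow> 0"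
        by (rule Lim_null_comparison[OF _ lim0]) (use bd in \<open>intro always_eventually allI\<close>)
      then show ?thesis using 1 LIMSEQ_unique by blast
    qed
    obtain g where g: "homog_poly k g" "\<And>s x. h s x = s * g s x + h 0 x"
      by (rule homog_poly_split_s[OF Suc.prems(1)]) blast
    have eq: "g 1 y = h 1 y" if "y \<in> coord_space D" for y using g(2)[of 1 y] h0[OF that] by simp
    from Suc.IH[OF g(1)] Suc.prems(2) eq show ?thesis by metis
  qed
qed

text \<open>The zero set projects finitely into a subspace with one coordinate less. A zero can
  exist only if \<open>D\<close> is nonempty, so the subtraction is not truncated.\<close>

lemma growth_zero_set_coord_space:
  fixes a :: "complex ^ 'n::finite \<Rightarrow> complex"
  assumes "poly_fun a" "b \<in> coord_space D" "a b \<noteq> 0" "\<exists>y\<in>coord_space D. a y = 0"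
  shows "card D \<ge> 1 \<and> growth {y \<in> coord_space D. a y = 0} (card D - 1)"
proof -
  let ?Y = "{y \<in> coord_space D. a y = 0}"
  obtain e0 where e0: "e0 \<in> coord_space D" "e0 \<notin> leading_cone ?Y"
    by (rule direction_off_leading_cone[OF assms(1) _ _ assms(2,3), where X = ?Y]) auto
  have "?Y \<noteq> {}" using assms(4) by auto
  with e0 obtain i e where e: "i \<in> D" "e $ i = 1" "e \<in> coord_space D" "e \<notin> leading_cone ?Y"
    by (rule normalize_direction) blast
  obtain m f where f: "homog_poly m f" "\<And>x. x \<in> ?Y \<Longrightarrow> f 1 x = 0" "f 0 e \<noteq> 0"
    using e(4) by (rule not_leading_coneE) blast
  have "proj_along i e ` ?Y \<subseteq> coord_space (D - {i})" using e by (auto intro: proj_along_coord_space)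
  then have g: "growth (proj_along i e ` ?Y) (card (D - {i}))" using growth_mono[OF growth_coord_space] by blast
  have "growth ?Y (card (D - {i}))" by (rule growth_proj_along[OF f e(2) g])
  moreover have "card (D - {i}) = card D - 1" using e(1) by (rule card_Diff_singleton)
  moreover have "card D \<ge> 1" using e(1) by (metis One_nat_def Suc_leI card_gt_0_iff empty_iff finite)
  ultimately show ?thesis by simp
qed

section \<open>The cone is attained by points of the variety\<close>

text \<open>\<open>F\<close> has least possible degree along \<open>e\<close>, so pseudo-division by \<open>F\<close> of any polynomial vanishing on
  \<open>V\<close> leaves remainder zero.\<close>

lemma minimal_relation:
  fixes V :: "(complex ^ 'n::finite) set"
  assumes V: "algebraic_set V" "V \<subseteq> coord_space D" and e: "e $ i = 1" "e \<in> coord_space D"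
    and f: "poly_fun f" "\<And>x. x \<in> V \<Longrightarrow> f x = 0" "p \<in> coord_space D" "f p \<noteq> 0"
  obtains F c r b where "\<And>x. x \<in> V \<Longrightarrow> F x = 0" "\<And>j. poly_fun (c j)"
    "\<And>y z. y \<in> coord_space (D - {i}) \<Longrightarrow> F (y + z *s e) = (\<Sum>j\<le>r. c j y * z ^ j)"
    "b \<in> coord_space (D - {i})" "c r b \<noteq> 0"
    "\<And>y z. y \<in> coord_space (D - {i}) \<Longrightarrow> c r y \<noteq> 0 \<Longrightarrow> F (y + z *s e) = 0 \<Longrightarrow> y + z *s e \<in> V"
proof -
  let ?D = "D - {i}"
  \<comment> \<open>The index \<open>s\<close> is a strict bound on the degree along
    \<open>e\<close>, so that \<open>s = 0\<close> means vanishing on the subspace and induction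
    starts there.\<close>
  define form where "form s G c \<longleftrightarrow> (\<forall>x\<in>V. G x = 0) \<and> (\<forall>j. poly_fun (c j)) \<and>
    (\<forall>y\<in>coord_space ?D. \<forall>z. G (y + z *s e) = (\<Sum>j<s. c j y * z ^ j))" for s :: nat and G c
  define Z where "Z r \<longleftrightarrow> (\<exists>F c. form (Suc r) F c \<and> (\<exists>b\<in>coord_space ?D. c r b \<noteq> 0))" for r
  have vanish: "\<forall>y\<in>coord_space ?D. \<forall>z. G (y + z *s e) = 0" if "\<And>r. r < s \<Longrightarrow> \<not> Z r" "form s G c" for s G c
    using that
  proof (induction s)
    case 0 then show ?case by (simp add: form_def)
  next
    case (Suc s)
    have c0: "c s y = 0" if "y \<in> coord_space ?D" for y
      using Suc.prems(1)[of s] Suc.prems(2) that unfolding Z_def by auto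
    have "form s G c" unfolding form_def
    proof (intro conjI ballI allI)
      show "G x = 0" if "x \<in> V" for x using Suc.prems(2) that by (simp add: form_def)
      show "poly_fun (c j)" for j using Suc.prems(2) by (simp add: form_def)
      fix y z assume y: "y \<in> coord_space ?D"
      then have "G (y + z *s e) = (\<Sum>j<Suc s. c j y * z ^ j)" using Suc.prems(2) by (simp only: form_def)
      then show "G (y + z *s e) = (\<Sum>j<s. c j y * z ^ j)" using c0[OF y] by simp
    qed
    then show ?case using Suc.IH Suc.prems(1) by simp
  qed
  have ex_form: "\<exists>s c. form s G c" if G: "poly_fun G" "\<forall>x\<in>V. G x = 0" for G
  proof -
    obtain k where k: "poly_fun_deg k G" using G(1) by (auto simp: poly_fun_def)
    obtain c where c: "\<And>j. j \<le> k \<Longrightarrow> poly_fun_deg (k - j) (c j)"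
      "\<And>y z. G (y + z *s e) = (\<Sum>j\<le>k. c j y * z ^ j)" by (rule poly_fun_deg_line[OF k, where v = e]) blast
    have "form (Suc k) G (\<lambda>j. if j \<le> k then c j else (\<lambda>y. 0))"
      using G(2) c by (auto simp: form_def lessThan_Suc_atMost intro: pfunI poly_fun_const)
    then show ?thesis by blast
  qed
  have Dmem: "proj_along i e x \<in> coord_space ?D" if "x \<in> coord_space D" for x using proj_along_coord_space[OF e that] .
  have "\<exists>r. Z r"
  proof (rule ccontr)
    assume no: "\<nexists>r. Z r"
    obtain s c where "form s f c" using ex_form f(1,2) by blast
    then have "f (proj_along i e p + (p $ i) *s e) = 0" using vanish no Dmem[OF f(3)] by blast
    then show False using f(4) by (simp add: proj_along_decomp)
  qed
  then obtain r where r: "Z r" "\<And>q. q < r \<Longrightarrow> \<not> Z q" using exists_least_iff[of Z] by blast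
  obtain F c b where F: "form (Suc r) F c" "b \<in> coord_space ?D" "c r b \<noteq> 0" using r(1) unfolding Z_def by blast
  have Fz: "F (y + z *s e) = (\<Sum>j\<le>r. c j y * z ^ j)" if "y \<in> coord_space ?D" for y z
    using F(1) that by (simp add: form_def lessThan_Suc_atMost)
  \<comment> \<open>At a point where \<open>F\<close> vanishes but its leading coefficient does not,
    \<open>G\<close> vanishes as soon as its pseudo-remainder does.\<close>
  have cut: "G (y + z *s e) = 0" if "form s G d" "y \<in> coord_space ?D" "c r y \<noteq> 0" "F (y + z *s e) = 0" for s G d y z
    using that
  proof (induction s arbitrary: G d)
    case 0 then show ?case by (simp add: form_def)
  next
    case (Suc s)
    show ?case
    proof (cases "Suc s \<le> r")
      case True
      then have "\<And>q. q < Suc s \<Longrightarrow> \<not> Z q" using r(2) by auto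
      from vanish[OF this Suc.prems(1)] Suc.prems(2) show ?thesis by blast
    next
      case False
      then obtain n where s: "s = n + r" by (metis not_less_eq_eq le_Suc_ex add.commute)
      \<comment> \<open>Multiplying \<open>G\<close> by the leading coefficient of \<open>F\<close>
        lets the top terms cancel without division.\<close>
      let ?G = "\<lambda>x. c r (proj_along i e x) * G x - d s (proj_along i e x) * (x $ i) ^ n * F x"
      let ?d = "\<lambda>j y. c r y * d j y - (if n \<le> j then d s y * c (j - n) y else 0)"
      have dc: "poly_fun (d j)" "poly_fun (c j)" for j using Suc.prems(1) F(1) by (auto simp: form_def)
      have "form s ?G ?d" unfolding form_def
      proof (intro conjI ballI allI)
        show "?G x = 0" if "x \<in> V" for x using Suc.prems(1) F(1) that by (simp add: form_def)
        show "poly_fun (?d j)" for j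
          by (intro poly_fun_diff poly_fun_mult dc) (cases "n \<le> j"; simp add: poly_fun_const poly_fun_mult dc)
        fix y z assume y: "y \<in> coord_space ?D"
        have yi: "y $ i = 0" using y by (rule coord_space_Diff_nth)
        have Gz: "G (y + z *s e) = (\<Sum>j<s. d j y * z ^ j) + d s y * z ^ s"
          using Suc.prems(1) y by (simp add: form_def)
        have Fz': "F (y + z *s e) = (\<Sum>j<r. c j y * z ^ j) + c r y * z ^ r"
          using Fz[OF y] by (simp add: lessThan_Suc_atMost[symmetric])
        have "(\<Sum>j<s. ?d j y * z ^ j) = c r y * (\<Sum>j<s. d j y * z ^ j) -
            (\<Sum>j<n + r. (if n \<le> j then d s y * c (j - n) y else 0) * z ^ j)"
          by (simp add: sum_subtractf left_diff_distrib s sum_distrib_left mult.assoc)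
        also have "\<dots> = c r y * (\<Sum>j<s. d j y * z ^ j) - d s y * z ^ n * (\<Sum>l<r. c l y * z ^ l)"
          by (subst sum_shift_if) (simp add: sum_distrib_left power_add mult_ac)
        also have "\<dots> = c r y * G (y + z *s e) - d s y * z ^ n * F (y + z *s e)"
          unfolding Gz Fz' s power_add by (simp add: algebra_simps)
        finally show "?G (y + z *s e) = (\<Sum>j<s. ?d j y * z ^ j)"
          using e(1) yi by (simp add: proj_along_add)
      qed
      from Suc.IH[OF this Suc.prems(2-4)] have "c r y * G (y + z *s e) = 0"
        using Suc.prems(2,4) e(1) by (simp add: proj_along_add coord_space_Diff_nth)
      then show ?thesis using Suc.prems(3) by simp
    qed
  qed
  have "y + z *s e \<in> V" if y: "y \<in> coord_space ?D" "c r y \<noteq> 0" "F (y + z *s e) = 0" for y z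
  proof (rule ccontr)
    assume "y + z *s e \<notin> V"
    then obtain G where G: "poly_fun G" "\<And>x. x \<in> V \<Longrightarrow> G x = 0" "G (y + z *s e) \<noteq> 0"
      using algebraic_setE[OF V(1)] by blast
    then obtain s d where "form s G d" using ex_form by blast
    from cut[OF this y] G(3) show False by blast
  qed
  moreover have "poly_fun (c j)" "\<And>x. x \<in> V \<Longrightarrow> F x = 0" for j using F(1) by (auto simp: form_def)
  ultimately show ?thesis using that[of F c r b] Fz F(2,3) by blast
qed

text \<open>Since the roots of the minimal relation are bounded by those of a monic one, its
  coefficients are divisible by the leading one.\<close>

lemma monic_relation:
  fixes V :: "(complex ^ 'n::finite) set"
  assumes V: "algebraic_set V" "V \<subseteq> coord_space D" and e: "e $ i = 1" "e \<in> coord_space D" "e \<notin> leading_cone V"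
    and f: "poly_fun f" "\<And>x. x \<in> V \<Longrightarrow> f x = 0" "p \<in> coord_space D" "f p \<noteq> 0"
  obtains a b r F where "poly_fun a" "b \<in> coord_space (D - {i})" "a b \<noteq> 0" "homog_poly r F" "F 0 e = 1"
    "\<And>x. x \<in> V \<Longrightarrow> a (proj_along i e x) \<noteq> 0 \<Longrightarrow> F 1 x = 0"
    "\<And>y z. y \<in> coord_space (D - {i}) \<Longrightarrow> a y \<noteq> 0 \<Longrightarrow> F 1 (y + z *s e) = 0 \<Longrightarrow> y + z *s e \<in> V"
proof -
  let ?D = "D - {i}"
  obtain G c r b where G: "\<And>x. x \<in> V \<Longrightarrow> G x = 0" and c: "\<And>j. poly_fun (c j)"
    and Gz: "\<And>y z. y \<in> coord_space ?D \<Longrightarrow> G (y + z *s e) = (\<Sum>j\<le>r. c j y * z ^ j)"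
    and b: "b \<in> coord_space ?D" "c r b \<noteq> 0"
    and cut: "\<And>y z. y \<in> coord_space ?D \<Longrightarrow> c r y \<noteq> 0 \<Longrightarrow> G (y + z *s e) = 0 \<Longrightarrow> y + z *s e \<in> V"
    by (rule minimal_relation[OF V e(1,2) f]) blast+
  obtain m h where h: "homog_poly m h" "\<And>x. x \<in> V \<Longrightarrow> h 1 x = 0" "h 0 e \<noteq> 0"
    using e(3) by (rule not_leading_coneE) blast
  obtain K where K: "K > 0" "\<And>y z. y + z *s e \<in> V \<Longrightarrow> norm z \<le> K * (1 + norm y)"
    by (rule proj_along_coordinate_bound[OF h]) blast+
  \<comment> \<open>Where \<open>c r\<close> is nonzero, all roots over \<open>y\<close> give points
    of \<open>V\<close> and so have norm at most \<open>K * (1 + norm y)\<close>; this is the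
    resulting bound for the \<open>j\<close>-th coefficient relative to the leading one.\<close>
  define B where "B j y = 2 ^ r * (K * (1 + norm y)) ^ (r - j)" for j and y :: "complex ^ 'n"
  have Bcont: "continuous_on UNIV (B j)" for j unfolding B_def by (intro continuous_intros)
  have bound: "norm (c j y) \<le> B j y * norm (c r y)" if j: "j \<le> r" and y: "y \<in> coord_space ?D" for j y
  proof -
    have "norm (c j y) - B j y * norm (c r y) \<le> 0"
    proof (rule coord_space_closure_le[OF c b _ _ y])
      show "continuous_on UNIV (\<lambda>y. norm (c j y) - B j y * norm (c r y))"
        by (intro continuous_intros Bcont poly_fun_continuous c)
      fix y assume y: "y \<in> coord_space ?D" "c r y \<noteq> 0"
      define P where "P = (\<Sum>j\<le>r. monom (c j y) j)"
      have coeffP: "coeff P j = (if j \<le> r then c j y else 0)" for j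
        by (simp add: P_def coeff_sum)
      have "degree P \<le> r" by (rule degree_le) (simp add: coeffP)
      then have degP: "degree P = r" using y(2) coeffP[of r] by (metis le_degree order_antisym order_refl)
      have "norm (coeff P j) \<le> 2 ^ degree P * (K * (1 + norm y)) ^ (degree P - j) * norm (lead_coeff P)"
      proof (rule coeff_bound_of_roots)
        show "0 \<le> K * (1 + norm y)" using K(1) by simp
        show "j \<le> degree P" using j degP by simp
        fix z assume "poly P z = 0"
        then have "G (y + z *s e) = 0" using Gz[OF y(1)] by (simp add: P_def poly_sum poly_monom)
        then show "norm z \<le> K * (1 + norm y)" using cut[OF y] K(2) by blast
      qed
      then show "norm (c j y) - B j y * norm (c r y) \<le> 0"
        using j by (simp add: degP coeffP B_def)
    qed
    then show ?thesis by simp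
  qed
  \<comment> \<open>The quotient by \<open>c r\<close> grows with order at most
    \<open>r - j\<close>, so its degree is at most \<open>r - j\<close> on the subspace. This is
    what makes the sum defining \<open>F\<close> homogeneous of degree \<open>r\<close>.\<close>
  have "\<exists>g. homog_poly (r - j) g \<and> (\<forall>y\<in>coord_space ?D. c j y = g 1 y * c r y)" if j: "j < r" for j
  proof -
    obtain q where q: "poly_fun q" "\<And>y. y \<in> coord_space ?D \<Longrightarrow> c j y = q y * c r y"
      using poly_fun_divides_of_bound[OF c b c bound Bcont, of j] j by (metis less_imp_le)
    have qB: "norm (q y) \<le> (2 ^ r * K ^ (r - j)) * (1 + norm y) ^ (r - j)" if y: "y \<in> coord_space ?D" for y
    proof -
      have "norm (q y) - B j y \<le> 0"
      proof (rule coord_space_closure_le[OF c b _ _ y])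
        show "continuous_on UNIV (\<lambda>y. norm (q y) - B j y)"
          by (intro continuous_intros Bcont poly_fun_continuous q)
        fix y assume y: "y \<in> coord_space ?D" "c r y \<noteq> 0"
        have "norm (q y) * norm (c r y) \<le> B j y * norm (c r y)"
          using bound[OF less_imp_le[OF j] y(1)] q(2)[OF y(1)] by (simp add: norm_mult)
        then show "norm (q y) - B j y \<le> 0" using y(2) by simp
      qed
      then show ?thesis by (simp add: B_def power_mult_distrib mult_ac)
    qed
    obtain k h where kh: "homog_poly k h" "q = h 1" using q(1) by (auto simp: poly_fun_def poly_fun_deg_def)
    from degree_of_growth[OF kh(1), of ?D] qB kh(2) obtain g where
      "homog_poly (r - j) g" "\<forall>y\<in>coord_space ?D. g 1 y = h 1 y" by blast
    then show ?thesis using q(2) kh(2) by auto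
  qed
  then obtain g where g: "\<And>j. j < r \<Longrightarrow> homog_poly (r - j) (g j)"
    "\<And>j y. j < r \<Longrightarrow> y \<in> coord_space ?D \<Longrightarrow> c j y = g j 1 y * c r y" by metis
  \<comment> \<open>Over the subspace, \<open>F 1\<close> is \<open>G\<close> divided by its leading
    coefficient, which divisibility has turned into a polynomial.\<close>
  define F where "F s x = (x $ i) ^ r + (\<Sum>j<r. g j s (proj_along i e x) * (x $ i) ^ j)" for s and x :: "complex ^ 'n"
  have hpF: "homog_poly r F" unfolding F_def
    by (intro homog_poly_add homog_poly_varpow homog_poly_sum homog_poly_mult_eq[OF homog_poly_proj_along[OF g(1)] homog_poly_varpow]) auto
  have "proj_along i e e = 0" using e(1) by (simp add: proj_along_def)
  then have F1: "F 0 e = 1" using e(1) homog_poly_at_origin[OF g(1)] by (simp add: F_def)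
  have GF: "G (y + z *s e) = c r y * F 1 (y + z *s e)" if y: "y \<in> coord_space ?D" for y z
  proof -
    have "G (y + z *s e) = (\<Sum>j<r. g j 1 y * c r y * z ^ j) + c r y * z ^ r"
      using Gz[OF y] g(2)[OF _ y] by (simp add: lessThan_Suc_atMost[symmetric])
    also have "\<dots> = c r y * F 1 (y + z *s e)"
      using e(1) coord_space_Diff_nth[OF y] by (simp add: F_def proj_along_add sum_distrib_left algebra_simps)
    finally show ?thesis .
  qed
  show ?thesis
  proof (rule that[OF c b hpF F1])
    fix x assume x: "x \<in> V" "c r (proj_along i e x) \<noteq> 0"
    have "proj_along i e x \<in> coord_space ?D" using proj_along_coord_space[OF e(1,2)] V(2) x(1) by blast
    from GF[OF this, of "x $ i"] show "F 1 x = 0" using x G by (simp add: proj_along_decomp)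
  next
    fix y z assume y: "y \<in> coord_space ?D" "c r y \<noteq> 0" "F 1 (y + z *s e) = 0"
    show "y + z *s e \<in> V" using cut[OF y(1,2)] GF[OF y(1)] y(3) by simp
  qed
qed

section \<open>Codimension one and the general case\<close>

text \<open>For large \<open>t\<close> the rescaled equation is small near \<open>v\<close>, and as
  it is monic along \<open>e\<close> it has a root nearby. Over a base point where \<open>a\<close>
  is nonzero this root belongs to \<open>V\<close>.\<close>

lemma root_of_leading_form_in_inner_cone:
  fixes V :: "(complex ^ 'n::finite) set"
  assumes e: "e $ i = 1" "e \<in> coord_space D" and a: "poly_fun a" "b \<in> coord_space (D - {i})" "a b \<noteq> 0"
    and F: "homog_poly r F" "F 0 e = 1" "F 0 v = 0" and v: "v \<in> coord_space D"
    and cut: "\<And>y z. y \<in> coord_space (D - {i}) \<Longrightarrow> a y \<noteq> 0 \<Longrightarrow> F 1 (y + z *s e) = 0 \<Longrightarrow> y + z *s e \<in> V"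
  shows "v \<in> inner_cone V"
  unfolding inner_cone_def
proof (intro CollectI allI impI)
  fix \<epsilon> :: real assume \<epsilon>: "\<epsilon> > 0"
  let ?D = "D - {i}"
  define y0 where "y0 = proj_along i e v"
  have y0: "y0 \<in> coord_space ?D" unfolding y0_def by (rule proj_along_coord_space[OF e v])
  have v_eq: "v = y0 + (v $ i) *s e" by (simp add: y0_def proj_along_decomp)
  \<comment> \<open>Chosen so that a shift by \<open>\<eta>\<close> along \<open>e\<close> costs at
    most half of \<open>\<epsilon>\<close>.\<close>
  define \<eta> where "\<eta> = \<epsilon> / (2 * (1 + norm e))"
  have \<eta>: "\<eta> > 0" using \<epsilon> by (simp add: \<eta>_def add_pos_nonneg)
  have \<eta>e: "\<eta> * norm e \<le> \<epsilon> / 2"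
  proof -
    have "\<eta> * norm e \<le> \<eta> * (1 + norm e)" using \<eta> by (intro mult_left_mono) auto
    also have "\<dots> = \<epsilon> / 2" by (simp add: \<eta>_def field_simps add_nonneg_eq_0_iff)
    finally show ?thesis .
  qed
  have "isCont (\<lambda>p. F (fst p) (snd p)) (0, v)"
    using homog_poly_continuous[OF F(1)] by (simp add: continuous_on_eq_continuous_at)
  then obtain \<delta> where \<delta>: "\<delta> > 0" "\<And>p. dist p (0, v) < \<delta> \<Longrightarrow> norm (F (fst p) (snd p)) < \<eta> ^ r"
    unfolding continuous_at_eps_delta using F(3) zero_less_power[OF \<eta>, of r] by fastforce
  \<comment> \<open>The first bound leaves room for \<open>1 / t\<close> in the continuity estimate
    for \<open>F\<close>, the second limits the displacement of the base point.\<close>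
  define \<delta>' where "\<delta>' = min (\<delta> / 2) (\<epsilon> / 2)"
  have \<delta>': "\<delta>' > 0" using \<delta>(1) \<epsilon> by (simp add: \<delta>'_def)
  have "\<exists>x\<in>V. dist ((1 / t) *\<^sub>R x) v < \<epsilon>" if t: "t > 2 / \<delta>" for t
  proof -
    have t0: "t > 0" using t \<delta>(1) by (meson divide_pos_pos less_trans zero_less_numeral)
    let ?t = "complex_of_real t"
    have "t * \<delta>' > 0" using t0 \<delta>' by simp
    \<comment> \<open>The base point is moved off the zeros of \<open>a\<close> at full scale; after
      division by \<open>t\<close> the displacement is below \<open>\<delta>'\<close>.\<close>
    then obtain u where u: "u \<in> coord_space ?D" "dist u (?t *s y0) < t * \<delta>'" "a u \<noteq> 0"
      using coord_space_dense[OF a coord_space_smult[OF y0]] by blast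
    define y where "y = (1 / ?t) *s u"
    have uy: "u = ?t *s y" using t0 by (simp add: y_def)
    have "dist u (?t *s y0) = t * dist y y0"
    proof -
      have "u - ?t *s y0 = ?t *s (y - y0)" by (simp add: uy vec_eq_iff algebra_simps)
      then have "norm (u - ?t *s y0) = norm (?t *s (y - y0))" by (rule arg_cong)
      then show ?thesis using t0 unfolding dist_norm norm_vec_smult by simp
    qed
    then have yy0: "dist y y0 < \<delta>'" using u(2) t0 by simp
    have "dist (1 / ?t, y + (v $ i) *s e) (0, v) \<le> norm (1 / ?t) + norm (y - y0)"
    proof -
      have "(1 / ?t, y + (v $ i) *s e) - (0, v) = (1 / ?t, y - y0)" by (subst (2) v_eq) simp
      then show ?thesis unfolding dist_norm by (metis norm_Pair_le)
    qed
    also have "\<dots> < \<delta> / 2 + \<delta> / 2"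
    proof (rule add_strict_mono)
      show "norm (1 / ?t) < \<delta> / 2" using t t0 \<delta>(1) by (simp add: norm_divide field_simps)
      show "norm (y - y0) < \<delta> / 2" using yy0 by (simp add: \<delta>'_def dist_norm)
    qed
    finally have "norm (F (1 / ?t) (y + (v $ i) *s e)) < \<eta> ^ r"
      using \<delta>(2)[of "(1 / ?t, y + (v $ i) *s e)"] by simp
    then have "t ^ r * norm (F (1 / ?t) (y + (v $ i) *s e)) < t ^ r * \<eta> ^ r"
      using t0 by (intro mult_strict_left_mono) auto
    moreover have "F 1 (u + (?t * v $ i) *s e) = ?t ^ r * F (1 / ?t) (y + (v $ i) *s e)"
    proof -
      have "?t *s (y + (v $ i) *s e) = u + (?t * v $ i) *s e" by (simp add: uy vec_eq_iff algebra_simps)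
      then show ?thesis using homog_poly_scale[OF F(1), of ?t "1 / ?t" "y + (v $ i) *s e"] t0 by simp
    qed
    ultimately have small: "norm (F 1 (u + (?t * v $ i) *s e)) < (t * \<eta>) ^ r"
      using t0 by (simp add: norm_mult norm_power power_mult_distrib)
    obtain q where q: "degree q \<le> r" "coeff q r = F 0 e" "\<And>z. poly q z = F 1 (u + z *s e)"
      by (rule homog_poly_line_poly[OF F(1), where v = e and y = u]) blast
    have degq: "degree q = r" using q(1,2) F(2) by (metis le_degree order_antisym zero_neq_one)
    obtain z where z: "poly q z = 0" "norm (z - ?t * v $ i) < t * \<eta>"
      using root_near[of q "t * \<eta>" "?t * v $ i"] degq q F(2) small t0 \<eta> by auto
    have "u + z *s e \<in> V" by (rule cut[OF u(1,3)]) (use z(1) q(3) in simp)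
    moreover have "dist ((1 / t) *\<^sub>R (u + z *s e)) v < \<epsilon>"
    proof -
      have "(1 / t) *\<^sub>R (u + z *s e) - v = (y - y0) + ((1 / ?t) * (z - ?t * v $ i)) *s e"
        using t0 by (subst v_eq) (simp add: uy scaleR_conv_smult vec_eq_iff field_simps)
      then have "dist ((1 / t) *\<^sub>R (u + z *s e)) v \<le> norm (y - y0) + norm (((1 / ?t) * (z - ?t * v $ i)) *s e)"
        unfolding dist_norm by (simp add: norm_triangle_ineq)
      also have "norm (((1 / ?t) * (z - ?t * v $ i)) *s e) \<le> \<eta> * norm e"
      proof -
        have "norm ((1 / ?t) * (z - ?t * v $ i)) \<le> \<eta>"
          using z(2) t0 by (simp add: norm_mult norm_divide field_simps)
        then show ?thesis unfolding norm_vec_smult by (rule mult_right_mono) simp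
      qed
      also have "norm (y - y0) + \<eta> * norm e < \<epsilon> / 2 + \<epsilon> / 2"
        using yy0 \<eta>e by (intro add_less_le_mono) (auto simp: \<delta>'_def dist_norm)
      finally show ?thesis by simp
    qed
    ultimately show ?thesis by blast
  qed
  then show "\<forall>\<^sub>F t in at_top. \<exists>x\<in>V. dist ((1 / t) *\<^sub>R x) v < \<epsilon>"
    using eventually_gt_at_top[of "2 / \<delta>"] by (rule eventually_mono[rotated])
qed

text \<open>Let \<open>W\<close> be the part of \<open>V\<close> over the zeros of \<open>a\<close>.
  A vector in the cone of \<open>W\<close> is reached by points of \<open>W\<close>, which has
  codimension at least two; any other vector of the cone is a zero of the leading form of the monic
  relation.\<close>

lemma leading_cone_subset_inner_cone:
  fixes V :: "(complex ^ 'n::finite) set"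
  assumes "algebraic_set V" "V \<subseteq> coord_space D"
  shows "leading_cone V \<subseteq> inner_cone V"
  using finite[of D] assms
proof (induction D arbitrary: V rule: finite_psubset_induct)
  case (psubset D)
  note V = psubset.prems
  have IH: "leading_cone W \<subseteq> inner_cone W" if "i \<in> D" "algebraic_set W" "W \<subseteq> coord_space (D - {i})" for i W
    using psubset.IH[of "D - {i}" W] that by blast
  show ?case
  proof
    fix v assume v: "v \<in> leading_cone V"
    have vD: "v \<in> coord_space D" using v leading_cone_subset_coord_space[OF V(2)] by blast
    have ne: "V \<noteq> {}" using v leading_cone_empty by auto
    show "v \<in> inner_cone V"
    proof (cases "V = coord_space D")
      case True
      have "\<exists>x\<in>V. dist ((1 / t) *\<^sub>R x) v < \<epsilon>" if "t > 0" "\<epsilon> > 0" for t \<epsilon> :: real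
        using that coord_space_smult[OF vD, of "of_real t"] True
        by (intro bexI[of _ "of_real t *s v"]) (auto simp: scaleR_conv_smult)
      then show ?thesis unfolding inner_cone_def
        by (auto intro: eventually_mono[OF eventually_gt_at_top[of 0]])
    next
      case False
      then obtain p where p: "p \<in> coord_space D" "p \<notin> V" using V(2) by blast
      obtain f where f: "poly_fun f" "\<And>x. x \<in> V \<Longrightarrow> f x = 0" "f p \<noteq> 0"
        using algebraic_setE[OF V(1) p(2)] by blast
      obtain e0 where e0: "e0 \<in> coord_space D" "e0 \<notin> leading_cone V"
        using direction_off_leading_cone[OF f(1) _ V(2) p(1) f(3)] f(2) by blast
      obtain i e where e: "i \<in> D" "e $ i = 1" "e \<in> coord_space D" "e \<notin> leading_cone V"
        using normalize_direction[OF e0 ne] by blast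
      let ?D = "D - {i}"
      obtain a b r F where a: "poly_fun a" "b \<in> coord_space ?D" "a b \<noteq> 0" and F: "homog_poly r F" "F 0 e = 1"
        and FV: "\<And>x. x \<in> V \<Longrightarrow> a (proj_along i e x) \<noteq> 0 \<Longrightarrow> F 1 x = 0"
        and cut: "\<And>y z. y \<in> coord_space ?D \<Longrightarrow> a y \<noteq> 0 \<Longrightarrow> F 1 (y + z *s e) = 0 \<Longrightarrow> y + z *s e \<in> V"
        by (rule monic_relation[OF V e(2-4) f(1,2) p(1) f(3)]) blast+
      define W where "W = V \<inter> {x. a (proj_along i e x) = 0}"
      show ?thesis
      proof (cases "v \<in> leading_cone W")
        case True
        then have Wne: "W \<noteq> {}" using leading_cone_empty by auto
        let ?Y = "{y \<in> coord_space ?D. a y = 0}"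
        have pW: "proj_along i e ` W \<subseteq> ?Y"
          using V(2) e by (auto simp: W_def intro: proj_along_coord_space)
        then have "\<exists>y\<in>coord_space ?D. a y = 0" using Wne by blast
        from growth_zero_set_coord_space[OF a this] have gY: "card ?D \<ge> 1" "growth ?Y (card ?D - 1)" by auto
        obtain m h where h: "homog_poly m h" "\<And>x. x \<in> V \<Longrightarrow> h 1 x = 0" "h 0 e \<noteq> 0"
          using e(4) by (rule not_leading_coneE) blast
        have "growth W (card ?D - 1)"
          by (rule growth_proj_along[OF h(1) _ h(3) e(2) growth_mono[OF gY(2) pW]]) (simp add: h(2) W_def)
        moreover have "algebraic_set W" unfolding W_def
          by (intro algebraic_Int V algebraic_zero_set poly_fun_proj_along a)
        moreover have "W \<subseteq> coord_space D" using V(2) by (auto simp: W_def)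
        \<comment> \<open>\<open>W\<close> projects into a hypersurface of a subspace with one
          coordinate less than \<open>D\<close>, so two dimensions are lost; \<open>gY(1)\<close>
          rules out truncation.\<close>
        moreover have "card ?D - 1 + 2 \<le> card D" using gY(1) e(1) by (simp add: card_Diff_singleton)
        ultimately have "leading_cone W \<subseteq> inner_cone W" using leading_cone_subset_inner_cone_small IH by blast
        moreover have "inner_cone W \<subseteq> inner_cone V" by (rule inner_cone_mono) (simp add: W_def)
        ultimately show ?thesis using True by blast
      next
        case False
        then obtain k h where h: "homog_poly k h" "\<And>x. x \<in> W \<Longrightarrow> h 1 x = 0" "h 0 v \<noteq> 0"
          by (rule not_leading_coneE) blast
        \<comment> \<open>\<open>h\<close> vanishes on \<open>W\<close> and \<open>F\<close> on the
          rest of \<open>V\<close>, so the product vanishes on \<open>V\<close> and its leading form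
          at \<open>v\<close>.\<close>
        have "h 0 v * F 0 v = 0"
          by (rule leading_coneD[OF v homog_poly_mult[OF h(1) F(1)]]) (use h(2) FV in \<open>auto simp: W_def\<close>)
        then have "F 0 v = 0" using h(3) by simp
        then show ?thesis using root_of_leading_form_in_inner_cone[OF e(2,3) a F _ vD cut] by blast
      qed
    qed
  qed
qed

section \<open>Comparison of dimensions\<close>

text \<open>\<open>compactness\<close> lifts only limits of rescaled points, hence the detour
  through \<open>inner_cone\<close> for the second inclusion.\<close>

lemma proj_along_leading_cone_eq:
  fixes V :: "(complex ^ 'n::finite) set"
  assumes "algebraic_set V" "e \<notin> leading_cone V" "e $ i = 1"
  shows "proj_along i e ` leading_cone V = leading_cone (proj_along i e ` V)"
proof
  show "proj_along i e ` leading_cone V \<subseteq> leading_cone (proj_along i e ` V)" using proj_along_leading_cone by blast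
  obtain m f where f: "homog_poly m f" "\<And>x. x \<in> V \<Longrightarrow> f 1 x = 0" "f 0 e \<noteq> 0"
    using assms(2) by (rule not_leading_coneE) blast
  have "algebraic_set (proj_along i e ` V)" by (rule algebraic_proj_along_image[OF assms(1) f assms(3)])
  then have "leading_cone (proj_along i e ` V) \<subseteq> inner_cone (proj_along i e ` V)"
    by (rule leading_cone_subset_inner_cone[where D = UNIV]) (simp add: coord_space_UNIV)
  then show "leading_cone (proj_along i e ` V) \<subseteq> proj_along i e ` leading_cone V" using proj_along_leading_cone_surj[OF assms(2,3)] by blast
qed

text \<open>One number \<open>d\<close> is carried for both sets, each with a growth bound from
  above and a chain from below. The induction removes coordinates until \<open>V\<close> is a full
  coordinate subspace, which is its own cone.\<close>

lemma dimension_of_leading_cone: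
  fixes V :: "(complex ^ 'n::finite) set"
  assumes "algebraic_set V" "V \<noteq> {}" "V \<subseteq> coord_space D"
  shows "\<exists>d Y Z. growth V d \<and> irr_chain d Y \<and> Y d \<subseteq> V \<and>
    growth (leading_cone V) d \<and> irr_chain d Z \<and> Z d \<subseteq> leading_cone V"
  using finite[of D] assms
proof (induction D arbitrary: V rule: finite_psubset_induct)
  case (psubset D)
  note V = psubset.prems
  show ?case
  proof (cases "V = coord_space D")
    case True
    obtain Z where Z: "irr_chain (card D) Z" "Z (card D) = coord_space D" by (rule irr_chain_coord_space)
    show ?thesis unfolding True leading_cone_coord_space
      by (intro exI[of _ "card D"] exI[of _ Z] conjI growth_coord_space Z) (simp_all add: Z)
  next
    case False
    then obtain p where p: "p \<in> coord_space D" "p \<notin> V" using V(3) by blast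
    obtain f where f: "poly_fun f" "\<And>x. x \<in> V \<Longrightarrow> f x = 0" "f p \<noteq> 0"
      using algebraic_setE[OF V(1) p(2)] by blast
    obtain e0 where e0: "e0 \<in> coord_space D" "e0 \<notin> leading_cone V"
      using direction_off_leading_cone[OF f(1) _ V(3) p(1) f(3)] f(2) by blast
    obtain i e where e: "i \<in> D" "e $ i = 1" "e \<in> coord_space D" "e \<notin> leading_cone V"
      using normalize_direction[OF e0 V(2)] by blast
    obtain m h where h: "homog_poly m h" "\<And>x. x \<in> V \<Longrightarrow> h 1 x = 0" "h 0 e \<noteq> 0"
      using e(4) by (rule not_leading_coneE) blast
    \<comment> \<open>The direction stays admissible for the cone, but the polynomial witnessing
      this is obtained anew, since \<open>h\<close> need not vanish on the cone.\<close>
    have "e \<notin> leading_cone (leading_cone V)" using e(4) by (simp add: leading_cone_idem)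
    then obtain m' h' where h': "homog_poly m' h'" "\<And>x. x \<in> leading_cone V \<Longrightarrow> h' 1 x = 0" "h' 0 e \<noteq> 0"
      by (rule not_leading_coneE) blast
    let ?W = "proj_along i e ` V"
    have W: "algebraic_set ?W" by (rule algebraic_proj_along_image[OF V(1) h e(2)])
    have WD: "?W \<subseteq> coord_space (D - {i})" using V(3) e by (auto intro: proj_along_coord_space)
    have eq: "proj_along i e ` leading_cone V = leading_cone ?W" by (rule proj_along_leading_cone_eq[OF V(1) e(4,2)])
    obtain d Y Z where IH: "growth ?W d" "irr_chain d Y" "Y d \<subseteq> ?W"
      "growth (leading_cone ?W) d" "irr_chain d Z" "Z d \<subseteq> leading_cone ?W"
      using psubset.IH[of "D - {i}" ?W] W WD V(2) e(1) by blast
    have g1: "growth V d" by (rule growth_proj_along[OF h e(2) IH(1)])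
    have g2: "growth (leading_cone V) d" by (rule growth_proj_along[OF h' e(2)]) (simp_all add: eq IH(4))
    obtain Y' where Y': "irr_chain d Y'" "Y' d \<subseteq> V"
      by (rule irr_chain_lift[OF h e(2) V(1) IH(2,3)]) blast+
    have Z1: "Z d \<subseteq> proj_along i e ` leading_cone V" using IH(6) eq by simp
    obtain Z' where Z': "irr_chain d Z'" "Z' d \<subseteq> leading_cone V"
      by (rule irr_chain_lift[OF h' e(2) algebraic_leading_cone IH(5) Z1]) blast+
    show ?thesis using g1 g2 Y' Z' by blast
  qed
qed

lemma algebraic_dim_leading_cone:
  fixes V :: "(complex ^ 'n::finite) set"
  assumes "algebraic_set V" "V \<noteq> {}"
  shows "algebraic_dim (leading_cone V) = algebraic_dim V"
proof -
  obtain d Y Z where d: "growth V d" "irr_chain d Y" "Y d \<subseteq> V"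
    "growth (leading_cone V) d" "irr_chain d Z" "Z d \<subseteq> leading_cone V"
    using dimension_of_leading_cone[OF assms, of UNIV] by (auto simp: coord_space_UNIV)
  have "algebraic_dim V = enat d"
    using algebraic_dim_le[OF d(1)] algebraic_dim_ge[OF d(2,3)] by (rule order_antisym)
  moreover have "algebraic_dim (leading_cone V) = enat d"
    using algebraic_dim_le[OF d(4)] algebraic_dim_ge[OF d(5,6)] by (rule order_antisym)
  ultimately show ?thesis by simp
qed

text \<open>Both inclusions hold for every sequence of scales, so uniqueness of the tangent cone
  comes with its description and determines the value of \<open>THE\<close>.\<close>

lemma tangent_cone_at_infinity_eq_leading_cone:
  fixes V :: "(complex ^ 'n::finite) set"
  assumes "algebraic_set V"
  shows "tangent_cone_at_infinity V = leading_cone V"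
proof (rule tangent_cone_at_infinity_eqI)
  have inner: "leading_cone V \<subseteq> inner_cone V"
    using leading_cone_subset_inner_cone[OF assms, of UNIV] by (simp add: coord_space_UNIV)
  show "is_unique_tangent_cone V (leading_cone V)"
    unfolding is_unique_tangent_cone_def
  proof (intro allI impI set_eqI iffI)
    fix T v assume T: "tends_to_infinity T"
    then have lim: "filterlim T at_top sequentially" by (simp add: tends_to_infinity_def)
    show "v \<in> leading_cone V" if "v \<in> tangents_at_infinity T V"
      using that limit_in_leading_cone[OF _ lim] by (auto simp: tangents_at_infinity_def)
    show "v \<in> tangents_at_infinity T V" if vC: "v \<in> leading_cone V"
    proof -
      obtain x where "\<And>j. x j \<in> V" "(\<lambda>j. (1 / T j) *\<^sub>R x j) \<longlonglongrightarrow> v"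
        using inner_cone_sequence[OF subsetD[OF inner vC] lim] by blast
      then show ?thesis by (auto simp: tangents_at_infinity_def)
    qed
  qed
qed

theorem proposition2p10:
  fixes V :: "(complex ^ 'n::finite) set"
  assumes "algebraic_set V" and "\<not> bounded V"
  shows "algebraic_dim V = algebraic_dim (tangent_cone_at_infinity V)"
proof -
  have "V \<noteq> {}" using assms(2) by auto
  with assms(1) show ?thesis
    by (simp add: tangent_cone_at_infinity_eq_leading_cone algebraic_dim_leading_cone)
qed

end
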